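(* Let $0<\lambda<\mu$ and consider the Poisson matching problem $PM(\lambda,\mu)$ (defined in the context), with stable matching $\mathcal{M}_s$. Let $X$ be the matching distance in $\mathcal{M}_s$ of an arbitrary (typical) blue point. Then $$\mathbb{E}(X)\le\left(1+\ln\Bigl(\frac{\mu+\lambda}{\mu-\lambda}\Bigr)\right)\frac{1}{\mu-\lambda}.$$
   Context: Poisson matching problem $PM(\lambda,\mu)$: $\mathcal{B}$ (blue points) and $\mathcal{R}$ (red points) are independent homogeneous Poisson point processes on $\mathbb{R}$ of intensities $\lambda$ and $\mu$ respectively. A matching is a map $\mathcal{M}:\mathcal{B}\cup\mathcal{R}\to\mathcal{B}\cup\mathcal{R}\cup\{\infty\}$ with $\mathcal{M}(r)\in\mathcal{B}\cup\{\infty\}$ for red $r$, $\mathcal{M}(b)\in\mathcal{R}\cup\{\infty\}$ for blue $b$, and $\mathcal{M}(r)=b$ iff $\mathcal{M}(b)=r$. A matching is stable if there is no pair $(b,r)$ with $b\ne\mathcal{M}(r)$ and $|r-b|<\min(|r-\mathcal{M}(r)|,|b-\mathcal{M}(b)|)$. $\mathcal{M}_s$ is the stable matching produced by the following procedure: every blue point simultaneously emits two rays, one in each direction, each at distance $t$ from its emitter at time $t$; when a ray hits an unmatched red point $r$, the emitter $b$ is matched to $r$ and both leave the system. The matching distance of $x$ is $|x-\mathcal{M}_s(x)|$. *)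

theory Defs
  imports "HOL-Probability.Probability"
begin

definition npts :: "real set \<Rightarrow> real \<Rightarrow> real \<Rightarrow> nat" where
  "npts S a b = card (S \<inter> {a<..b})"

definition disj_intervals :: "nat \<Rightarrow> (nat \<Rightarrow> real) \<Rightarrow> (nat \<Rightarrow> real) \<Rightarrow> bool" where
  "disj_intervals n a b \<longleftrightarrow> (\<forall>i<n. a i < b i) \<and>
     (\<forall>i<n. \<forall>j<n. i \<noteq> j \<longrightarrow> {a i<..b i} \<inter> {a j<..b j} = {})"

text \<open>The random configurations B and R (on the probability space M) are independent
  homogeneous Poisson point processes on the real line with intensities lam and mu:
  they are locally finite, the number of points in an interval of length l is Poisson
  with mean (intensity * l), and the counts of B on any finite family of disjoint intervals
  together with the counts of R on any finite family of disjoint intervals are mutually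
  independent (this expresses both the independent-increment property of each process
  and the independence of the two processes).\<close>
definition poisson_count :: "'a measure \<Rightarrow> real \<Rightarrow> ('a \<Rightarrow> real set) \<Rightarrow> bool" where
  "poisson_count M c N \<longleftrightarrow>
     (\<forall>\<omega>\<in>space M. \<forall>a b. finite (N \<omega> \<inter> {a..b})) \<and>
     (\<forall>a b. a < b \<longrightarrow>
        (\<lambda>\<omega>. npts (N \<omega>) a b) \<in> measurable M (count_space UNIV) \<and>
        (\<forall>k::nat. measure M {\<omega>\<in>space M. npts (N \<omega>) a b = k}
                   = (c * (b - a)) ^ k / fact k * exp (- (c * (b - a)))))"

definition indep_poisson_processes ::
    "'a measure \<Rightarrow> real \<Rightarrow> real \<Rightarrow> ('a \<Rightarrow> real set) \<Rightarrow> ('a \<Rightarrow> real set) \<Rightarrow> bool" where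
  "indep_poisson_processes M lam mu B R \<longleftrightarrow>
     prob_space M \<and> poisson_count M lam B \<and> poisson_count M mu R \<and>
     (\<forall>n a b m c d. disj_intervals n a b \<longrightarrow> disj_intervals m c d \<longrightarrow>
        prob_space.indep_vars M (\<lambda>_. count_space (UNIV :: nat set))
          (\<lambda>i \<omega>. case i of Inl k \<Rightarrow> npts (B \<omega>) (a k) (b k) | Inr k \<Rightarrow> npts (R \<omega>) (c k) (d k))
          ({..<n} <+> {..<m}))"

text \<open>A matching of blue points Bl and red points Rd: Mt x = Some y means x is matched to y,
  Mt x = None means x is unmatched (matched to infinity). Points outside Bl \<union> Rd are
  mapped to None (normalisation).\<close>
definition is_matching :: "real set \<Rightarrow> real set \<Rightarrow> (real \<Rightarrow> real option) \<Rightarrow> bool" where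
  "is_matching Bl Rd Mt \<longleftrightarrow>
     (\<forall>x. x \<notin> Bl \<union> Rd \<longrightarrow> Mt x = None) \<and>
     (\<forall>b\<in>Bl. \<forall>y. Mt b = Some y \<longrightarrow> y \<in> Rd) \<and>
     (\<forall>r\<in>Rd. \<forall>y. Mt r = Some y \<longrightarrow> y \<in> Bl) \<and>
     (\<forall>b\<in>Bl. \<forall>r\<in>Rd. Mt r = Some b \<longleftrightarrow> Mt b = Some r)"

definition mdist :: "(real \<Rightarrow> real option) \<Rightarrow> real \<Rightarrow> ennreal" where
  "mdist Mt x = (case Mt x of None \<Rightarrow> \<infinity> | Some y \<Rightarrow> ennreal \<bar>x - y\<bar>)"

definition is_stable :: "real set \<Rightarrow> real set \<Rightarrow> (real \<Rightarrow> real option) \<Rightarrow> bool" where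
  "is_stable Bl Rd Mt \<longleftrightarrow> is_matching Bl Rd Mt \<and>
     (\<forall>b\<in>Bl. \<forall>r\<in>Rd. Mt r \<noteq> Some b \<longrightarrow>
        \<not> (ennreal \<bar>r - b\<bar> < min (mdist Mt r) (mdist Mt b)))"

text \<open>The stable matching M_s (produced by the two-sided ray procedure, which yields the
  almost surely unique stable matching).\<close>
definition stable_matching :: "real set \<Rightarrow> real set \<Rightarrow> real \<Rightarrow> real option" where
  "stable_matching Bl Rd = (THE Mt. is_stable Bl Rd Mt)"

text \<open>Matching distance of the typical blue point: by Slivnyak's theorem the Palm
  version of the blue Poisson process is obtained by adding a point at the origin.\<close>
definition typical_blue_dist :: "real set \<Rightarrow> real set \<Rightarrow> ennreal" where
  "typical_blue_dist Bl Rd = mdist (stable_matching (insert 0 Bl) Rd) 0"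

end

theory Submission
  imports Defs
begin

text \<open>
  Let X be the matching distance and let W be the walk that goes up at blue points and down at red
  points. Up-steps of W are grouped by the level they reach. Suppose that a blue point b has no
  partner within distance t. Stability forces the red points near b to be matched among
  themselves with blue points, so W is at least W(b) at some point beyond b + t and below W(b) at some
  point before b - t; moreover two such blue points at distance at most 2 t lie on different levels.
  Hence on a level with N up-steps whose span (from the first visit below the level to the last
  visit at or above it) has length S at most S / (2 t) up-steps satisfy X > t, and the sum of X over
  the level is at most S / 2 times the N-th harmonic number. Bounding this number by
  ln c + N / c for c = (mu + lam) / (mu - lam), it remains to count, at a typical site, the
  levels whose span covers it and the up-steps of these levels; both expectations are first-moment
  computations for a random walk with drift.

  Ergodic averages and Palm calculus are avoided by cutting the line into cells of
  mesh h: the cells form an i.i.d. sequence of symbols, on which the estimate above is a statement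
  about finite lists, and off an event whose probability vanishes as h tends to 0 the greedy
  matching of the cells agrees with the stable matching up to a given distance.
\<close>

section \<open>Greedy matching of a colouring of the integers\<close>

text \<open>Let p and q be the probabilities of a blue and a red letter. The constant c is a
  size-biased mean: the levels whose span covers a site number at most 2 p / (q - p) on average,
  their up-steps at most 2 p (p + q) / (q - p)^2, and the quotient of the two bounds is c = (p + q)
  / (q - p). As ln c + m / c is least at c = m, this is the best line above the logarithm, and it
  yields 1 + ln c. Levels above the current height and levels at or below it contribute equally; the
  resulting 2 cancels the half in S / 2, and division by the density p leaves (1 + ln c) / (q - p).

  The obstacle on the real line is that a chain of ever shorter competing edges may run off to
  infinity, so local finiteness alone settles neither existence nor uniqueness of the stable
  matching. Empty intervals of every length on both sides stop such chains. They also isolate the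
  window in which points and cells are compared: agreement of cells with points is likely only in a
  bounded region, whereas a stable matching is a global object.\<close>

text \<open>
  The last bit breaks ties between a red point to the right and one to the left, so that
  two edges sharing an endpoint always have different keys; hence the greedy matching is given by a
  recursion on the key, without any genericity assumption.
\<close>

definition edge_key :: "int \<Rightarrow> int \<Rightarrow> nat" where
  "edge_key i j = nat (2 * \<bar>i - j\<bar> + (if j < i then 1 else 0))"

function dmatch :: "(int \<Rightarrow> int) \<Rightarrow> int \<Rightarrow> int \<Rightarrow> bool" where
  "dmatch s i j \<longleftrightarrow> s i = 1 \<and> s j = -1 \<and>
     (\<forall>j'. edge_key i j' < edge_key i j \<longrightarrow> \<not> dmatch s i j') \<and>
     (\<forall>i'. edge_key i' j < edge_key i j \<longrightarrow> \<not> dmatch s i' j)"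
  by pat_completeness auto
termination by (relation "Wellfounded.measure (\<lambda>(s, i, j). edge_key i j)") auto

declare dmatch.simps [simp del]

lemma edge_key_inj_red: "edge_key i j = edge_key i j' \<Longrightarrow> j = j'"
  by (auto simp: edge_key_def eq_nat_nat_iff split: if_splits) presburger+

lemma edge_key_inj_blue: "edge_key i j = edge_key i' j \<Longrightarrow> i = i'"
  by (auto simp: edge_key_def eq_nat_nat_iff split: if_splits) presburger+

lemma edge_key_less_abs: "edge_key i j < edge_key i' j' \<Longrightarrow> \<bar>i - j\<bar> \<le> \<bar>i' - j'\<bar>"
  unfolding edge_key_def by (auto split: if_splits)

lemma abs_less_edge_key: "\<bar>i - j\<bar> < \<bar>i' - j'\<bar> \<Longrightarrow> edge_key i j < edge_key i' j'"
  unfolding edge_key_def by (auto split: if_splits)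

lemma dmatchD: "dmatch s i j \<Longrightarrow> s i = 1 \<and> s j = -1"
  by (subst (asm) dmatch.simps) simp

lemma dmatch_unique_red: "dmatch s i j \<Longrightarrow> dmatch s i j' \<Longrightarrow> j = j'"
  by (metis dmatch.simps edge_key_inj_red linorder_neqE_nat)

lemma dmatch_unique_blue: "dmatch s i j \<Longrightarrow> dmatch s i' j \<Longrightarrow> i = i'"
  by (metis dmatch.simps edge_key_inj_blue linorder_neqE_nat)

section \<open>Blue positions that have no partner within distance D\<close>

definition alive :: "(int \<Rightarrow> int) \<Rightarrow> nat \<Rightarrow> int \<Rightarrow> bool" where
  "alive s D i \<longleftrightarrow> s i = 1 \<and> (\<forall>j. \<bar>i - j\<bar> \<le> int D \<longrightarrow> \<not> dmatch s i j)"

text \<open>An edge between a blue and a red position can only be blocked by a matched edge of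
  smaller key at one of its ends; the end i is excluded by hypothesis, so the blocking edge sits at
  j.\<close>

lemma red_taken:
  assumes "s j = -1" "s i = 1" "\<And>j'. edge_key i j' \<le> edge_key i j \<Longrightarrow> \<not> dmatch s i j'"
  obtains i' where "dmatch s i' j" "i' \<noteq> i" "\<bar>i' - j\<bar> \<le> \<bar>i - j\<bar>"
proof -
  have "\<not> dmatch s i j" using assms(3) by simp
  then obtain i' where "edge_key i' j < edge_key i j" "dmatch s i' j"
    using assms by (subst (asm) dmatch.simps) (auto dest: less_imp_le)
  then show ?thesis using that edge_key_less_abs by blast
qed

lemma red_taken_near_alive:
  assumes "alive s D i" "s j = -1" "\<bar>i - j\<bar> \<le> int D"
  obtains i' where "dmatch s i' j" "i' \<noteq> i" "\<bar>i' - j\<bar> \<le> \<bar>i - j\<bar>"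
proof (rule red_taken[of s j i])
  show "s i = 1" "s j = -1" using assms by (auto simp: alive_def)
  show "\<not> dmatch s i j'" if "edge_key i j' \<le> edge_key i j" for j'
    using that assms edge_key_less_abs[of i j' i j] edge_key_inj_red[of i j' j]
    unfolding alive_def le_less by fastforce
qed (use that in blast)

text \<open>Taking partners injects the reds of A into the blues of A.\<close>

lemma sum_nonneg_if_reds_matched:
  assumes "finite A" "\<And>x. x \<in> A \<Longrightarrow> s x \<in> {-1, 0, 1::int}"
    and m: "\<And>j. j \<in> A \<Longrightarrow> s j = -1 \<Longrightarrow> \<exists>i\<in>A. dmatch s i j"
  shows "0 \<le> sum s A"
proof -
  have "sum s A = (\<Sum>x\<in>A. (if s x = 1 then 1 else 0) - (if s x = -1 then 1 else 0))"
    by (rule sum.cong) (use assms(2) in force)+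
  also have "\<dots> = int (card {x\<in>A. s x = 1}) - int (card {x\<in>A. s x = -1})"
    using assms(1) by (simp add: sum_subtractf sum.If_cases Int_def conj_commute)
  finally have *: "sum s A = int (card {x\<in>A. s x = 1}) - int (card {x\<in>A. s x = -1})" .
  obtain g where g: "\<And>j. j \<in> A \<Longrightarrow> s j = -1 \<Longrightarrow> g j \<in> A \<and> dmatch s (g j) j"
    using m by metis
  have "inj_on g {x\<in>A. s x = -1}"
    by (rule inj_onI) (metis (mono_tags, lifting) dmatch_unique_red g mem_Collect_eq)
  moreover have "g ` {x\<in>A. s x = -1} \<subseteq> {x\<in>A. s x = 1}"
    using g dmatchD by fast
  ultimately have "card {x\<in>A. s x = -1} \<le> card {x\<in>A. s x = 1}"
    using assms(1) by (intro card_inj_on_le[of g]) auto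
  then show ?thesis using * by simp
qed



text \<open>Every red within D of i holds a blue point nearer than i. Such blue points lie on the
  same side of i but may stick out beyond D; the set \<open>P\<close> collects those, and the window
  is stretched to the farthest of them. It lies within 2 D because its distance to its red partner
  is at most that of i. The sign e treats both directions at once.\<close>

lemma alive_one_sided:
  fixes e :: int
  assumes al: "alive s D i" and s: "\<And>x. s x \<in> {-1, 0, 1::int}" and e: "e = 1 \<or> e = -1"
  shows "\<exists>m. int D \<le> m \<and> m \<le> 2 * int D \<and> 0 \<le> sum s {y. 0 < e * (y - i) \<and> e * (y - i) \<le> m}"
proof -
  define P where "P = {b. e * (b - i) > int D \<and> (\<exists>r. 0 < e * (r - i) \<and> e * (r - i) \<le> int D \<and> dmatch s b r)}"
  define pos where "pos y = e * (y - i)" for y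
  have absd: "\<bar>x - y\<bar> = \<bar>pos x - pos y\<bar>" for x y using e by (auto simp: pos_def)
  have posi: "pos i = 0" by (simp add: pos_def)
  have inj: "pos x = pos y \<longleftrightarrow> x = y" for x y using e by (auto simp: pos_def)
  have taken: "\<exists>b. dmatch s b r \<and> 0 < pos b \<and> pos b \<le> 2 * pos r \<and> pos b - pos r \<le> pos r"
    if "s r = -1" "0 < pos r" "pos r \<le> int D" for r
  proof -
    have "\<bar>i - r\<bar> \<le> int D" using that absd[of i r] posi by simp
    from red_taken_near_alive[OF al that(1) this] obtain b
      where b: "dmatch s b r" "b \<noteq> i" "\<bar>b - r\<bar> \<le> \<bar>i - r\<bar>" .
    have "pos b \<noteq> 0" using b(2) inj posi by metis
    then show ?thesis using b(1,3) absd[of b r] absd[of i r] posi that(2) by (intro exI[of _ b]) auto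
  qed
  have fin: "finite {y. 0 < pos y \<and> pos y \<le> m}" for m
    by (rule finite_subset[of _ "{i - \<bar>m\<bar>..i + \<bar>m\<bar>}"]) (use e in \<open>auto simp: pos_def\<close>)
  show ?thesis
  proof (cases "P = {}")
    case True
    have "0 \<le> sum s {y. 0 < pos y \<and> pos y \<le> int D}"
    proof (rule sum_nonneg_if_reds_matched[OF fin s])
      fix j assume j: "j \<in> {y. 0 < pos y \<and> pos y \<le> int D}" "s j = -1"
      then obtain b where b: "dmatch s b j" "0 < pos b" using taken by blast
      have "b \<notin> P" using True by simp
      with b j have "pos b \<le> int D" unfolding P_def pos_def by (force simp: not_less)
      then show "\<exists>i\<in>{y. 0 < pos y \<and> pos y \<le> int D}. dmatch s i j" using b by auto
    qed
    then show ?thesis by (intro exI[of _ "int D"]) (simp add: pos_def)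
  next
    case False
    have Pfact: "\<exists>r. dmatch s b r \<and> 0 < pos r \<and> pos r \<le> int D \<and> pos b \<le> 2 * pos r \<and> pos b > int D"
      if bP: "b \<in> P" for b
    proof -
      obtain r where r: "0 < pos r" "pos r \<le> int D" "dmatch s b r" "pos b > int D"
        using bP by (auto simp: P_def pos_def)
      obtain b' where "dmatch s b' r" "pos b' \<le> 2 * pos r"
        using taken[of r] r dmatchD by blast
      moreover then have "b' = b" using r dmatch_unique_blue by blast
      ultimately show ?thesis using r by blast
    qed
    have "P \<subseteq> {y. 0 < pos y \<and> pos y \<le> 2 * int D}" using Pfact by fastforce
    then have finP: "finite P" using fin finite_subset by blast
    obtain u where u: "u \<in> P" "\<And>b. b \<in> P \<Longrightarrow> pos b \<le> pos u"
    proof -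
      have "Max (pos ` P) \<in> pos ` P" using False finP by simp
      then obtain u where "u \<in> P" "pos u = Max (pos ` P)" by auto
      then show ?thesis using that finP by auto
    qed
    obtain r0 where r0: "dmatch s u r0" "0 < pos r0" "pos r0 \<le> int D" "pos u \<le> 2 * pos r0" "pos u > int D"
      using Pfact[OF u(1)] by blast
    have "0 \<le> sum s {y. 0 < pos y \<and> pos y \<le> pos u}"
    proof (rule sum_nonneg_if_reds_matched[OF fin s])
      fix j assume j: "j \<in> {y. 0 < pos y \<and> pos y \<le> pos u}" "s j = -1"
      show "\<exists>i\<in>{y. 0 < pos y \<and> pos y \<le> pos u}. dmatch s i j"
      proof (cases "pos j \<le> int D")
        case True
        then obtain b where b: "dmatch s b j" "0 < pos b" using taken j by blast
        have "pos b \<le> pos u"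
        proof (cases "pos b > int D")
          case True
          then have "b \<in> P" using b j \<open>pos j \<le> int D\<close> unfolding P_def pos_def by auto
          then show ?thesis using u by blast
        qed (use r0 in auto)
        then show ?thesis using b by auto
      next
        case False
        \<comment> \<open>The intruder u prefers j to its own partner \<open>r0\<close>, so j holds
          a blue point b at most as far from j as u. Since pos u \<le> 2 D < 2 pos j, the mirror
          image of u in j is still on the positive side of i, and b lies between this image and
          u.\<close>
        have uj: "u \<noteq> j" using j(2) dmatchD[OF r0(1)] by auto
        then have "pos j < pos u" using j inj[of j u] by auto
        then have lt: "\<bar>u - j\<bar> < \<bar>u - r0\<bar>" using absd[of u j] absd[of u r0] False r0 by auto
        obtain b where b: "dmatch s b j" "b \<noteq> u" "\<bar>b - j\<bar> \<le> \<bar>u - j\<bar>"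
        proof (rule red_taken[of s j u])
          show "s j = -1" "s u = 1" using j dmatchD[OF r0(1)] by auto
          show "\<not> dmatch s u j'" if "edge_key u j' \<le> edge_key u j" for j'
            using that abs_less_edge_key[OF lt] dmatch_unique_red[OF r0(1), of j'] by auto
        qed
        have "pos b \<noteq> pos u" using b inj by auto
        then have "pos b < pos u" "pos b > 0"
          using b(3) \<open>pos j < pos u\<close> False r0 absd[of b j] absd[of u j] by auto
        then show ?thesis using b by auto
      qed
    qed
    then show ?thesis using r0 by (intro exI[of _ "pos u"]) (auto simp: pos_def)
  qed
qed

lemma alive_right:
  assumes "alive s D i" "\<And>x. s x \<in> {-1, 0, 1::int}"
  obtains u where "i + int D \<le> u" "u \<le> i + 2 * int D" "0 \<le> sum s {i<..u}"
proof -
  obtain m where m: "int D \<le> m" "m \<le> 2 * int D" "0 \<le> sum s {y. 0 < 1 * (y - i) \<and> 1 * (y - i) \<le> m}"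
    using alive_one_sided[OF assms, of 1] by auto
  have "{y. 0 < 1 * (y - i) \<and> 1 * (y - i) \<le> m} = {i<..i + m}" by auto
  with m show ?thesis by (intro that[of "i + m"]) auto
qed

lemma alive_left:
  assumes "alive s D i" "\<And>x. s x \<in> {-1, 0, 1::int}"
  obtains v where "i - 2 * int D \<le> v" "v \<le> i - int D" "0 \<le> sum s {v..<i}"
proof -
  obtain m where m: "int D \<le> m" "m \<le> 2 * int D" "0 \<le> sum s {y. 0 < -1 * (y - i) \<and> -1 * (y - i) \<le> m}"
    using alive_one_sided[OF assms, of "-1"] by auto
  have "{y. 0 < -1 * (y - i) \<and> -1 * (y - i) \<le> m} = {i - m..<i}" by auto
  with m show ?thesis by (intro that[of "i - m"]) auto
qed

text \<open>A red point in between is within D of one of the two ends and holds a blue point nearer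
  than that end. If this partner lay at or beyond the other end, the red point would also be within
  D of the other end, and the same argument there would put the partner inside.\<close>

lemma alive_between:
  assumes al: "alive s D i" "alive s D i2" "i2 \<le> i + 2 * int D"
    and s: "\<And>x. s x \<in> {-1, 0, 1::int}"
  shows "0 \<le> sum s {i<..<i2}"
proof (rule sum_nonneg_if_reds_matched[OF _ s])
  have dead: "\<not> dmatch s i j" if "\<bar>i - j\<bar> \<le> int D" for j using al that by (auto simp: alive_def)
  have dead2: "\<not> dmatch s i2 j" if "\<bar>i2 - j\<bar> \<le> int D" for j using al that by (auto simp: alive_def)
  fix j assume j: "j \<in> {i<..<i2}" "s j = -1"
  consider "\<bar>i - j\<bar> \<le> int D" | "\<bar>i2 - j\<bar> \<le> int D" using j al(3) by fastforce
  then show "\<exists>i\<in>{i<..<i2}. dmatch s i j"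
  proof cases
    case 1
    obtain b where b: "dmatch s b j" "b \<noteq> i" "\<bar>b - j\<bar> \<le> \<bar>i - j\<bar>"
      using red_taken_near_alive[OF al(1) j(2) 1] .
    have "b < i2"
    proof (rule ccontr)
      assume "\<not> b < i2"
      then have le: "\<bar>i2 - j\<bar> \<le> \<bar>b - j\<bar>" using j by auto
      then have "\<bar>i2 - j\<bar> \<le> int D" using b 1 by linarith
      obtain b' where b': "dmatch s b' j" "b' \<noteq> i2" "\<bar>b' - j\<bar> \<le> \<bar>i2 - j\<bar>"
        using red_taken_near_alive[OF al(2) j(2) \<open>\<bar>i2 - j\<bar> \<le> int D\<close>] .
      have "b' = b" using dmatch_unique_blue b b' by blast
      then show False using b' \<open>\<not> b < i2\<close> j by auto
    qed
    then show ?thesis using b j by (intro bexI[of _ b]) auto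
  next
    case 2
    obtain b where b: "dmatch s b j" "b \<noteq> i2" "\<bar>b - j\<bar> \<le> \<bar>i2 - j\<bar>"
      using red_taken_near_alive[OF al(2) j(2) 2] .
    have "i < b"
    proof (rule ccontr)
      assume "\<not> i < b"
      then have le: "\<bar>i - j\<bar> \<le> \<bar>b - j\<bar>" using j by auto
      then have "\<bar>i - j\<bar> \<le> int D" using b 2 by linarith
      obtain b' where b': "dmatch s b' j" "b' \<noteq> i" "\<bar>b' - j\<bar> \<le> \<bar>i - j\<bar>"
        using red_taken_near_alive[OF al(1) j(2) \<open>\<bar>i - j\<bar> \<le> int D\<close>] .
      have "b' = b" using dmatch_unique_blue b b' by blast
      then show False using b' \<open>\<not> i < b\<close> j by auto
    qed
    then show ?thesis using b j by (intro bexI[of _ b]) auto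
  qed
qed simp

section \<open>Locality and shift invariance of the greedy matching\<close>

text \<open>Each recursive call lowers the key k and moves the endpoints by at most k.\<close>

lemma dmatch_local:
  assumes "\<And>x. \<bar>x - i\<bar> \<le> (int (edge_key i j))\<^sup>2 \<Longrightarrow> s x = s' x"
  shows "dmatch s i j = dmatch s' i j"
  using assms
proof (induction "edge_key i j" arbitrary: i j rule: less_induct)
  case less
  let ?k = "int (edge_key i j)"
  have d: "2 * \<bar>i - j\<bar> \<le> ?k" by (simp add: edge_key_def)
  have "edge_key i j \<le> (edge_key i j)\<^sup>2" by (simp add: power2_eq_square)
  then have ksq: "?k \<le> ?k\<^sup>2" by (simp flip: of_nat_power)
  have "s i = s' i" by (rule less.prems) simp
  moreover have "\<bar>j - i\<bar> \<le> ?k" using d by arith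
  then have "s j = s' j" by (intro less.prems order.trans[OF _ ksq])
  ultimately have ij: "s i = s' i" "s j = s' j" by auto
  have rad: "(int (edge_key a b))\<^sup>2 + ?k \<le> ?k\<^sup>2" if "edge_key a b < edge_key i j" for a b
  proof -
    have "int (edge_key a b) \<le> ?k - 1" "0 \<le> int (edge_key a b)" using that by auto
    then have "(int (edge_key a b))\<^sup>2 \<le> (?k - 1)\<^sup>2" by (rule power_mono)
    also have "\<dots> = ?k\<^sup>2 - 2 * ?k + 1" by (simp add: power2_eq_square algebra_simps)
    finally show ?thesis using that by linarith
  qed
  have 1: "dmatch s i j' = dmatch s' i j'" if "edge_key i j' < edge_key i j" for j'
  proof (rule less.hyps[OF that])
    fix x assume "\<bar>x - i\<bar> \<le> (int (edge_key i j'))\<^sup>2"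
    then show "s x = s' x" using rad[OF that] by (intro less.prems) arith
  qed
  have 2: "dmatch s i' j = dmatch s' i' j" if "edge_key i' j < edge_key i j" for i'
  proof (rule less.hyps[OF that])
    fix x assume "\<bar>x - i'\<bar> \<le> (int (edge_key i' j))\<^sup>2"
    moreover have "\<bar>i' - i\<bar> \<le> ?k" using d edge_key_less_abs[OF that] by arith
    ultimately show "s x = s' x" using rad[OF that] by (intro less.prems) arith
  qed
  show ?case by (subst (1 2) dmatch.simps) (use ij 1 2 in metis)
qed

definition radius :: "nat \<Rightarrow> nat" where "radius D = (2 * D + 1)\<^sup>2"

lemma alive_local:
  assumes "\<And>x. \<bar>x - i\<bar> \<le> int (radius D) \<Longrightarrow> s x = s' x"
  shows "alive s D i = alive s' D i"
proof -
  have "dmatch s i j = dmatch s' i j" if "\<bar>i - j\<bar> \<le> int D" for j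
  proof (rule dmatch_local, rule assms)
    fix x assume *: "\<bar>x - i\<bar> \<le> (int (edge_key i j))\<^sup>2"
    have "edge_key i j \<le> 2 * D + 1" using that by (auto simp: edge_key_def)
    then have "(edge_key i j)\<^sup>2 \<le> radius D" unfolding radius_def by (rule power_mono) simp
    then have "int ((edge_key i j)\<^sup>2) \<le> int (radius D)" by (simp only: of_nat_le_iff)
    with * show "\<bar>x - i\<bar> \<le> int (radius D)" by (simp only: of_nat_power)
  qed
  moreover have "s i = s' i" by (rule assms) simp
  ultimately show ?thesis unfolding alive_def by auto
qed

lemma edge_key_shift: "edge_key (i + a) (j + a) = edge_key i j"
  by (simp add: edge_key_def)

lemma dmatch_shift: "dmatch (\<lambda>x. s (x + a)) i j = dmatch s (i + a) (j + a)"
proof (induction "edge_key i j" arbitrary: i j rule: less_induct)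
  case less
  have "(\<forall>j'. edge_key i j' < edge_key i j \<longrightarrow> \<not> dmatch (\<lambda>x. s (x + a)) i j') \<longleftrightarrow>
     (\<forall>j'. edge_key (i + a) j' < edge_key i j \<longrightarrow> \<not> dmatch s (i + a) j')"
    using less edge_key_shift by (metis diff_add_cancel)
  moreover have "(\<forall>i'. edge_key i' j < edge_key i j \<longrightarrow> \<not> dmatch (\<lambda>x. s (x + a)) i' j) \<longleftrightarrow>
     (\<forall>i'. edge_key i' (j + a) < edge_key i j \<longrightarrow> \<not> dmatch s i' (j + a))"
    using less edge_key_shift by (metis diff_add_cancel)
  ultimately show ?case
    by (subst (1 2) dmatch.simps) (simp add: edge_key_shift)
qed

lemma alive_shift: "alive (\<lambda>x. s (x + a)) D i = alive s D (i + a)"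
  unfolding alive_def dmatch_shift by (metis add_diff_cancel_right diff_add_cancel)

section \<open>Lazy random walks\<close>

text \<open>
  The expectation of F over words of n independent letters, which are 1 (blue) with probability p,
  -1 (red) with probability q, and 0 otherwise.
\<close>

primrec iid_exp :: "real \<Rightarrow> real \<Rightarrow> nat \<Rightarrow> (int list \<Rightarrow> real) \<Rightarrow> real" where
  "iid_exp p q 0 F = F []"
| "iid_exp p q (Suc n) F = p * iid_exp p q n (\<lambda>xs. F (1 # xs)) +
     q * iid_exp p q n (\<lambda>xs. F (-1 # xs)) + (1 - p - q) * iid_exp p q n (\<lambda>xs. F (0 # xs))"

text \<open>The number of up-steps, of the walk with these increments, that end at level k.\<close>

primrec ups :: "int list \<Rightarrow> int \<Rightarrow> nat" where
  "ups [] k = 0"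
| "ups (a # xs) k = of_bool (a = 1 \<and> k = 1) + ups xs (k - a)"

definition reach :: "int list \<Rightarrow> int \<Rightarrow> bool" where
  "reach xs j \<longleftrightarrow> (\<exists>m\<le>length xs. j \<le> sum_list (take m xs))"

lemma reach_Nil [simp]: "reach [] j \<longleftrightarrow> j \<le> 0"
  by (simp add: reach_def)

lemma reach_Cons [simp]: "reach (a # xs) j \<longleftrightarrow> j \<le> 0 \<or> reach xs (j - a)"
proof -
  have "reach (a # xs) j \<longleftrightarrow> j \<le> 0 \<or> (\<exists>m\<le>length xs. j \<le> sum_list (take (Suc m) (a # xs)))"
    unfolding reach_def
    by (metis (no_types, opaque_lifting) Suc_le_mono length_Cons old.nat.exhaust sum_list.Nil take0 zero_le)
  then show ?thesis by (auto simp: reach_def algebra_simps)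
qed

lemma ups_append: "ups (xs @ ys) k = ups xs k + ups ys (k - sum_list xs)"
  by (induction xs arbitrary: k) (auto simp: algebra_simps)

text \<open>Measured from the right end, a height w becomes \<open>sum_list xs\<close> - w, and an
  up-step read backwards ends where it used to begin; the + 1 is this one step.\<close>

lemma ups_rev: "ups (rev xs) k = ups xs (sum_list xs + 1 - k)"
proof (induction xs arbitrary: k)
  case (Cons a xs)
  then show ?case by (auto simp: ups_append algebra_simps sum_list_rev)
qed simp

lemma sum_ups_le: "finite K \<Longrightarrow> (\<Sum>k\<in>K. ups xs k) \<le> count_list xs 1"
proof (induction xs arbitrary: K)
  case (Cons a xs)
  have "(\<Sum>k\<in>K. ups xs (k - a)) = (\<Sum>k\<in>(\<lambda>k. k - a) ` K. ups xs k)"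
    by (subst sum.reindex) (auto simp: inj_on_def)
  also have "\<dots> \<le> count_list xs 1" using Cons by simp
  finally have "(\<Sum>k\<in>K. ups (a # xs) k) \<le> (\<Sum>k\<in>K. of_bool (a = 1 \<and> k = 1)) + count_list xs 1"
    by (simp add: sum.distrib)
  also have "(\<Sum>k\<in>K. of_bool (a = 1 \<and> k = (1::int))) \<le> (of_bool (a = 1) :: nat)"
    using Cons.prems by (cases "a = 1") (auto simp: of_bool_def sum.delta')
  finally show ?case by auto
qed simp

lemma ups_eq_card:
  "ups xs k = card {i\<in>{1..length xs}. xs ! (i - 1) = 1 \<and> sum_list (take i xs) = k}"
proof (induction xs rule: rev_induct)
  case (snoc a xs)
  let ?S = "{i\<in>{1..length xs}. xs ! (i - 1) = 1 \<and> sum_list (take i xs) = k}"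
  have "{i\<in>{1..length (xs @ [a])}. (xs @ [a]) ! (i - 1) = 1 \<and> sum_list (take i (xs @ [a])) = k} =
    ?S \<union> (if a = 1 \<and> sum_list xs + 1 = k then {Suc (length xs)} else {})"
    by (auto simp: nth_append le_Suc_eq split: if_splits)
  moreover have "ups (xs @ [a]) k = ups xs k + of_bool (a = 1 \<and> sum_list xs + 1 = k)"
    by (auto simp: ups_append)
  ultimately show ?case using snoc by auto
qed simp

section \<open>First-moment bounds for a lazy walk with downward drift\<close>

locale lazy_walk =
  fixes p q :: real
  assumes p_pos: "0 < p" and p_less_q: "p < q" and pq_le: "p + q \<le> 1"
begin

abbreviation "E \<equiv> iid_exp p q"
abbreviation "\<rho> \<equiv> p / q"

lemma E_cong: "(\<And>xs. length xs = n \<Longrightarrow> set xs \<subseteq> {-1, 0, 1} \<Longrightarrow> F xs = G xs) \<Longrightarrow> E n F = E n G"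
proof (induction n arbitrary: F G)
  case (Suc n)
  have "E n (\<lambda>xs. F (a # xs)) = E n (\<lambda>xs. G (a # xs))" if "a \<in> {-1, 0, 1}" for a
    by (rule Suc.IH) (use that Suc.prems in auto)
  then show ?case by simp
qed simp

lemma E_mono: "(\<And>xs. length xs = n \<Longrightarrow> set xs \<subseteq> {-1, 0, 1} \<Longrightarrow> F xs \<le> G xs) \<Longrightarrow> E n F \<le> E n G"
proof (induction n arbitrary: F G)
  case (Suc n)
  have "E n (\<lambda>xs. F (a # xs)) \<le> E n (\<lambda>xs. G (a # xs))" if "a \<in> {-1, 0, 1}" for a
    by (rule Suc.IH) (use that Suc.prems in auto)
  then show ?case using p_pos p_less_q pq_le by (auto intro!: add_mono mult_left_mono)
qed simp

lemma E_const: "E n (\<lambda>_. c) = c"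
  by (induction n) (auto simp: algebra_simps)

lemma E_add: "E n (\<lambda>xs. F xs + G xs) = E n F + E n G"
  by (induction n arbitrary: F G) (auto simp: algebra_simps)

lemma E_mult: "E n (\<lambda>xs. c * F xs) = c * E n F"
  by (induction n arbitrary: F) (auto simp: algebra_simps)

lemma E_mult_right: "E n (\<lambda>xs. F xs * c) = E n F * c"
  using E_mult[of n c F] by (simp add: mult.commute)

lemma E_sum: "E n (\<lambda>xs. \<Sum>i\<in>I. F i xs) = (\<Sum>i\<in>I. E n (F i))"
  by (induction I rule: infinite_finite_induct) (auto simp: E_add E_const)

lemma E_append: "E (m + n) F = E m (\<lambda>xs. E n (\<lambda>ys. F (xs @ ys)))"
  by (induction m arbitrary: F) auto

lemma E_snoc: "E (Suc n) F = E n (\<lambda>xs. p * F (xs @ [1]) + q * F (xs @ [-1]) + (1 - p - q) * F (xs @ [0]))"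
  using E_append[of n 1 F] by simp

lemma E_rev: "E n (\<lambda>xs. F (rev xs)) = E n F"
proof (induction n arbitrary: F)
  case (Suc n)
  have "E n (\<lambda>xs. F (a # rev xs)) = E n (\<lambda>xs. F (a # xs))" for a
    by (rule Suc.IH)
  then show ?case by (subst E_snoc) (simp add: E_add E_mult)
qed simp

lemma rho: "0 < \<rho>" "\<rho> < 1" "\<rho> * q = p"
  using p_pos p_less_q by auto

lemma rho_harmonic:
  "0 < j \<Longrightarrow> p * \<rho> ^ nat (j - 1) + q * \<rho> ^ nat (j + 1) + (1 - p - q) * \<rho> ^ nat j = \<rho> ^ nat j"
proof -
  assume "0 < j"
  then obtain m where m: "nat (j - 1) = m" "nat j = Suc m" "nat (j + 1) = Suc (Suc m)" by auto
  show ?thesis unfolding m using rho p_less_q p_pos by (simp add: field_simps)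
qed

text \<open>The gambler's ruin bound: \<rho> is the root below 1 of p + q x^2 = (p + q) x, so its
  powers are harmonic above level 0, where the bound equals 1.\<close>

lemma E_reach: "E n (\<lambda>xs. of_bool (reach xs j)) \<le> \<rho> ^ nat j"
proof (induction n arbitrary: j)
  case (Suc n)
  show ?case
  proof (cases "j \<le> 0")
    case True
    then show ?thesis by (simp add: E_const)
  next
    case False
    have "E (Suc n) (\<lambda>xs. of_bool (reach xs j)) \<le>
        p * \<rho> ^ nat (j - 1) + q * \<rho> ^ nat (j + 1) + (1 - p - q) * \<rho> ^ nat j"
      using False Suc[of "j - 1"] Suc[of "j + 1"] Suc[of j] p_pos p_less_q pq_le
      by (auto intro!: add_mono mult_left_mono)
    then show ?thesis using rho_harmonic[of j] False by simp
  qed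
qed (use p_pos p_less_q in auto)

text \<open>An up-step to level k starts at level k - 1. The unbounded walk reaches that level with
  the probability that the power of \<rho> gives, then visits it 1 / (q - p) times on average, and
  follows each visit by an up-step with probability p. The bound is the fixed point of the
  first-letter recursion, whose source term sits at k = 1.\<close>

lemma E_ups: "E n (\<lambda>xs. real (ups xs k)) \<le> p / (q - p) * \<rho> ^ nat (k - 1)"
proof (induction n arbitrary: k)
  case 0
  then show ?case using p_pos p_less_q by simp
next
  case (Suc n)
  let ?c = "p / (q - p)"
  have "E (Suc n) (\<lambda>xs. real (ups xs k)) =
      p * (of_bool (k = 1) + E n (\<lambda>xs. real (ups xs (k - 1)))) +
      q * E n (\<lambda>xs. real (ups xs (k + 1))) + (1 - p - q) * E n (\<lambda>xs. real (ups xs k))"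
    by (simp add: E_add E_const)
  also have "\<dots> \<le> p * (of_bool (k = 1) + ?c * \<rho> ^ nat (k - 2)) +
      q * (?c * \<rho> ^ nat k) + (1 - p - q) * (?c * \<rho> ^ nat (k - 1))"
    using Suc[of "k - 1"] Suc[of "k + 1"] Suc[of k] p_pos p_less_q pq_le
    by (intro add_mono mult_left_mono order.refl) auto
  also have "\<dots> = ?c * \<rho> ^ nat (k - 1)"
  proof -
    consider "k \<le> 0" | "k = 1" | "k \<ge> 2" by linarith
    then show ?thesis
    proof cases
      case 1
      have "p * ?c + q * ?c + (1 - p - q) * ?c = ?c" by (simp only: algebra_simps)
      then show ?thesis using 1 by simp
    next
      case 2
      have "p * (1 + ?c) + q * (?c * \<rho>) + (1 - p - q) * ?c = ?c"
      proof -
        have "?c * (q - p) = p" "q * (?c * \<rho>) = p * ?c" using p_pos p_less_q by auto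
        then show ?thesis by (simp only: algebra_simps)
      qed
      then show ?thesis using 2 by simp
    next
      case 3
      have *: "p * (c * x) + q * (c * y) + (1 - p - q) * (c * z) = c * (p * x + q * y + (1 - p - q) * z)"
        for c x y z :: real by (simp only: algebra_simps)
      have "p * \<rho> ^ nat (k - 2) + q * \<rho> ^ nat k + (1 - p - q) * \<rho> ^ nat (k - 1) = \<rho> ^ nat (k - 1)"
        using 3 rho_harmonic[of "k - 1"] by simp
      then show ?thesis using 3 *[of ?c "\<rho> ^ nat (k - 2)" "\<rho> ^ nat k" "\<rho> ^ nat (k - 1)"] by simp
    qed
  qed
  finally show ?case .
qed

lemma sum_rho_le: "(\<Sum>j=1..m. \<rho> ^ j) \<le> p / (q - p)" "(\<Sum>j=1..m. \<rho> ^ (j - 1)) \<le> q / (q - p)"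
proof -
  have "(\<Sum>j=1..m. \<rho> ^ (j - 1)) = (\<Sum>j<m. \<rho> ^ j)"
    by (rule sum.reindex_bij_witness[of _ Suc "\<lambda>j. j - 1"]) auto
  also have "\<dots> \<le> 1 / (1 - \<rho>)"
    using rho by (subst sum_gp_strict) (auto simp: divide_right_mono)
  also have "1 / (1 - \<rho>) = q / (q - p)" using p_pos p_less_q by (simp add: field_simps)
  finally show *: "(\<Sum>j=1..m. \<rho> ^ (j - 1)) \<le> q / (q - p)" .
  have "(\<Sum>j=1..m. \<rho> ^ j) = \<rho> * (\<Sum>j=1..m. \<rho> ^ (j - 1))"
    unfolding sum_distrib_left by (rule sum.cong) (auto simp: power_eq_if)
  also have "\<dots> \<le> \<rho> * (q / (q - p))" using * rho by (intro mult_left_mono) auto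
  also have "\<dots> = p / (q - p)" using p_pos p_less_q by simp
  finally show "(\<Sum>j=1..m. \<rho> ^ j) \<le> p / (q - p)" .
qed

lemma E_count_list: "E n (\<lambda>xs. real (count_list xs 1)) = real n * p"
  by (induction n) (auto simp: E_add E_const algebra_simps)

text \<open>Here \<open>rs\<close> is the walk to the right of a site and \<open>ls\<close> the walk
  to its left, read backwards from the site; j is the level relative to the height at the
  site.\<close>

lemma E_sites1:
  "E a (\<lambda>ls. E b (\<lambda>rs. \<Sum>j=1..m. of_bool (reach rs (int j)) + of_bool (reach ls (int j)))) \<le> 2 * p / (q - p)"
proof -
  have "E a (\<lambda>ls. E b (\<lambda>rs. \<Sum>j=1..m. of_bool (reach rs (int j)) + of_bool (reach ls (int j)))) =
     (\<Sum>j=1..m. E b (\<lambda>rs. of_bool (reach rs (int j)))) + (\<Sum>j=1..m. E a (\<lambda>ls. of_bool (reach ls (int j))))"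
    by (simp add: E_sum E_add E_const sum.distrib del: sum_of_bool_eq)
  also have "\<dots> \<le> (\<Sum>j=1..m. \<rho> ^ j) + (\<Sum>j=1..m. \<rho> ^ j)"
    using E_reach[of b "int j" for j] E_reach[of a "int j" for j]
    by (intro add_mono sum_mono) auto
  also have "\<dots> \<le> 2 * p / (q - p)" using sum_rho_le(1)[of m] by simp
  finally show ?thesis .
qed

text \<open>Where indicator and count belong to the same side, the indicator is dropped; where they
  belong to opposite sides, the expectation factors. The two kinds of terms sum to q / (q - p) and p
  / (q - p) up to a common factor, which is where p + q comes from.\<close>

lemma E_sites2:
  "E a (\<lambda>ls. E b (\<lambda>rs. \<Sum>j=1..m.
      of_bool (reach rs (int j)) * (real (ups rs (int j)) + real (ups ls (1 - int j))) +
      of_bool (reach ls (int j)) * (real (ups rs (1 - int j)) + real (ups ls (int j)))))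
   \<le> 2 * p * (p + q) / (q - p)\<^sup>2" (is "?lhs \<le> _")
proof -
  let ?c = "p / (q - p)"
  have c: "0 \<le> ?c" using p_pos p_less_q by simp
  have "?lhs \<le> E a (\<lambda>ls. E b (\<lambda>rs. \<Sum>j=1..m.
      (real (ups rs (int j)) + of_bool (reach rs (int j)) * real (ups ls (1 - int j))) +
      (of_bool (reach ls (int j)) * real (ups rs (1 - int j)) + real (ups ls (int j)))))"
    by (intro E_mono sum_mono add_mono) (auto simp: of_bool_def)
  also have "\<dots> = (\<Sum>j=1..m.
      (E b (\<lambda>rs. real (ups rs (int j))) +
        E b (\<lambda>rs. of_bool (reach rs (int j))) * E a (\<lambda>ls. real (ups ls (1 - int j)))) +
      (E a (\<lambda>ls. of_bool (reach ls (int j))) * E b (\<lambda>rs. real (ups rs (1 - int j))) +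
        E a (\<lambda>ls. real (ups ls (int j)))))"
    by (simp add: E_sum E_add E_mult E_mult_right E_const)
  also have "\<dots> \<le> (\<Sum>j=1..m. (?c * \<rho> ^ (j - 1) + \<rho> ^ j * ?c) + (\<rho> ^ j * ?c + ?c * \<rho> ^ (j - 1)))"
  proof (intro sum_mono add_mono mult_mono)
    fix j assume "j \<in> {1..m}"
    then have [simp]: "nat (int j - 1) = j - 1" "nat (1 - int j - 1) = 0" by auto
    show "E b (\<lambda>rs. real (ups rs (int j))) \<le> ?c * \<rho> ^ (j - 1)" using E_ups[of b "int j"] by simp
    show "E a (\<lambda>rs. real (ups rs (int j))) \<le> ?c * \<rho> ^ (j - 1)" using E_ups[of a "int j"] by simp
    show "E b (\<lambda>rs. of_bool (reach rs (int j))) \<le> \<rho> ^ j" using E_reach[of b "int j"] by simp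
    show "E a (\<lambda>rs. of_bool (reach rs (int j))) \<le> \<rho> ^ j" using E_reach[of a "int j"] by simp
    show "E b (\<lambda>rs. real (ups rs (1 - int j))) \<le> ?c" using E_ups[of b "1 - int j"] by simp
    show "E a (\<lambda>rs. real (ups rs (1 - int j))) \<le> ?c" using E_ups[of a "1 - int j"] by simp
    show "0 \<le> E b (\<lambda>rs. real (ups rs (1 - int j)))"
      using E_mono[of b "\<lambda>_. 0" "\<lambda>rs. real (ups rs (1 - int j))"] by (simp add: E_const)
    show "0 \<le> E a (\<lambda>rs. real (ups rs (1 - int j)))"
      using E_mono[of a "\<lambda>_. 0" "\<lambda>rs. real (ups rs (1 - int j))"] by (simp add: E_const)
  qed (use rho in auto)
  also have "\<dots> = 2 * ?c * ((\<Sum>j=1..m. \<rho> ^ (j - 1)) + (\<Sum>j=1..m. \<rho> ^ j))"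
    by (simp add: sum.distrib sum_distrib_left distrib_left mult_ac del: times_divide_eq_left times_divide_eq_right)
  also have "\<dots> \<le> 2 * ?c * (q / (q - p) + ?c)"
    using sum_rho_le[of m] c by (intro mult_left_mono add_mono) auto
  also have "\<dots> = 2 * p * (p + q) / (q - p)\<^sup>2"
    by (simp add: power2_eq_square add_divide_distrib[symmetric] add.commute)
  finally show ?thesis .
qed

end

section \<open>Levels of the walk and the expected matching distance on the integers\<close>

text \<open>Positions start at 1, so that the letter at i is the step from height
  \<open>W xs (i - 1)\<close> to height \<open>W xs i\<close>.\<close>

definition conf :: "int list \<Rightarrow> int \<Rightarrow> int" where
  "conf xs i = (if 1 \<le> i \<and> i \<le> int (length xs) then xs ! nat (i - 1) else 0)"

abbreviation "W xs x \<equiv> sum_list (take x xs)"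

lemma conf_symb: "set xs \<subseteq> {-1, 0, 1} \<Longrightarrow> conf xs i \<in> {-1, 0, 1}"
proof (cases "1 \<le> i \<and> i \<le> int (length xs)")
  case True
  assume s: "set xs \<subseteq> {-1, 0, 1}"
  have "xs ! nat (i - 1) \<in> set xs" using True by (intro nth_mem) auto
  then show ?thesis using True s by (auto simp: conf_def)
qed (auto simp: conf_def)

lemma W_Suc: "b < length xs \<Longrightarrow> W xs (Suc b) = W xs b + conf xs (int (Suc b))"
  by (auto simp: conf_def take_Suc_conv_app_nth)

lemma W_diff: "a \<le> b \<Longrightarrow> b \<le> length xs \<Longrightarrow> sum (conf xs) {int a<..int b} = W xs b - W xs a"
proof (induction b rule: dec_induct)
  case (step b)
  have "{int a<..int (Suc b)} = insert (int (Suc b)) {int a<..int b}" using step by auto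
  then show ?case using step W_Suc[of b xs] by simp
qed simp

lemma alive_right_W:
  assumes "set xs \<subseteq> {-1, 0, 1}" "alive (conf xs) D (int i)" "i + 2 * D \<le> length xs"
  obtains u where "i + D \<le> u" "u \<le> length xs" "W xs i \<le> W xs u"
proof -
  obtain u where u: "int i + int D \<le> u" "u \<le> int i + 2 * int D" "0 \<le> sum (conf xs) {int i<..u}"
    using alive_right[OF assms(2) conf_symb[OF assms(1)]] .
  define v where "v = nat u"
  have v: "u = int v" "i + D \<le> v" "v \<le> i + 2 * D" using u by (auto simp: v_def)
  then have "W xs i \<le> W xs v" using u(3) W_diff[of i v xs] assms(3) by auto
  then show ?thesis using v assms(3) by (intro that[of v]) auto
qed

text \<open>The letter at i is itself an up-step. Hence a nonnegative sum over the letters just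
  before it leaves the walk strictly below the level of i at the start of these letters, one time
  unit before the first of them; this is the extra 1 in the distance.\<close>

lemma alive_left_W:
  assumes "set xs \<subseteq> {-1, 0, 1}" "alive (conf xs) D (int i)" "2 * D < i" "i \<le> length xs"
  obtains y where "y + D + 1 \<le> i" "W xs y \<le> W xs i - 1"
proof -
  obtain v where v: "int i - 2 * int D \<le> v" "v \<le> int i - int D" "0 \<le> sum (conf xs) {v..<int i}"
    using alive_left[OF assms(2) conf_symb[OF assms(1)]] .
  define y where "y = nat (v - 1)"
  have vy: "v = int y + 1" "1 \<le> v" using v assms by (auto simp: y_def)
  have "{v..<int i} = {int y<..int (i - 1)}" using vy assms by auto
  then have "0 \<le> W xs (i - 1) - W xs y"
    using v(3) W_diff[of y "i - 1" xs] assms(4) vy v(2) by auto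
  moreover have "W xs i = W xs (i - 1) + 1"
    using W_Suc[of "i - 1" xs] assms by (auto simp: alive_def)
  ultimately show ?thesis using vy v(2) by (intro that[of y]) auto
qed

text \<open>The strictness comes from the up-step at i'. It forbids two such letters on a common
  level.\<close>

lemma alive_between_W:
  assumes "set xs \<subseteq> {-1, 0, 1}" "alive (conf xs) D (int i)" "alive (conf xs) D (int i')"
    "i < i'" "i' \<le> i + 2 * D" "i' \<le> length xs"
  shows "W xs i < W xs i'"
proof -
  have "0 \<le> sum (conf xs) {int i<..<int i'}"
    by (rule alive_between[OF assms(2,3)]) (use assms conf_symb in auto)
  moreover have "{int i<..<int i'} = {int i<..int (i' - 1)}" using assms by auto
  ultimately have "0 \<le> W xs (i' - 1) - W xs i"
    using W_diff[of i "i' - 1" xs] assms by auto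
  moreover have "W xs i' = W xs (i' - 1) + 1"
    using W_Suc[of "i' - 1" xs] assms by (auto simp: alive_def)
  ultimately show ?thesis by simp
qed

text \<open>The index x stands for the unit gap between times x and x + 1, whence the weak bound on
  y and the strict one on u. The number of such x is the length of the span of level k.\<close>

definition active :: "int list \<Rightarrow> int \<Rightarrow> nat \<Rightarrow> bool" where
  "active xs k x \<longleftrightarrow> (\<exists>y\<le>x. W xs y \<le> k - 1) \<and> (\<exists>u. x < u \<and> u \<le> length xs \<and> k \<le> W xs u)"

definition alives :: "int list \<Rightarrow> nat \<Rightarrow> int \<Rightarrow> nat \<Rightarrow> nat set" where
  "alives xs r k D = {i\<in>{r<..length xs - r}. alive (conf xs) D (int i) \<and> W xs i = k}"

text \<open>An alive letter i has a point below its level at time i - D - 1 or earlier and a point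
  at or above it at time i + D or later, so the 2 D + 1 gaps of \<open>J i\<close> lie in the span.
  Letters on one level are more than 2 D apart, which is just enough to make these windows
  disjoint.\<close>

lemma card_alives_le_active:
  assumes xs: "set xs \<subseteq> {-1, 0, 1}" and r: "2 * D \<le> r"
  shows "card (alives xs r k D) * (2 * D + 1) \<le> card {x\<in>{..<length xs}. active xs k x}"
proof -
  let ?A = "alives xs r k D"
  define J where "J i = {i - D - 1..<i + D}" for i
  have fin: "finite ?A" by (simp add: alives_def)
  have A: "alive (conf xs) D (int i)" "W xs i = k" "2 * D < i" "i + 2 * D \<le> length xs" "r < i" if "i \<in> ?A" for i
    using that r by (auto simp: alives_def)
  have cardJ: "card (J i) = 2 * D + 1" if "i \<in> ?A" for i
    using A[OF that] by (auto simp: J_def)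
  have sep: "i + 2 * D < i'" if "i \<in> ?A" "i' \<in> ?A" "i < i'" for i i'
    using alive_between_W[OF xs A(1)[OF that(1)] A(1)[OF that(2)] that(3)] A(2,4) that by (fastforce simp: not_less)
  have disj: "J i \<inter> J i' = {}" if "i \<in> ?A" "i' \<in> ?A" "i \<noteq> i'" for i i'
    using sep[of i i'] sep[of i' i] A(3)[OF that(1)] A(3)[OF that(2)] that by (cases "i < i'") (auto simp: J_def)
  have "card ?A * (2 * D + 1) = (\<Sum>i\<in>?A. card (J i))" using cardJ by simp
  also have "\<dots> = card (\<Union>i\<in>?A. J i)"
    by (rule card_UN_disjoint[symmetric]) (use fin disj in \<open>auto simp: J_def\<close>)
  also have "\<dots> \<le> card {x\<in>{..<length xs}. active xs k x}"
  proof (rule card_mono)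
    show "(\<Union>i\<in>?A. J i) \<subseteq> {x\<in>{..<length xs}. active xs k x}"
    proof safe
      fix i x assume i: "i \<in> ?A" and x: "x \<in> J i"
      obtain u where u: "i + D \<le> u" "u \<le> length xs" "W xs i \<le> W xs u"
        using alive_right_W[OF xs A(1)[OF i] A(4)[OF i]] .
      have "i \<le> length xs" using A(4)[OF i] by simp
      then obtain y where y: "y + D + 1 \<le> i" "W xs y \<le> W xs i - 1"
        using alive_left_W[OF xs A(1)[OF i] A(3)[OF i]] by blast
      show "x < length xs" using x A(4)[OF i] by (auto simp: J_def)
      show "active xs k x"
      proof -
        have "y \<le> x" "W xs y \<le> k - 1" "x < u" "k \<le> W xs u"
          using u y x A(2)[OF i] by (auto simp: J_def)
        then show ?thesis using u unfolding active_def by blast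
      qed
    qed
  qed simp
  finally show ?thesis .
qed

lemma card_alives_le_ups: "card (alives xs r k D) \<le> ups xs k"
  unfolding ups_eq_card
  by (rule card_mono) (auto simp: alives_def alive_def conf_def nat_diff_distrib)

text \<open>Counting by layers: those D with A D \<ge> l satisfy 2 D + 1 \<le> S / l, and there are
  at most (S / l + 1) / 2 of them. The term N / 2 is the price of working on a lattice; it turns
  into h / 2 at mesh h.\<close>

lemma sum_le_harm:
  fixes A :: "nat \<Rightarrow> nat"
  assumes "\<And>D. D < m \<Longrightarrow> A D \<le> N" "\<And>D. D < m \<Longrightarrow> A D * (2 * D + 1) \<le> S"
  shows "(\<Sum>D<m. real (A D)) \<le> (real S * harm N + real N) / 2"
proof -
  have "(\<Sum>D<m. real (A D)) = (\<Sum>D<m. \<Sum>l=1..N. of_bool (l \<le> A D))"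
  proof (rule sum.cong)
    fix D assume "D \<in> {..<m}"
    then have "{1..N} \<inter> {l. l \<le> A D} = {1..A D}" using assms(1)[of D] by auto
    then show "real (A D) = (\<Sum>l=1..N. of_bool (l \<le> A D))" by simp
  qed simp
  also have "\<dots> = (\<Sum>l=1..N. \<Sum>D<m. of_bool (l \<le> A D))" by (rule sum.swap)
  also have "\<dots> \<le> (\<Sum>l=1..N. (real S / real l + 1) / 2)"
  proof (rule sum_mono)
    fix l assume l: "l \<in> {1..N}"
    have "{..<m} \<inter> {D. l \<le> A D} \<subseteq> {..<nat \<lfloor>(real S / real l + 1) / 2\<rfloor>}"
    proof safe
      fix D assume D: "D < m" "l \<le> A D"
      have "l * (2 * D + 1) \<le> A D * (2 * D + 1)" using D by (intro mult_right_mono) auto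
      also have "\<dots> \<le> S" using assms D by blast
      finally have "real (l * (2 * D + 1)) \<le> real S" by (simp only: of_nat_le_iff)
      then have "real (2 * D + 1) \<le> real S / real l" using l by (simp add: field_simps)
      then have "real (D + 1) \<le> (real S / real l + 1) / 2" by simp
      then show "D < nat \<lfloor>(real S / real l + 1) / 2\<rfloor>" by linarith
    qed
    then have "card ({..<m} \<inter> {D. l \<le> A D}) \<le> nat \<lfloor>(real S / real l + 1) / 2\<rfloor>"
      by (metis card_lessThan card_mono finite_lessThan)
    then have "real (card ({..<m} \<inter> {D. l \<le> A D})) \<le> real (nat \<lfloor>(real S / real l + 1) / 2\<rfloor>)"
      by (simp only: of_nat_le_iff)
    also have "\<dots> \<le> (real S / real l + 1) / 2" by (rule of_nat_floor) simp
    finally show "(\<Sum>D<m. of_bool (l \<le> A D)) \<le> (real S / real l + 1) / 2" by simp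
  qed
  also have "\<dots> = (real S * harm N + real N) / 2"
  proof -
    have "(\<Sum>l=1..N. real S / real l) = real S * harm N"
      unfolding harm_def sum_distrib_left by (simp only: divide_inverse)
    then show ?thesis by (simp add: sum.distrib flip: sum_divide_distrib)
  qed
  finally show ?thesis .
qed

lemma harm_le_ln: "n \<ge> 1 \<Longrightarrow> harm n \<le> 1 + ln (real n)"
proof (induction n rule: dec_induct)
  case (step n)
  have "ln (real n / real (Suc n)) \<le> real n / real (Suc n) - 1"
    using step by (intro ln_le_minus_one) auto
  then have "ln (real n) + inverse (real (Suc n)) \<le> ln (real (Suc n))"
    using step by (simp add: ln_div field_simps)
  then show ?case using step by (simp add: harm_Suc)
qed (simp add: harm_expand)

text \<open>The tangent of ln at c. Linearity in n is the point: after it, only first moments of the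
  number of up-steps are required.\<close>

lemma harm_le_linear:
  assumes "c \<ge> (1::real)"
  shows "harm n \<le> ln c + real n / c"
proof (cases "n = 0")
  case False
  then have "harm n \<le> 1 + ln (real n)" by (intro harm_le_ln) simp
  moreover have "ln (real n / c) \<le> real n / c - 1" using False assms by (intro ln_le_minus_one) auto
  ultimately show ?thesis using False assms by (simp add: ln_div)
qed (use assms in \<open>simp add: harm_expand\<close>)

lemma abs_sum_list_le: "set xs \<subseteq> {-1, 0, 1} \<Longrightarrow> \<bar>sum_list xs\<bar> \<le> int (length xs)"
  by (induction xs) auto

text \<open>A covering level above the height at x must be reached by the walk to the right; one at
  or below that height must have been undercut on the left, that is, the left part read backwards
  climbs at least \<open>W xs x + 1 - k\<close>. The weight g serves for counting levels and for
  counting their up-steps.\<close>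

lemma active_split:
  assumes xs: "set xs \<subseteq> {-1, 0, 1}" and x: "x < length xs" and g: "\<And>k. 0 \<le> g k"
    and n: "n = length xs"
  shows "(\<Sum>k\<in>{-int n..int n}. of_bool (active xs k x) * g k) \<le>
    (\<Sum>j=1..2*n. of_bool (reach (drop x xs) (int j)) * g (W xs x + int j) +
       of_bool (reach (rev (take x xs)) (int j)) * (g (W xs x + 1 - int j) :: real))"
proof -
  let ?w = "W xs x"
  have w: "- int n \<le> ?w" "?w \<le> int n"
    using abs_sum_list_le[OF order.trans[OF set_take_subset xs], of x] x n by auto
  have right: "reach (drop x xs) (k - ?w)" if act: "active xs k x" for k
  proof -
    obtain u where u: "x < u" "u \<le> length xs" "k \<le> W xs u" using act unfolding active_def by blast
    have "W xs u = ?w + sum_list (take (u - x) (drop x xs))"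
      using u by (metis add_diff_inverse_nat less_imp_le not_less sum_list_append take_add)
    then show ?thesis unfolding reach_def using u by (intro exI[of _ "u - x"]) auto
  qed
  have left: "reach (rev (take x xs)) (?w + 1 - k)" if act: "active xs k x" for k
  proof -
    obtain y where y: "y \<le> x" "W xs y \<le> k - 1" using act unfolding active_def by blast
    have "rev (take (x - y) (rev (take x xs))) = drop y (take x xs)"
      using x y by (simp add: take_rev min_def)
    moreover have "?w = W xs y + sum_list (drop y (take x xs))"
      using y by (metis append_take_drop_id min.absorb1 sum_list_append take_take)
    ultimately have "?w = W xs y + sum_list (take (x - y) (rev (take x xs)))"
      by (metis sum_list_rev)
    then show ?thesis unfolding reach_def using x y by (intro exI[of _ "x - y"]) auto
  qed
  have "(\<Sum>k\<in>{-int n..int n}. of_bool (active xs k x) * g k) =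
    (\<Sum>k\<in>{?w<..int n}. of_bool (active xs k x) * g k) + (\<Sum>k\<in>{-int n..?w}. of_bool (active xs k x) * g k)"
    using w by (subst sum.union_disjoint[symmetric]) (auto intro!: sum.cong)
  also have "(\<Sum>k\<in>{?w<..int n}. of_bool (active xs k x) * g k) \<le>
     (\<Sum>k\<in>(\<lambda>j. ?w + int j) ` {1..2*n}. of_bool (reach (drop x xs) (k - ?w)) * g k)"
  proof (rule order.trans[OF sum_mono sum_mono2])
    show "{?w<..int n} \<subseteq> (\<lambda>j. ?w + int j) ` {1..2*n}"
    proof
      fix k assume "k \<in> {?w<..int n}"
      then show "k \<in> (\<lambda>j. ?w + int j) ` {1..2*n}" using w
        by (intro image_eqI[of _ _ "nat (k - ?w)"]) auto
    qed
  qed (use right g in \<open>auto simp: of_bool_def\<close>)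
  also have "\<dots> = (\<Sum>j=1..2*n. of_bool (reach (drop x xs) (int j)) * g (?w + int j))"
    by (subst sum.reindex) (auto simp: inj_on_def)
  also have "(\<Sum>k\<in>{-int n..?w}. of_bool (active xs k x) * g k) \<le>
     (\<Sum>k\<in>(\<lambda>j. ?w + 1 - int j) ` {1..2*n+1}. of_bool (reach (rev (take x xs)) (?w + 1 - k)) * g k)"
  proof (rule order.trans[OF sum_mono sum_mono2])
    show "{-int n..?w} \<subseteq> (\<lambda>j. ?w + 1 - int j) ` {1..2*n+1}"
    proof
      fix k assume "k \<in> {-int n..?w}"
      then show "k \<in> (\<lambda>j. ?w + 1 - int j) ` {1..2*n+1}" using w
        by (intro image_eqI[of _ _ "nat (?w + 1 - k)"]) auto
    qed
  qed (use left g in \<open>auto simp: of_bool_def\<close>)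
  also have "\<dots> = (\<Sum>j=1..2*n+1. of_bool (reach (rev (take x xs)) (int j)) * g (?w + 1 - int j))"
    by (subst sum.reindex) (auto simp: inj_on_def)
  also have "\<dots> = (\<Sum>j=1..2*n. of_bool (reach (rev (take x xs)) (int j)) * g (?w + 1 - int j))"
  proof -
    \<comment> \<open>The level -n at height n would need the index 2 n + 1, but the reversed left
      part has fewer than n letters and cannot climb that far.\<close>
    have "\<not> reach (rev (take x xs)) (int (2 * n + 1))"
    proof
      assume "reach (rev (take x xs)) (int (2 * n + 1))"
      then obtain m where m: "m \<le> x" "int (2 * n + 1) \<le> sum_list (take m (rev (take x xs)))"
        using x by (auto simp: reach_def)
      have "set (take m (rev (take x xs))) \<subseteq> set xs"
        using set_take_subset[of m "rev (take x xs)"] set_take_subset[of x xs] by simp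
      then have "set (take m (rev (take x xs))) \<subseteq> {-1, 0, 1}" using xs by (rule order.trans)
      from abs_sum_list_le[OF this] show False using m x n by simp
    qed
    then show ?thesis by simp
  qed
  finally show ?thesis by (simp add: sum.distrib)
qed

section \<open>From levels of a long word to a typical blue letter\<close>

context lazy_walk begin

lemma c_ge_1: "(p + q) / (q - p) \<ge> 1"
  using p_pos p_less_q by (simp add: field_simps)

text \<open>Alive letters are sorted by level, the harmonic estimate is applied on each level, and
  the sums are exchanged so that spans are counted site by site. The margin r keeps the windows of
  the alive letters inside the word.\<close>

lemma alives_bound:
  fixes xs :: "int list"
  defines "n \<equiv> length xs" and "c \<equiv> (p + q) / (q - p)"
  assumes xs: "set xs \<subseteq> {-1, 0, 1}" and r: "2 * m \<le> r"
  shows "(\<Sum>i\<in>{r<..n - r}. \<Sum>D<m. of_bool (alive (conf xs) D (int i))) \<le>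
    (\<Sum>x<n. ln c / 2 * (\<Sum>k\<in>{-int n..int n}. of_bool (active xs k x))) +
    (\<Sum>x<n. 1 / (2 * c) * (\<Sum>k\<in>{-int n..int n}. of_bool (active xs k x) * real (ups xs k))) +
    real (count_list xs 1) / 2"
proof -
  let ?K = "{-int n..int n}"
  define S where "S k = card {x\<in>{..<length xs}. active xs k x}" for k
  have S: "real (S k) = (\<Sum>x<n. of_bool (active xs k x))" for k
    by (simp add: S_def n_def Int_def)
  have c: "c \<ge> 1" using c_ge_1 by (simp add: c_def)
  have "(\<Sum>i\<in>{r<..n - r}. \<Sum>D<m. of_bool (alive (conf xs) D (int i)) :: real) =
    (\<Sum>D<m. \<Sum>i\<in>{r<..n - r}. of_bool (alive (conf xs) D (int i)))"
    by (rule sum.swap)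
  also have "\<dots> = (\<Sum>D<m. \<Sum>k\<in>?K. real (card (alives xs r k D)))"
  proof (rule sum.cong)
    fix D assume "D \<in> {..<m}"
    let ?A = "{i\<in>{r<..n - r}. alive (conf xs) D (int i)}"
    have "(\<lambda>i. W xs i) ` ?A \<subseteq> ?K"
    proof
      fix k assume "k \<in> (\<lambda>i. W xs i) ` ?A"
      then obtain i where "i \<in> ?A" and ki: "k = W xs i" by blast
      then have i: "i \<le> n" "k = W xs i" by auto
      from abs_sum_list_le[OF order.trans[OF set_take_subset xs], of i] show "k \<in> ?K" using i by (auto simp: n_def)
    qed
    then have "(\<Sum>k\<in>?K. \<Sum>i\<in>{i\<in>?A. W xs i = k}. 1) = (\<Sum>i\<in>?A. 1::nat)"
      by (intro sum.group) auto
    moreover have "{i\<in>?A. W xs i = k} = alives xs r k D" for k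
      by (auto simp: alives_def n_def)
    ultimately have "(\<Sum>k\<in>?K. card (alives xs r k D)) = card ?A" by simp
    then show "(\<Sum>i\<in>{r<..n - r}. of_bool (alive (conf xs) D (int i))) = (\<Sum>k\<in>?K. real (card (alives xs r k D)))"
      by (simp add: Int_def flip: of_nat_sum)
  qed simp
  also have "\<dots> = (\<Sum>k\<in>?K. \<Sum>D<m. real (card (alives xs r k D)))" by (rule sum.swap)
  also have "\<dots> \<le> (\<Sum>k\<in>?K. (real (S k) * harm (ups xs k) + real (ups xs k)) / 2)"
    unfolding S_def using r
    by (intro sum_mono sum_le_harm card_alives_le_ups card_alives_le_active[OF xs]) auto
  also have "\<dots> \<le> (\<Sum>k\<in>?K. (real (S k) * (ln c + real (ups xs k) / c) + real (ups xs k)) / 2)"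
    by (intro sum_mono divide_right_mono add_mono mult_left_mono harm_le_linear c) auto
  also have "\<dots> = ln c / 2 * (\<Sum>k\<in>?K. real (S k)) + 1 / (2 * c) * (\<Sum>k\<in>?K. real (S k) * real (ups xs k)) +
      real (\<Sum>k\<in>?K. ups xs k) / 2"
  proof -
    have "(real (S k) * (ln c + real (ups xs k) / c) + real (ups xs k)) / 2 =
        ln c / 2 * real (S k) + 1 / (2 * c) * (real (S k) * real (ups xs k)) + 1 / 2 * real (ups xs k)" for k
      by (simp add: field_simps)
    then show ?thesis by (simp only: sum.distrib flip: sum_distrib_left) simp
  qed
  also have "(\<Sum>k\<in>?K. real (S k)) = (\<Sum>x<n. \<Sum>k\<in>?K. of_bool (active xs k x))"
    unfolding S by (rule sum.swap)
  also have "(\<Sum>k\<in>?K. real (S k) * real (ups xs k)) = (\<Sum>x<n. \<Sum>k\<in>?K. of_bool (active xs k x) * real (ups xs k))"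
    unfolding S sum_distrib_right by (rule sum.swap)
  also have "(\<Sum>k\<in>?K. ups xs k) \<le> count_list xs 1" by (rule sum_ups_le) simp
  finally show ?thesis by (simp add: sum_distrib_left)
qed

lemma E_active1:
  assumes "x < n"
  shows "E n (\<lambda>xs. \<Sum>k\<in>{-int n..int n}. of_bool (active xs k x)) \<le> 2 * p / (q - p)"
proof -
  have "E n (\<lambda>xs. \<Sum>k\<in>{-int n..int n}. of_bool (active xs k x)) \<le>
    E n (\<lambda>xs. \<Sum>j=1..2*n. of_bool (reach (drop x xs) (int j)) + of_bool (reach (rev (take x xs)) (int j)))"
    using active_split[where g = "\<lambda>_. 1"] assms by (intro E_mono) fastforce
  also have "\<dots> = E x (\<lambda>ls. E (n - x) (\<lambda>rs. \<Sum>j=1..2*n. of_bool (reach (drop x (ls @ rs)) (int j)) + of_bool (reach (rev (take x (ls @ rs))) (int j))))"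
    using E_append[of x "n - x"] assms by simp
  also have "\<dots> = E x (\<lambda>ls. E (n - x) (\<lambda>rs. \<Sum>j=1..2*n. of_bool (reach rs (int j)) + of_bool (reach (rev ls) (int j))))"
    by (rule E_cong)+ simp
  \<comment> \<open>The letters are i.i.d., so the left part may be read backwards from the
    site.\<close>
  also have "\<dots> = E x (\<lambda>ls. E (n - x) (\<lambda>rs. \<Sum>j=1..2*n. of_bool (reach rs (int j)) + of_bool (reach ls (int j))))"
    by (rule E_rev)
  also have "\<dots> \<le> 2 * p / (q - p)" by (rule E_sites1)
  finally show ?thesis .
qed

lemma E_active2:
  assumes "x < n"
  shows "E n (\<lambda>xs. \<Sum>k\<in>{-int n..int n}. of_bool (active xs k x) * real (ups xs k)) \<le> 2 * p * (p + q) / (q - p)\<^sup>2"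
proof -
  let ?f = "\<lambda>ls rs j. of_bool (reach rs (int j)) * (real (ups rs (int j)) + real (ups ls (1 - int j))) +
      of_bool (reach ls (int j)) * (real (ups rs (1 - int j)) + real (ups ls (int j)))"
  have ups: "ups xs (W xs x + k) = ups (drop x xs) k + ups (rev (take x xs)) (1 - k)" for xs k
    using ups_append[of "take x xs" "drop x xs"] ups_rev[of "take x xs"] by (simp add: algebra_simps)
  have "E n (\<lambda>xs. \<Sum>k\<in>{-int n..int n}. of_bool (active xs k x) * real (ups xs k)) \<le>
    E n (\<lambda>xs. \<Sum>j=1..2*n. ?f (rev (take x xs)) (drop x xs) j)"
  proof (rule E_mono)
    fix xs :: "int list" assume xs: "length xs = n" "set xs \<subseteq> {-1, 0, 1}"
    have "(\<Sum>k\<in>{-int n..int n}. of_bool (active xs k x) * real (ups xs k)) \<le>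
      (\<Sum>j=1..2*n. of_bool (reach (drop x xs) (int j)) * real (ups xs (W xs x + int j)) +
       of_bool (reach (rev (take x xs)) (int j)) * real (ups xs (W xs x + (1 - int j))))"
      using active_split[OF xs(2) _ _ xs(1)[symmetric], of x "\<lambda>k. real (ups xs k)"] xs(1) assms
      unfolding add_diff_eq by simp
    then show "(\<Sum>k\<in>{-int n..int n}. of_bool (active xs k x) * real (ups xs k)) \<le>
      (\<Sum>j=1..2*n. ?f (rev (take x xs)) (drop x xs) j)"
      unfolding ups by simp
  qed
  also have "\<dots> = E x (\<lambda>ls. E (n - x) (\<lambda>rs. \<Sum>j=1..2*n. ?f (rev (take x (ls @ rs))) (drop x (ls @ rs)) j))"
    using E_append[of x "n - x"] assms by simp
  also have "\<dots> = E x (\<lambda>ls. E (n - x) (\<lambda>rs. \<Sum>j=1..2*n. ?f (rev ls) rs j))"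
    by (rule E_cong)+ simp
  also have "\<dots> = E x (\<lambda>ls. E (n - x) (\<lambda>rs. \<Sum>j=1..2*n. ?f ls rs j))"
    by (rule E_rev)
  also have "\<dots> \<le> 2 * p * (p + q) / (q - p)\<^sup>2" by (rule E_sites2)
  finally show ?thesis .
qed

text \<open>Conditioned on a blue letter at the central position r + 1.\<close>

definition palm_alive :: "nat \<Rightarrow> nat \<Rightarrow> real" where
  "palm_alive r D = E r (\<lambda>ls. E r (\<lambda>rs. of_bool (alive (conf (ls @ 1 # rs)) D (int r + 1))))"

lemma alive_window:
  assumes "length ls = r" "length rs = r" "radius D \<le> r"
  shows "alive (conf (as @ ls @ a # rs @ bs)) D (int (length as + r + 1)) = alive (conf (ls @ a # rs)) D (int r + 1)"
proof -
  have "alive (conf (as @ ls @ a # rs @ bs)) D (int (length as + r + 1)) =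
    alive (\<lambda>x. conf (as @ ls @ a # rs @ bs) (x + int (length as))) D (int r + 1)"
    by (subst alive_shift) (simp add: algebra_simps)
  also have "\<dots> = alive (conf (ls @ a # rs)) D (int r + 1)"
  proof (rule alive_local)
    fix x assume "\<bar>x - (int r + 1)\<bar> \<le> int (radius D)"
    then have x: "1 \<le> x" "x \<le> 2 * int r + 1" using assms(3) by auto
    define y where "y = nat (x - 1)"
    have y: "x = int y + 1" "y < 2 * r + 1" using x by (auto simp: y_def)
    have "(as @ ls @ a # rs @ bs) ! nat (x + int (length as) - 1) = (as @ (ls @ a # rs) @ bs) ! (length as + y)"
      using y by (simp add: nat_add_distrib algebra_simps)
    also have "\<dots> = (ls @ a # rs) ! y"
      unfolding nth_append_length_plus using y assms by (subst nth_append) auto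
    finally show "conf (as @ ls @ a # rs @ bs) (x + int (length as)) = conf (ls @ a # rs) x"
      using y assms by (auto simp: conf_def)
  qed
  finally show ?thesis .
qed

text \<open>Stationarity away from the ends: being alive depends on the letters within r of i only,
  and the letter at i is blue with probability p.\<close>

lemma E_alive_eq_palm:
  assumes "radius D \<le> r" "r < i" "i \<le> n - r"
  shows "E n (\<lambda>xs. of_bool (alive (conf xs) D (int i))) = p * palm_alive r D"
proof -
  define a b where "a = i - 1 - r" and "b = n - i - r"
  have n: "n = a + (r + (1 + (r + b)))" using assms by (auto simp: a_def b_def)
  have i: "i = a + r + 1" using assms by (simp add: a_def)
  have *: "of_bool (alive (conf (as @ ls @ c # rs @ bs)) D (int i)) =
     (of_bool (alive (conf (ls @ c # rs)) D (int r + 1)) :: real)"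
    if "length as = a" "length ls = r" "length rs = r" for as ls rs bs c
    using alive_window[OF that(2,3) assms(1), of as c bs] that i by simp
  have "E n (\<lambda>xs. of_bool (alive (conf xs) D (int i))) =
    E a (\<lambda>as. E r (\<lambda>ls. E 1 (\<lambda>cs. E r (\<lambda>rs. E b (\<lambda>bs. of_bool (alive (conf (as @ ls @ cs @ rs @ bs)) D (int i)))))))"
    unfolding n by (simp only: E_append)
  also have "\<dots> = E a (\<lambda>as. E r (\<lambda>ls. E 1 (\<lambda>cs. E r (\<lambda>rs. E b (\<lambda>bs. of_bool (alive (conf (ls @ cs @ rs)) D (int r + 1)))))))"
  proof (rule E_cong)+
    fix as ls cs rs bs :: "int list"
    assume "length as = a" "length ls = r" "length cs = 1" "length rs = r"
    then show "of_bool (alive (conf (as @ ls @ cs @ rs @ bs)) D (int i)) = (of_bool (alive (conf (ls @ cs @ rs)) D (int r + 1)) :: real)"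
      using *[of as ls rs "hd cs" bs] by (cases cs) auto
  qed
  also have "\<dots> = E r (\<lambda>ls. E 1 (\<lambda>cs. E r (\<lambda>rs. of_bool (alive (conf (ls @ cs @ rs)) D (int r + 1)))))"
    by (simp only: E_const)
  also have "\<dots> = E r (\<lambda>ls. p * E r (\<lambda>rs. of_bool (alive (conf (ls @ 1 # rs)) D (int r + 1))))"
  proof (rule E_cong)
    fix ls :: "int list" assume l: "length ls = r"
    have 0: "E r (\<lambda>rs. of_bool (alive (conf (ls @ c # rs)) D (int r + 1))) = 0" if "c \<noteq> 1" for c
    proof -
      have "E r (\<lambda>rs. of_bool (alive (conf (ls @ c # rs)) D (int r + 1))) = E r (\<lambda>_. 0)"
        by (rule E_cong) (use l that in \<open>auto simp: alive_def conf_def nth_append\<close>)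
      then show ?thesis by (simp add: E_const)
    qed
    show "E 1 (\<lambda>cs. E r (\<lambda>rs. of_bool (alive (conf (ls @ cs @ rs)) D (int r + 1)))) =
        p * E r (\<lambda>rs. of_bool (alive (conf (ls @ 1 # rs)) D (int r + 1)))"
      using 0[of 0] 0[of "-1"] by simp
  qed
  finally show ?thesis by (simp add: E_mult palm_alive_def)
qed

lemma radius_mono: "D \<le> m \<Longrightarrow> radius D \<le> radius m"
  unfolding radius_def by (intro power_mono) auto

text \<open>A finite substitute for an ergodic average: the n - 2 r inner positions of a word of
  length n contribute equally, while the level estimate bounds their total by a multiple of
  n.\<close>

lemma sum_palm_alive_le:
  assumes r: "radius m \<le> r"
  shows "(\<Sum>D<m. palm_alive r D) \<le> (1 + ln ((p + q) / (q - p))) / (q - p) + 1 / 2"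
proof -
  define c where "c = (p + q) / (q - p)"
  define A where "A = p * (\<Sum>D<m. palm_alive r D)"
  define C where "C = p / (q - p) * (1 + ln c) + p / 2"
  have c: "c \<ge> 1" using c_ge_1 by (simp add: c_def)
  have "2 * m \<le> radius m" by (simp add: radius_def power2_eq_square)
  then have r2: "2 * m \<le> r" using r by simp
  have key: "real (n - 2 * r) * A \<le> real n * C" if "n \<ge> 2 * r" for n
  proof -
    have "real (n - 2 * r) * A = (\<Sum>i\<in>{r<..n - r}. \<Sum>D<m. p * palm_alive r D)"
      using that by (simp add: A_def sum_distrib_left)
    also have "\<dots> = (\<Sum>i\<in>{r<..n - r}. \<Sum>D<m. E n (\<lambda>xs. of_bool (alive (conf xs) D (int i))))"
    proof (intro sum.cong refl)
      fix i D assume "i \<in> {r<..n - r}" "D \<in> {..<m}"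
      moreover then have "radius D \<le> r" using radius_mono[of D m] r by simp
      ultimately show "p * palm_alive r D = E n (\<lambda>xs. of_bool (alive (conf xs) D (int i)))"
        by (subst E_alive_eq_palm) auto
    qed
    also have "\<dots> = E n (\<lambda>xs. \<Sum>i\<in>{r<..n - r}. \<Sum>D<m. of_bool (alive (conf xs) D (int i)))"
      by (simp only: E_sum)
    also have "\<dots> \<le> E n (\<lambda>xs. (\<Sum>x<n. ln c / 2 * (\<Sum>k\<in>{-int n..int n}. of_bool (active xs k x))) +
      (\<Sum>x<n. 1 / (2 * c) * (\<Sum>k\<in>{-int n..int n}. of_bool (active xs k x) * real (ups xs k))) +
      1 / 2 * real (count_list xs 1))"
    proof (rule E_mono)
      fix xs :: "int list" assume xs: "length xs = n" "set xs \<subseteq> {-1, 0, 1}"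
      show "(\<Sum>i\<in>{r<..n - r}. \<Sum>D<m. of_bool (alive (conf xs) D (int i))) \<le>
       (\<Sum>x<n. ln c / 2 * (\<Sum>k\<in>{-int n..int n}. of_bool (active xs k x))) +
      (\<Sum>x<n. 1 / (2 * c) * (\<Sum>k\<in>{-int n..int n}. of_bool (active xs k x) * real (ups xs k))) +
      1 / 2 * real (count_list xs 1)"
        using alives_bound[OF xs(2) r2] unfolding xs(1) c_def by simp
    qed
    also have "\<dots> = (\<Sum>x<n. ln c / 2 * E n (\<lambda>xs. \<Sum>k\<in>{-int n..int n}. of_bool (active xs k x))) +
      (\<Sum>x<n. 1 / (2 * c) * E n (\<lambda>xs. \<Sum>k\<in>{-int n..int n}. of_bool (active xs k x) * real (ups xs k))) +
      1 / 2 * (real n * p)"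
      by (simp only: E_add E_sum E_mult E_count_list)
    also have "\<dots> \<le> (\<Sum>x<n. ln c / 2 * (2 * p / (q - p))) + (\<Sum>x<n. 1 / (2 * c) * (2 * p * (p + q) / (q - p)\<^sup>2)) +
      1 / 2 * (real n * p)"
      using c by (intro add_mono sum_mono mult_left_mono E_active1 E_active2) auto
    also have "\<dots> = real n * C"
    proof -
      have "1 / (2 * (t / d)) * (2 * p * t / d\<^sup>2) = p / d" if "t > 0" "d > 0" for t d :: real
        using that by (simp add: power2_eq_square)
      from this[of "p + q" "q - p"] have "1 / (2 * c) * (2 * p * (p + q) / (q - p)\<^sup>2) = p / (q - p)"
        using p_pos p_less_q by (simp only: c_def)
      moreover have "ln c / 2 * (2 * p / (q - p)) = ln c * (p / (q - p))" by simp
      moreover have "real n * (ln c * e) + real n * e + 1 / 2 * (real n * p) = real n * (e * (1 + ln c) + p / 2)" for e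
        by (simp add: algebra_simps)
      ultimately show ?thesis by (simp only: C_def sum_constant card_lessThan)
    qed
    finally show ?thesis .
  qed
  \<comment> \<open>The margin r stays fixed while n grows, so the defect 2 r disappears in the
    comparison per letter.\<close>
  have "A \<le> C"
  proof (rule ccontr)
    assume "\<not> A \<le> C"
    then have pos: "0 < A - C" by simp
    obtain n0 where n0: "2 * real r * A < real n0 * (A - C)"
      using reals_Archimedean3[OF pos] by blast
    let ?n = "n0 + 2 * r"
    have "C \<ge> 0" using c p_pos p_less_q by (simp add: C_def)
    have "real n0 * A \<le> real ?n * C" using key[of ?n] by simp
    also have "\<dots> = real n0 * C + 2 * real r * C" by (simp add: algebra_simps)
    also have "\<dots> \<le> real n0 * C + 2 * real r * A" using pos by (intro add_left_mono mult_left_mono) auto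
    finally show False using n0 by (simp add: algebra_simps)
  qed
  then have "p * (\<Sum>D<m. palm_alive r D) \<le> p * ((1 + ln c) / (q - p) + 1 / 2)"
    by (simp add: A_def C_def algebra_simps add_divide_distrib)
  then show ?thesis using p_pos by (simp add: c_def)
qed

end

section \<open>Stable matchings of point configurations on the line\<close>

text \<open>The predicate occurs negatively in its own equation, which excludes an inductive
  definition; well-foundedness provides the solution instead.\<close>

lemma wf_fixpoint:
  assumes "wf R"
  obtains Q where "\<And>x. Q x \<longleftrightarrow> V x \<and> (\<forall>y. (y, x) \<in> R \<longrightarrow> \<not> Q y)"
proof
  let ?F = "\<lambda>f x. V x \<and> (\<forall>y. (y, x) \<in> R \<longrightarrow> \<not> f y)"
  fix x show "wfrec R ?F x \<longleftrightarrow> V x \<and> (\<forall>y. (y, x) \<in> R \<longrightarrow> \<not> wfrec R ?F y)"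
    by (subst wfrec[OF assms]) (simp add: cut_apply)
qed

lemma is_matchingD:
  assumes "is_matching Bl Rd Mt"
  shows "x \<notin> Bl \<union> Rd \<Longrightarrow> Mt x = None" "b \<in> Bl \<Longrightarrow> Mt b = Some y \<Longrightarrow> y \<in> Rd"
    "r \<in> Rd \<Longrightarrow> Mt r = Some y \<Longrightarrow> y \<in> Bl"
    "b \<in> Bl \<Longrightarrow> r \<in> Rd \<Longrightarrow> Mt r = Some b \<longleftrightarrow> Mt b = Some r"
  using assms unfolding is_matching_def by blast+

text \<open>The two gap conditions ask for empty intervals of any length d arbitrarily far out on
  either side. They exclude infinite chains of shrinking edges, which locally finite sets may
  contain.\<close>

locale point_config =
  fixes Bl Rd :: "real set"
  assumes locally_finite: "finite ((Bl \<union> Rd) \<inter> {a..b})"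
    and disjoint: "Bl \<inter> Rd = {}"
    and no_ties: "x \<in> Bl \<union> Rd \<Longrightarrow> y \<in> Bl \<union> Rd \<Longrightarrow> z \<in> Bl \<union> Rd \<Longrightarrow>
      x \<noteq> y \<Longrightarrow> x \<noteq> z \<Longrightarrow> y \<noteq> z \<Longrightarrow> \<bar>x - y\<bar> \<noteq> \<bar>x - z\<bar>"
    and gap_right: "\<exists>g\<ge>x. (Bl \<union> Rd) \<inter> {g<..g + d} = {}"
    and gap_left: "\<exists>g\<le>x. (Bl \<union> Rd) \<inter> {g - d<..g} = {}"
begin

definition closer :: "((real \<times> real) \<times> (real \<times> real)) set" where
  "closer = {((b', r'), (b, r)). b \<in> Bl \<and> b' \<in> Bl \<and> r \<in> Rd \<and> r' \<in> Rd \<and>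
     (b' = b \<or> r' = r) \<and> \<bar>b' - r'\<bar> < \<bar>b - r\<bar>}"

text \<open>Consecutive edges of a descending chain share an endpoint and are shorter than the first
  edge, so the chain cannot jump over an empty interval of that length. It is trapped in a finite
  set of edges, yet its lengths strictly decrease.\<close>

lemma wf_closer: "wf closer"
  unfolding wf_iff_no_infinite_down_chain
proof
  assume "\<exists>f. \<forall>i. (f (Suc i), f i) \<in> closer"
  then obtain f where f: "\<And>i. (f (Suc i), f i) \<in> closer" by blast
  define dist' where "dist' = (\<lambda>(b, r). \<bar>b - r\<bar> :: real)"
  have dec: "dist' (f (Suc i)) < dist' (f i)" for i
    using f[of i] by (auto simp: closer_def dist'_def)
  have anti: "dist' (f j) < dist' (f i)" if "i < j" for i j
    using that by (induction rule: less_Suc_induct) (auto intro: dec)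
  define d0 where "d0 = dist' (f 0)"
  define m where "m = \<bar>fst (f 0)\<bar> + \<bar>snd (f 0)\<bar> + 1"
  obtain g where g: "g \<ge> m" "(Bl \<union> Rd) \<inter> {g<..g + d0} = {}" using gap_right by blast
  obtain g' where g': "g' \<le> -m" "(Bl \<union> Rd) \<inter> {g' - d0<..g'} = {}" using gap_left by blast
  define F where "F = (Bl \<union> Rd) \<inter> {g'<..g}"
  have finF: "finite F"
    unfolding F_def by (rule finite_subset[OF _ locally_finite[of g' g]]) auto
  have near: "y \<in> F" if "x \<in> F" "y \<in> Bl \<union> Rd" "\<bar>x - y\<bar> < d0" for x y
  proof -
    have "y \<notin> {g<..g + d0}" "y \<notin> {g' - d0<..g'}" using g(2) g'(2) that(2) by blast+
    then show ?thesis using that by (auto simp: F_def)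
  qed
  have "f i \<in> F \<times> F" for i
  proof (induction i)
    case 0
    have "fst (f 0) \<in> Bl" "snd (f 0) \<in> Rd" using f[of 0] by (auto simp: closer_def)
    then have "fst (f 0) \<in> F" "snd (f 0) \<in> F" using g g' by (auto simp: F_def m_def)
    then show ?case by (simp add: mem_Times_iff)
  next
    case (Suc i)
    obtain b r b' r' where eq: "f i = (b, r)" "f (Suc i) = (b', r')" by fastforce
    have "dist' (f (Suc i)) < d0" using anti[of 0 "Suc i"] by (simp add: d0_def)
    then have "\<bar>b' - r'\<bar> < d0" by (simp add: dist'_def eq)
    moreover have "b' \<in> Bl" "r' \<in> Rd" "b' = b \<or> r' = r"
      using f[of i] eq by (auto simp: closer_def)
    ultimately show ?case using near[of b r'] near[of r b'] Suc eq by (auto simp: abs_minus_commute)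
  qed
  then have "range f \<subseteq> F \<times> F" by (rule image_subsetI)
  then have "finite (range f)" using finF finite_subset by blast
  moreover have "inj f"
    by (rule linorder_injI) (metis anti less_irrefl)
  ultimately show False using finite_imageD infinite_UNIV_nat by blast
qed

text \<open>Stability in the form of a recursion along \<open>closer\<close>, the shape that the
  greedy matching has by definition. Absence of ties turns "at most as far" into "strictly
  nearer".\<close>

lemma stable_iff:
  assumes st: "is_stable Bl Rd Mt" and br: "b \<in> Bl" "r \<in> Rd"
  shows "Mt b = Some r \<longleftrightarrow> (\<forall>r'\<in>Rd. \<bar>b - r'\<bar> < \<bar>b - r\<bar> \<longrightarrow> Mt b \<noteq> Some r') \<and>
     (\<forall>b'\<in>Bl. \<bar>b' - r\<bar> < \<bar>b - r\<bar> \<longrightarrow> Mt b' \<noteq> Some r)" (is "_ \<longleftrightarrow> ?R")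
proof
  have m: "is_matching Bl Rd Mt" using st by (simp add: is_stable_def)
  have sym: "Mt r' = Some b' \<longleftrightarrow> Mt b' = Some r'" if "b' \<in> Bl" "r' \<in> Rd" for b' r'
    using is_matchingD(4)[OF m that] .
  show ?R if "Mt b = Some r"
    using that sym br by (metis less_irrefl option.inject)
  show "Mt b = Some r" if R: ?R
  proof (rule ccontr)
    assume n: "Mt b \<noteq> Some r"
    then have "Mt r \<noteq> Some b" using sym br by blast
    then have "\<not> ennreal \<bar>r - b\<bar> < min (mdist Mt r) (mdist Mt b)"
      using st br by (auto simp: is_stable_def)
    then consider "mdist Mt r \<le> ennreal \<bar>r - b\<bar>" | "mdist Mt b \<le> ennreal \<bar>r - b\<bar>"
      by (auto simp: not_less)
    then show False
    proof cases
      case 1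
      then obtain b' where b': "Mt r = Some b'" "\<bar>r - b'\<bar> \<le> \<bar>r - b\<bar>"
        by (auto simp: mdist_def top_unique split: option.splits)
      have "b' \<in> Bl" using is_matchingD(3)[OF m] b' br by blast
      moreover have "b' \<noteq> b" using b' \<open>Mt r \<noteq> Some b\<close> by auto
      ultimately have "\<bar>r - b'\<bar> \<noteq> \<bar>r - b\<bar>" using br disjoint by (intro no_ties) auto
      then show False using R b' sym[of b' r] \<open>b' \<in> Bl\<close> br by (auto simp: abs_minus_commute)
    next
      case 2
      then obtain r' where r': "Mt b = Some r'" "\<bar>b - r'\<bar> \<le> \<bar>b - r\<bar>"
        by (auto simp: mdist_def top_unique abs_minus_commute split: option.splits)
      have "r' \<in> Rd" using is_matchingD(2)[OF m] r' br by blast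
      moreover have "r' \<noteq> r" using r' n by auto
      ultimately have "\<bar>b - r'\<bar> \<noteq> \<bar>b - r\<bar>" using br disjoint by (intro no_ties) auto
      then show False using R r' \<open>r' \<in> Rd\<close> by auto
    qed
  qed
qed

lemma stable_unique:
  assumes "is_stable Bl Rd Mt" "is_stable Bl Rd Mt'"
  shows "Mt = Mt'"
proof -
  have agree: "Mt b = Some r \<longleftrightarrow> Mt' b = Some r" if "b \<in> Bl" "r \<in> Rd" for b r
    using wf_closer that
  proof (induction "(b, r)" arbitrary: b r rule: wf_induct_rule)
    case less
    then show ?case
      unfolding stable_iff[OF assms(1) less(2,3)] stable_iff[OF assms(2) less(2,3)]
      by (auto simp: closer_def)
  qed
  have m: "is_matching Bl Rd Mt" "is_matching Bl Rd Mt'" using assms by (auto simp: is_stable_def)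
  show ?thesis
  proof
    fix x
    consider "x \<in> Bl" | "x \<in> Rd" | "x \<notin> Bl \<union> Rd" by blast
    then show "Mt x = Mt' x"
    proof cases
      case 1
      then have "Mt x = Some y \<longleftrightarrow> Mt' x = Some y" for y
        using is_matchingD(2)[OF m(1) 1, of y] is_matchingD(2)[OF m(2) 1, of y] agree[OF 1, of y] by blast
      then show ?thesis by (metis option.exhaust)
    next
      case 2
      then have "Mt x = Some y \<longleftrightarrow> Mt' x = Some y" for y
        using is_matchingD(3)[OF m(1) 2, of y] is_matchingD(3)[OF m(2) 2, of y]
          is_matchingD(4)[OF m(1) _ 2, of y] is_matchingD(4)[OF m(2) _ 2, of y] agree[OF _ 2, of y] by blast
      then show ?thesis by (metis option.exhaust)
    next
      case 3
      then show ?thesis using is_matchingD(1)[OF m(1)] is_matchingD(1)[OF m(2)] by simp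
    qed
  qed
qed

text \<open>The set Q of greedily chosen edges is the solution of the recursion; absence of ties
  makes it a matching. Together with uniqueness this gives meaning to the definite description in
  \<open>stable_matching\<close>.\<close>

lemma stable_exists: "\<exists>Mt. is_stable Bl Rd Mt"
proof -
  obtain Q where Q: "\<And>x. Q x \<longleftrightarrow> x \<in> Bl \<times> Rd \<and> (\<forall>y. (y, x) \<in> closer \<longrightarrow> \<not> Q y)"
    by (rule wf_fixpoint[OF wf_closer, of "\<lambda>x. x \<in> Bl \<times> Rd"]) blast
  have QD: "b \<in> Bl" "r \<in> Rd" if "Q (b, r)" for b r using that Q by blast+
  have Qred: "r = r'" if "Q (b, r)" "Q (b, r')" for b r r'
  proof (rule ccontr)
    assume "r \<noteq> r'"
    then have "\<bar>b - r\<bar> \<noteq> \<bar>b - r'\<bar>" using QD[OF that(1)] QD[OF that(2)] disjoint by (intro no_ties) auto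
    then have "((b, r), (b, r')) \<in> closer \<or> ((b, r'), (b, r)) \<in> closer"
      using QD[OF that(1)] QD[OF that(2)] by (auto simp: closer_def)
    then show False using that Q by blast
  qed
  have Qblue: "b = b'" if "Q (b, r)" "Q (b', r)" for b b' r
  proof (rule ccontr)
    assume "b \<noteq> b'"
    then have "\<bar>r - b\<bar> \<noteq> \<bar>r - b'\<bar>" using QD[OF that(1)] QD[OF that(2)] disjoint by (intro no_ties) auto
    then have "((b, r), (b', r)) \<in> closer \<or> ((b', r), (b, r)) \<in> closer"
      using QD[OF that(1)] QD[OF that(2)] by (auto simp: closer_def)
    then show False using that Q by blast
  qed
  define Mt where "Mt x = (if \<exists>r. Q (x, r) then Some (THE r. Q (x, r))
     else if \<exists>b. Q (b, x) then Some (THE b. Q (b, x)) else None)" for x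
  have Mb: "Mt b = Some r \<longleftrightarrow> Q (b, r)" if "b \<in> Bl" for b r
  proof -
    have "\<not> Q (b', b)" for b' using that QD disjoint by blast
    moreover have "(THE r. Q (b, r)) = r'" if "Q (b, r')" for r' using that Qred by blast
    ultimately show ?thesis by (auto simp: Mt_def)
  qed
  have Mr: "Mt r = Some b \<longleftrightarrow> Q (b, r)" if "r \<in> Rd" for b r
  proof -
    have "\<not> Q (r, r')" for r' using that QD disjoint by blast
    moreover have "(THE b. Q (b, r)) = b'" if "Q (b', r)" for b' using that Qblue by blast
    ultimately show ?thesis by (auto simp: Mt_def)
  qed
  have "is_matching Bl Rd Mt"
    unfolding is_matching_def using Mb Mr QD by (auto simp: Mt_def)
  moreover have "\<not> ennreal \<bar>r - b\<bar> < min (mdist Mt r) (mdist Mt b)"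
    if br: "b \<in> Bl" "r \<in> Rd" "Mt r \<noteq> Some b" for b r
  proof -
    have "\<not> Q (b, r)" using br Mr by blast
    then obtain b' r' where y: "((b', r'), (b, r)) \<in> closer" "Q (b', r')"
      using Q[of "(b, r)"] br by auto
    then consider "b' = b" "\<bar>b - r'\<bar> < \<bar>b - r\<bar>" | "r' = r" "\<bar>b' - r\<bar> < \<bar>b - r\<bar>"
      by (auto simp: closer_def)
    then show ?thesis
    proof cases
      case 1
      then have "Mt b = Some r'" using Mb[OF br(1), of r'] y by simp
      then have "mdist Mt b \<le> ennreal \<bar>r - b\<bar>"
        using 1 by (auto simp: mdist_def intro!: ennreal_leI)
      then show ?thesis by (auto simp: not_less)
    next
      case 2
      then have "Mt r = Some b'" using Mr[OF br(2), of b'] y by simp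
      then have "mdist Mt r \<le> ennreal \<bar>r - b\<bar>"
        using 2 by (auto simp: mdist_def intro!: ennreal_leI)
      then show ?thesis by (auto simp: not_less)
    qed
  qed
  ultimately show ?thesis unfolding is_stable_def by blast
qed

lemma stable_matching_stable: "is_stable Bl Rd (stable_matching Bl Rd)"
  unfolding stable_matching_def
  by (rule theI'[of "is_stable Bl Rd"]) (use stable_exists stable_unique in blast)

end

text \<open>Cells are centred at the multiples of h, so that the origin is an inner point of cell 0,
  and half-open like the intervals counted by \<open>npts\<close>.\<close>

definition cell :: "real \<Rightarrow> real \<Rightarrow> int" where
  "cell h x = \<lceil>x / h - 1 / 2\<rceil>"

lemma cell_eq_iff: "h > 0 \<Longrightarrow> cell h x = j \<longleftrightarrow> (real_of_int j - 1 / 2) * h < x \<and> x \<le> (real_of_int j + 1 / 2) * h"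
  unfolding cell_def ceiling_eq_iff by (auto simp: field_simps)

lemma cell_0 [simp]: "cell h 0 = 0"
  by (simp add: cell_def ceiling_eq_iff)

lemma cell_dist:
  assumes "h > 0"
  shows "\<bar>\<bar>x - y\<bar> - h * \<bar>real_of_int (cell h x) - real_of_int (cell h y)\<bar>\<bar> < h"
proof -
  have "(real_of_int (cell h x) - 1 / 2) * h < x" "x \<le> (real_of_int (cell h x) + 1 / 2) * h"
    "(real_of_int (cell h y) - 1 / 2) * h < y" "y \<le> (real_of_int (cell h y) + 1 / 2) * h"
    using cell_eq_iff[OF assms, of x "cell h x"] cell_eq_iff[OF assms, of y "cell h y"] by auto
  moreover have "h * \<bar>real_of_int (cell h x) - real_of_int (cell h y)\<bar> = \<bar>h * real_of_int (cell h x) - h * real_of_int (cell h y)\<bar>"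
    using assms by (simp add: abs_mult right_diff_distrib[symmetric])
  ultimately show ?thesis by (simp add: algebra_simps)
qed

text \<open>Inside the core C the colours and the order of competing distances are those of the
  points, so both matchings satisfy one recursion there for edges of at most D cells. Outside C it
  is only known that a coloured cell contains a point of its colour; this suffices, because a point
  close to the core already belongs to it.\<close>

lemma mdist_imp_alive:
  fixes Bl Rd :: "real set" and s :: "int \<Rightarrow> int" and h \<tau> :: real
  assumes pc: "point_config Bl Rd" and st: "is_stable Bl Rd Mt" and h: "h > 0"
    and s1: "\<And>j. s j = 1 \<Longrightarrow> \<exists>x\<in>Bl. cell h x = j" and s2: "\<And>j. s j = -1 \<Longrightarrow> \<exists>x\<in>Rd. cell h x = j"
    and core: "\<And>x y. x \<in> C \<Longrightarrow> y \<in> Bl \<union> Rd \<Longrightarrow> \<bar>x - y\<bar> < \<tau> \<Longrightarrow> y \<in> C"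
    and sB: "\<And>x. x \<in> Bl \<inter> C \<Longrightarrow> s (cell h x) = 1" and sR: "\<And>x. x \<in> Rd \<inter> C \<Longrightarrow> s (cell h x) = -1"
    and ties: "\<And>x y z. x \<in> (Bl \<union> Rd) \<inter> C \<Longrightarrow> y \<in> (Bl \<union> Rd) \<inter> C \<Longrightarrow> z \<in> (Bl \<union> Rd) \<inter> C \<Longrightarrow>
       x \<noteq> y \<Longrightarrow> x \<noteq> z \<Longrightarrow> y \<noteq> z \<Longrightarrow>
       \<bar>\<bar>cell h x - cell h y\<bar> - \<bar>cell h x - cell h z\<bar>\<bar> > 1"
    and D: "(real D + 1) * h \<le> \<tau>"
    and zero: "0 \<in> Bl" "0 \<in> C" and dist: "mdist Mt 0 > ennreal ((real D + 1) * h)"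
  shows "alive s D 0"
proof -
  interpret point_config Bl Rd by (rule pc)
  have near: "\<bar>x - y\<bar> < \<tau>" if "\<bar>cell h x - cell h y\<bar> \<le> int D" for x y
  proof -
    have "h * \<bar>real_of_int (cell h x) - real_of_int (cell h y)\<bar> \<le> h * real D"
      using that h by (intro mult_left_mono) linarith+
    then show ?thesis using cell_dist[OF h, of x y] D by (simp add: algebra_simps)
  qed
  \<comment> \<open>A distance differs from h times the cell distance by less than h. Cell distances
    that differ by at least 2 are therefore ordered like the true distances, and they outweigh the
    tie-breaking bit of the key.\<close>
  have order: "edge_key (cell h x) (cell h y) < edge_key (cell h x) (cell h z) \<longleftrightarrow> \<bar>x - y\<bar> < \<bar>x - z\<bar>"
      "edge_key (cell h y) (cell h x) < edge_key (cell h z) (cell h x) \<longleftrightarrow> \<bar>y - x\<bar> < \<bar>z - x\<bar>"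
    if "x \<in> (Bl \<union> Rd) \<inter> C" "y \<in> (Bl \<union> Rd) \<inter> C" "z \<in> (Bl \<union> Rd) \<inter> C" "x \<noteq> y" "x \<noteq> z" "y \<noteq> z" for x y z
  proof -
    let ?a = "\<bar>cell h x - cell h y\<bar>" and ?b = "\<bar>cell h x - cell h z\<bar>"
    have ab: "?a + 2 \<le> ?b \<or> ?b + 2 \<le> ?a" using ties[OF that] by linarith
    have scale: "h * real_of_int m + 2 * h \<le> h * real_of_int n" if "m + 2 \<le> n" for m n
    proof -
      have "h * real_of_int (m + 2) \<le> h * real_of_int n" using that h by (intro mult_left_mono) auto
      then show ?thesis by (simp add: algebra_simps)
    qed
    have sep: "X < Y" if "A + 2 * h \<le> B" "\<bar>X - A\<bar> < h" "\<bar>Y - B\<bar> < h" for A B X Y :: real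
      using that by linarith
    have cd: "\<bar>\<bar>x - y\<bar> - h * real_of_int ?a\<bar> < h" "\<bar>\<bar>x - z\<bar> - h * real_of_int ?b\<bar> < h"
      using cell_dist[OF h, of x y] cell_dist[OF h, of x z] by simp_all
    have "\<bar>x - y\<bar> < \<bar>x - z\<bar>" if "?a + 2 \<le> ?b" using sep[OF scale[OF that] cd] .
    moreover have "\<bar>x - z\<bar> < \<bar>x - y\<bar>" if "?b + 2 \<le> ?a" using sep[OF scale[OF that] cd(2,1)] .
    ultimately have "?a < ?b \<longleftrightarrow> \<bar>x - y\<bar> < \<bar>x - z\<bar>" using ab by linarith
    moreover have "edge_key (cell h x) (cell h y) < edge_key (cell h x) (cell h z) \<longleftrightarrow> ?a < ?b"
      "edge_key (cell h y) (cell h x) < edge_key (cell h z) (cell h x) \<longleftrightarrow> ?a < ?b"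
      using ab by (auto simp: edge_key_def)
    ultimately show "edge_key (cell h x) (cell h y) < edge_key (cell h x) (cell h z) \<longleftrightarrow> \<bar>x - y\<bar> < \<bar>x - z\<bar>"
      "edge_key (cell h y) (cell h x) < edge_key (cell h z) (cell h x) \<longleftrightarrow> \<bar>y - x\<bar> < \<bar>z - x\<bar>"
      by (auto simp: abs_minus_commute)
  qed
  \<comment> \<open>Induction on the key: every competitor of the edge, on either side of the
    comparison, is again within D cells and inside the core.\<close>
  have agree: "Mt b = Some r \<longleftrightarrow> dmatch s (cell h b) (cell h r)"
    if "b \<in> Bl \<inter> C" "r \<in> Rd \<inter> C" "\<bar>cell h b - cell h r\<bar> \<le> int D" for b r
    using that
  proof (induction "edge_key (cell h b) (cell h r)" arbitrary: b r rule: less_induct)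
    case less
    have br: "b \<noteq> r" using less.prems disjoint by auto
    have dbr: "\<bar>b - r\<bar> < \<tau>" using near less.prems by blast
    have red: "(\<forall>r'\<in>Rd. \<bar>b - r'\<bar> < \<bar>b - r\<bar> \<longrightarrow> Mt b \<noteq> Some r') \<longleftrightarrow>
      (\<forall>j'. edge_key (cell h b) j' < edge_key (cell h b) (cell h r) \<longrightarrow> \<not> dmatch s (cell h b) j')" (is "?l = ?r")
    proof
      assume l: ?l
      show ?r
      proof (intro allI impI notI)
        fix j' assume j': "edge_key (cell h b) j' < edge_key (cell h b) (cell h r)" "dmatch s (cell h b) j'"
        obtain r' where r': "r' \<in> Rd" "cell h r' = j'" using s2 dmatchD[OF j'(2)] by blast
        have small: "\<bar>cell h b - cell h r'\<bar> \<le> int D"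
          using edge_key_less_abs[OF j'(1)] r' less.prems by linarith
        have C: "r' \<in> C" using core[of b r'] near[OF small] r' less.prems by auto
        have "r' \<noteq> r" "b \<noteq> r'" using j' r' disjoint less.prems by auto
        then have "\<bar>b - r'\<bar> < \<bar>b - r\<bar>" using order(1)[of b r' r] j' r' C less.prems br by auto
        moreover have "Mt b = Some r'" using less.hyps[of b r'] j' r' C less.prems small by auto
        ultimately show False using l r' by blast
      qed
    next
      assume r: ?r
      show ?l
      proof (intro ballI impI notI)
        fix r' assume r': "r' \<in> Rd" "\<bar>b - r'\<bar> < \<bar>b - r\<bar>" "Mt b = Some r'"
        have C: "r' \<in> C" using core[of b r'] dbr r' less.prems by auto
        have "r' \<noteq> r" "b \<noteq> r'" using r' disjoint less.prems by auto
        then have k: "edge_key (cell h b) (cell h r') < edge_key (cell h b) (cell h r)"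
          using order(1)[of b r' r] r' C less.prems br by auto
        then have "\<bar>cell h b - cell h r'\<bar> \<le> int D" using edge_key_less_abs[OF k] less.prems by linarith
        then have "dmatch s (cell h b) (cell h r')" using less.hyps[of b r'] k r' C less.prems by auto
        then show False using r k by blast
      qed
    qed
    have blue: "(\<forall>b'\<in>Bl. \<bar>b' - r\<bar> < \<bar>b - r\<bar> \<longrightarrow> Mt b' \<noteq> Some r) \<longleftrightarrow>
      (\<forall>i'. edge_key i' (cell h r) < edge_key (cell h b) (cell h r) \<longrightarrow> \<not> dmatch s i' (cell h r))" (is "?l = ?r")
    proof
      assume l: ?l
      show ?r
      proof (intro allI impI notI)
        fix i' assume i': "edge_key i' (cell h r) < edge_key (cell h b) (cell h r)" "dmatch s i' (cell h r)"
        obtain b' where b': "b' \<in> Bl" "cell h b' = i'" using s1 dmatchD[OF i'(2)] by blast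
        have small: "\<bar>cell h b' - cell h r\<bar> \<le> int D"
          using edge_key_less_abs[OF i'(1)] b' less.prems by linarith
        have C: "b' \<in> C" using core[of r b'] near[OF small] b' less.prems by (auto simp: abs_minus_commute)
        have "b' \<noteq> b" "b' \<noteq> r" using i' b' disjoint less.prems by auto
        then have "\<bar>b' - r\<bar> < \<bar>b - r\<bar>" using order(2)[of r b' b] i' b' C less.prems br by auto
        moreover have "Mt b' = Some r" using less.hyps[of b' r] i' b' C less.prems small by auto
        ultimately show False using l b' by blast
      qed
    next
      assume r: ?r
      show ?l
      proof (intro ballI impI notI)
        fix b' assume b': "b' \<in> Bl" "\<bar>b' - r\<bar> < \<bar>b - r\<bar>" "Mt b' = Some r"
        have C: "b' \<in> C" using core[of r b'] dbr b' less.prems by (auto simp: abs_minus_commute)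
        have "b' \<noteq> b" "b' \<noteq> r" using b' disjoint less.prems by auto
        then have k: "edge_key (cell h b') (cell h r) < edge_key (cell h b) (cell h r)"
          using order(2)[of r b' b] b' C less.prems br by auto
        then have "\<bar>cell h b' - cell h r\<bar> \<le> int D" using edge_key_less_abs[OF k] less.prems by linarith
        then have "dmatch s (cell h b') (cell h r)" using less.hyps[of b' r] k b' C less.prems by auto
        then show False using r k by blast
      qed
    qed
    have "s (cell h b) = 1" "s (cell h r) = -1" using sB sR less.prems by auto
    then show ?case
      using stable_iff[OF st, of b r] red blue less.prems dmatch.simps[of s "cell h b" "cell h r"] by auto
  qed
  show ?thesis unfolding alive_def
  proof (intro conjI allI impI notI)
    show "s 0 = 1" using sB[of 0] zero by simp
    fix j assume j: "\<bar>0 - j\<bar> \<le> int D" "dmatch s 0 j"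
    obtain r where r: "r \<in> Rd" "cell h r = j" using s2 dmatchD[OF j(2)] by blast
    have "\<bar>0 - r\<bar> < \<tau>" using near[of 0 r] j r by simp
    then have C: "r \<in> C" using core[of 0 r] zero r by auto
    have "Mt 0 = Some r" using agree[of 0 r] zero r C j by auto
    then have "mdist Mt 0 = ennreal \<bar>r\<bar>" by (simp add: mdist_def)
    moreover have "\<bar>r\<bar> \<le> (real D + 1) * h"
    proof -
      have "h * \<bar>real_of_int (cell h 0) - real_of_int (cell h r)\<bar> \<le> h * real D"
        using j r h by (intro mult_left_mono) auto
      then show ?thesis using cell_dist[OF h, of 0 r] by (simp add: algebra_simps)
    qed
    ultimately show False using dist ennreal_leI leD by metis
  qed
qed

section \<open>Counts of the Poisson processes in a grid of cells\<close>

lemma iid_exp_eq_sum: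
  "iid_exp p q n F = (\<Sum>xs | length xs = n \<and> set xs \<subseteq> {-1, 0, 1}.
     prod_list (map (\<lambda>a. if a = 1 then p else if a = -1 then q else 1 - p - q) xs) * F xs)"
proof (induction n arbitrary: F)
  case 0
  have "{xs. length xs = 0 \<and> set xs \<subseteq> {-1, 0, 1::int}} = {[]}" by auto
  then show ?case by simp
next
  case (Suc n)
  let ?w = "\<lambda>a. if a = (1::int) then p else if a = -1 then q else 1 - p - q"
  let ?L = "{xs. length xs = n \<and> set xs \<subseteq> {-1, 0, 1::int}}"
  have fin: "finite ?L"
    using finite_lists_length_eq[of "{-1, 0, 1::int}" n] by (simp add: conj_commute)
  have L: "{xs. length xs = Suc n \<and> set xs \<subseteq> {-1, 0, 1::int}} = (\<lambda>(a, xs). a # xs) ` ({-1, 0, 1} \<times> ?L)"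
    by (auto simp: length_Suc_conv image_iff)
  have "(\<Sum>xs | length xs = Suc n \<and> set xs \<subseteq> {-1, 0, 1}. prod_list (map ?w xs) * F xs) =
    (\<Sum>(a, xs)\<in>{-1, 0, 1} \<times> ?L. ?w a * prod_list (map ?w xs) * F (a # xs))"
    unfolding L by (subst sum.reindex) (auto simp: inj_on_def case_prod_beta)
  also have "\<dots> = (\<Sum>a\<in>{-1, 0, 1}. ?w a * (\<Sum>xs\<in>?L. prod_list (map ?w xs) * F (a # xs)))"
    using fin by (subst sum.cartesian_product[symmetric]) (simp add: sum_distrib_left mult.assoc)
  also have "\<dots> = iid_exp p q (Suc n) F"
    by (simp add: Suc)
  finally show ?case by simp
qed

text \<open>Cells with several points count as empty; such cells in the window make the
  configuration congested.\<close>

definition cell_sym :: "nat \<times> nat \<Rightarrow> int" where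
  "cell_sym z = (if z = (1, 0) then 1 else if z = (0, 1) then -1 else 0)"

lemma one_minus_exp_le: "1 - exp (- x) \<le> (x::real)"
  using exp_ge_add_one_self[of "-x"] by simp

lemma poisson_two_le: "0 \<le> x \<Longrightarrow> 1 - exp (- x) - x * exp (- x) \<le> (x::real)\<^sup>2"
proof -
  assume x: "0 \<le> x"
  have "(1 + x) * (1 - x) \<le> (1 + x) * exp (- x)"
    using x exp_ge_add_one_self[of "-x"] by (intro mult_left_mono) auto
  then show ?thesis by (simp add: algebra_simps power2_eq_square)
qed

locale poisson_pair =
  fixes M :: "'a measure" and B R :: "'a \<Rightarrow> real set" and lam mu :: real
  assumes lam_pos: "0 < lam" and mu_pos: "0 < mu"
    and processes: "indep_poisson_processes M lam mu B R"
begin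

sublocale prob_space M
  using processes by (simp add: indep_poisson_processes_def)

abbreviation "\<kappa> \<equiv> lam + mu"

definition cells :: "real \<Rightarrow> int \<Rightarrow> 'a \<Rightarrow> nat \<times> nat" where
  "cells h j \<omega> = (npts (B \<omega>) ((j - 1 / 2) * h) ((j + 1 / 2) * h),
                  npts (R \<omega>) ((j - 1 / 2) * h) ((j + 1 / 2) * h))"

lemma finB: "\<omega> \<in> space M \<Longrightarrow> finite (B \<omega> \<inter> {a..b})"
  and finR: "\<omega> \<in> space M \<Longrightarrow> finite (R \<omega> \<inter> {a..b})"
  using processes by (auto simp: indep_poisson_processes_def poisson_count_def)

lemma npts_B:
  assumes "a < b"
  shows "(\<lambda>\<omega>. npts (B \<omega>) a b) \<in> measurable M (count_space UNIV)"
    "prob {\<omega>\<in>space M. npts (B \<omega>) a b = k} = (lam * (b - a)) ^ k / fact k * exp (- (lam * (b - a)))"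
  using processes assms by (auto simp: indep_poisson_processes_def poisson_count_def)

lemma npts_R:
  assumes "a < b"
  shows "(\<lambda>\<omega>. npts (R \<omega>) a b) \<in> measurable M (count_space UNIV)"
    "prob {\<omega>\<in>space M. npts (R \<omega>) a b = k} = (mu * (b - a)) ^ k / fact k * exp (- (mu * (b - a)))"
  using processes assms by (auto simp: indep_poisson_processes_def poisson_count_def)

lemma cells_bounds: "h > 0 \<Longrightarrow> (real_of_int j - 1 / 2) * h < (real_of_int j + 1 / 2) * h"
  "(real_of_int j + 1 / 2) * h - (real_of_int j - 1 / 2) * h = h"
  by (simp_all add: algebra_simps)

lemma disj_cells:
  assumes "h > 0" "distinct js"
  shows "disj_intervals (length js) (\<lambda>k. (real_of_int (js ! k) - 1 / 2) * h) (\<lambda>k. (real_of_int (js ! k) + 1 / 2) * h)"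
  unfolding disj_intervals_def
proof (intro conjI allI impI)
  fix i j assume ij: "i < length js" "j < length js" "i \<noteq> j"
  have "js ! i \<noteq> js ! j" using ij assms(2) by (simp add: nth_eq_iff_index_eq)
  then show "{(real_of_int (js ! i) - 1 / 2) * h<..(real_of_int (js ! i) + 1 / 2) * h} \<inter>
      {(real_of_int (js ! j) - 1 / 2) * h<..(real_of_int (js ! j) + 1 / 2) * h} = {}"
    by (metis (no_types, lifting) assms(1) cell_eq_iff disjoint_iff greaterThanAtMost_iff)
qed (use assms in simp)

lemma indep_counts:
  assumes "h > 0" "distinct js"
  shows "indep_vars (\<lambda>_. count_space (UNIV :: nat set))
     (\<lambda>i \<omega>. case i of Inl k \<Rightarrow> npts (B \<omega>) ((real_of_int (js ! k) - 1 / 2) * h) ((real_of_int (js ! k) + 1 / 2) * h)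
        | Inr k \<Rightarrow> npts (R \<omega>) ((real_of_int (js ! k) - 1 / 2) * h) ((real_of_int (js ! k) + 1 / 2) * h))
     ({..<length js} <+> {..<length js})"
  using processes disj_cells[OF assms] unfolding indep_poisson_processes_def by blast

text \<open>The blue and red counts are jointly independent, and grouping them in disjoint pairs
  preserves independence.\<close>

lemma indep_cells:
  assumes "h > 0" "distinct js"
  shows "indep_vars (\<lambda>_. count_space UNIV) (\<lambda>k. cells h (js ! k)) {..<length js}"
proof -
  let ?X = "\<lambda>i \<omega>. case i of Inl k \<Rightarrow> npts (B \<omega>) ((real_of_int (js ! k) - 1 / 2) * h) ((real_of_int (js ! k) + 1 / 2) * h)
        | Inr k \<Rightarrow> npts (R \<omega>) ((real_of_int (js ! k) - 1 / 2) * h) ((real_of_int (js ! k) + 1 / 2) * h)"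
  let ?K = "\<lambda>k::nat. {Inl k, Inr k :: nat + nat}"
  let ?N = "\<lambda>_. count_space (UNIV :: nat set)"
  have "indep_vars (\<lambda>k. PiM (?K k) ?N) (\<lambda>k \<omega>. restrict (\<lambda>i. ?X i \<omega>) (?K k)) {..<length js}"
    by (rule indep_vars_restrict[OF indep_counts[OF assms]]) (auto simp: disjoint_family_on_def)
  then have "indep_vars (\<lambda>_. count_space UNIV)
    (\<lambda>k \<omega>. (\<lambda>f. (f (Inl k), f (Inr k))) (restrict (\<lambda>i. ?X i \<omega>) (?K k))) {..<length js}"
  proof (rule indep_vars_compose2)
    fix k :: nat
    have "(\<lambda>f. (f (Inl k), f (Inr k))) \<in> measurable (PiM (?K k) ?N) (count_space UNIV \<Otimes>\<^sub>M count_space UNIV)"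
      by (intro measurable_Pair measurable_component_singleton) auto
    then show "(\<lambda>f. (f (Inl k), f (Inr k))) \<in> measurable (PiM (?K k) ?N) (count_space UNIV)"
      by (simp add: pair_measure_countable)
  qed
  then show ?thesis by (simp add: cells_def[abs_def])
qed

lemma measurable_cells: "h > 0 \<Longrightarrow> cells h j \<in> measurable M (count_space UNIV)"
  using indep_cells[of h "[j]"] unfolding indep_vars_def by simp

lemma sets_cells: "h > 0 \<Longrightarrow> {\<omega>\<in>space M. P (cells h j \<omega>)} \<in> events"
  using measurable_sets[OF measurable_cells, of h "Collect P" j]
  by (simp add: vimage_def Int_def conj_commute)

lemma prob_cells_all:
  assumes "h > 0" "distinct js"
  shows "prob {\<omega>\<in>space M. \<forall>k<length js. P k (cells h (js ! k) \<omega>)} =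
    (\<Prod>k<length js. prob {\<omega>\<in>space M. P k (cells h (js ! k) \<omega>)})"
proof (cases "js = []")
  case True
  then show ?thesis by (simp add: prob_space)
next
  case False
  have "prob (\<Inter>k\<in>{..<length js}. cells h (js ! k) -` Collect (P k) \<inter> space M) =
    (\<Prod>k<length js. prob (cells h (js ! k) -` Collect (P k) \<inter> space M))"
    using False by (intro indep_varsD_finite[OF indep_cells[OF assms]]) auto
  moreover have "(\<Inter>k\<in>{..<length js}. cells h (js ! k) -` Collect (P k) \<inter> space M) =
    {\<omega>\<in>space M. \<forall>k<length js. P k (cells h (js ! k) \<omega>)}" using False by auto
  moreover have "cells h (js ! k) -` Collect (P k) \<inter> space M = {\<omega>\<in>space M. P k (cells h (js ! k) \<omega>)}" for k
    by auto
  ultimately show ?thesis by simp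
qed

lemma prob_cell:
  assumes h: "h > 0"
  shows "prob {\<omega>\<in>space M. cells h j \<omega> = (a, b)} =
    (lam * h) ^ a / fact a * ((mu * h) ^ b / fact b) * exp (- (\<kappa> * h))"
proof -
  let ?l = "(real_of_int j - 1 / 2) * h" and ?u = "(real_of_int j + 1 / 2) * h"
  let ?X = "\<lambda>i \<omega>. case i of Inl k \<Rightarrow> npts (B \<omega>) ((real_of_int ([j] ! k) - 1 / 2) * h) ((real_of_int ([j] ! k) + 1 / 2) * h)
        | Inr k \<Rightarrow> npts (R \<omega>) ((real_of_int ([j] ! k) - 1 / 2) * h) ((real_of_int ([j] ! k) + 1 / 2) * h)"
  let ?A = "\<lambda>i::nat + nat. case i of Inl _ \<Rightarrow> {a} | Inr _ \<Rightarrow> {b}"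
  have I: "{..<length [j]} <+> {..<length [j]} = {Inl 0, Inr 0}" by (auto simp: less_Suc_eq)
  have "prob (\<Inter>i\<in>{Inl 0, Inr 0}. ?X i -` ?A i \<inter> space M) = (\<Prod>i\<in>{Inl 0, Inr 0}. prob (?X i -` ?A i \<inter> space M))"
    by (rule indep_varsD[OF indep_counts[OF h, of "[j]"]]) (auto split: sum.split)
  moreover have "(\<Inter>i\<in>{Inl 0, Inr 0}. ?X i -` ?A i \<inter> space M) = {\<omega>\<in>space M. cells h j \<omega> = (a, b)}"
    by (auto simp: cells_def)
  moreover have "?X (Inl 0) -` ?A (Inl 0) \<inter> space M = {\<omega>\<in>space M. npts (B \<omega>) ?l ?u = a}"
    "?X (Inr 0) -` ?A (Inr 0) \<inter> space M = {\<omega>\<in>space M. npts (R \<omega>) ?l ?u = b}" by auto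
  ultimately have "prob {\<omega>\<in>space M. cells h j \<omega> = (a, b)} =
     prob {\<omega>\<in>space M. npts (B \<omega>) ?l ?u = a} * prob {\<omega>\<in>space M. npts (R \<omega>) ?l ?u = b}" by simp
  also have "\<dots> = ((lam * h) ^ a / fact a * exp (- (lam * h))) * ((mu * h) ^ b / fact b * exp (- (mu * h)))"
    unfolding npts_B(2)[OF cells_bounds(1)[OF h]] npts_R(2)[OF cells_bounds(1)[OF h]] cells_bounds(2) ..
  also have "\<dots> = (lam * h) ^ a / fact a * ((mu * h) ^ b / fact b) * exp (- (\<kappa> * h))"
  proof -
    have "exp (- (\<kappa> * h)) = exp (- (lam * h)) * exp (- (mu * h))"
      by (simp add: distrib_right flip: exp_add)
    then show ?thesis by (simp only: mult_ac)
  qed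
  finally show ?thesis .
qed

lemma prob_cell_nonempty: "h > 0 \<Longrightarrow> prob {\<omega>\<in>space M. cells h j \<omega> \<noteq> (0, 0)} = 1 - exp (- (\<kappa> * h))"
  using prob_neg[of "\<lambda>\<omega>. cells h j \<omega> = (0, 0)"] sets_cells[of h "\<lambda>z. z = (0, 0)" j] prob_cell[of h j 0 0]
  by simp

lemma prob_cell_multi:
  assumes h: "h > 0"
  shows "prob {\<omega>\<in>space M. 2 \<le> fst (cells h j \<omega>) + snd (cells h j \<omega>)} \<le> (\<kappa> * h)\<^sup>2"
proof -
  let ?E = "\<lambda>z. {\<omega>\<in>space M. cells h j \<omega> = z}"
  have m: "?E z \<in> events" for z using sets_cells[OF h, of "\<lambda>y. y = z"] by simp
  have "prob (space M - (?E (0, 0) \<union> ?E (1, 0) \<union> ?E (0, 1))) = 1 - prob (?E (0, 0) \<union> ?E (1, 0) \<union> ?E (0, 1))"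
    using m by (intro prob_compl) auto
  also have "prob (?E (0, 0) \<union> ?E (1, 0) \<union> ?E (0, 1)) = prob (?E (0, 0)) + prob (?E (1, 0)) + prob (?E (0, 1))"
    using m by (subst finite_measure_Union; (subst finite_measure_Union)?) auto
  also have "\<dots> = exp (- (\<kappa> * h)) + \<kappa> * h * exp (- (\<kappa> * h))"
    using h by (simp add: prob_cell algebra_simps)
  also have "1 - \<dots> \<le> (\<kappa> * h)\<^sup>2"
    using poisson_two_le[of "\<kappa> * h"] h lam_pos mu_pos by simp
  also have "space M - (?E (0, 0) \<union> ?E (1, 0) \<union> ?E (0, 1)) = {\<omega>\<in>space M. 2 \<le> fst (cells h j \<omega>) + snd (cells h j \<omega>)}"
    by (auto simp: prod_eq_iff)
  finally show ?thesis .
qed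

definition syms :: "real \<Rightarrow> int list \<Rightarrow> 'a \<Rightarrow> int list" where
  "syms h js \<omega> = map (\<lambda>j. cell_sym (cells h j \<omega>)) js"

abbreviation "pB h \<equiv> lam * h * exp (- (\<kappa> * h))"
abbreviation "pR h \<equiv> mu * h * exp (- (\<kappa> * h))"

lemma prob_cell_sym:
  assumes h: "h > 0" and a: "a \<in> {-1, 0, 1}"
  shows "prob {\<omega>\<in>space M. cell_sym (cells h j \<omega>) = a} = (if a = 1 then pB h else if a = -1 then pR h else 1 - pB h - pR h)"
proof -
  let ?E = "\<lambda>z. {\<omega>\<in>space M. cells h j \<omega> = z}"
  have m: "?E z \<in> events" for z using sets_cells[OF h, of "\<lambda>y. y = z"] by simp
  have p: "prob (?E (1, 0)) = pB h" "prob (?E (0, 1)) = pR h" using h by (simp_all add: prob_cell)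
  have "{\<omega>\<in>space M. cell_sym (cells h j \<omega>) = 1} = ?E (1, 0)"
    "{\<omega>\<in>space M. cell_sym (cells h j \<omega>) = -1} = ?E (0, 1)"
    "{\<omega>\<in>space M. cell_sym (cells h j \<omega>) = 0} = space M - (?E (1, 0) \<union> ?E (0, 1))"
    by (auto simp: cell_sym_def)
  moreover have "prob (space M - (?E (1, 0) \<union> ?E (0, 1))) = 1 - pB h - pR h"
  proof -
    have "prob (space M - (?E (1, 0) \<union> ?E (0, 1))) = 1 - prob (?E (1, 0) \<union> ?E (0, 1))"
      using m by (intro prob_compl) auto
    also have "prob (?E (1, 0) \<union> ?E (0, 1)) = prob (?E (1, 0)) + prob (?E (0, 1))"
      using m by (subst finite_measure_Union) auto
    finally show ?thesis using p by simp
  qed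
  ultimately show ?thesis using a p by auto
qed

lemma sets_syms: "h > 0 \<Longrightarrow> {\<omega>\<in>space M. syms h js \<omega> = xs} \<in> events"
proof (induction js arbitrary: xs)
  case (Cons j js)
  have "{\<omega>\<in>space M. syms h (j # js) \<omega> = xs} =
     (if xs = [] then {} else {\<omega>\<in>space M. cell_sym (cells h j \<omega>) = hd xs} \<inter> {\<omega>\<in>space M. syms h js \<omega> = tl xs})"
    by (cases xs) (auto simp: syms_def)
  moreover have "{\<omega>\<in>space M. cell_sym (cells h j \<omega>) = hd xs} \<in> events"
    using sets_cells[OF Cons.prems, of "\<lambda>z. cell_sym z = hd xs"] by simp
  ultimately show ?case using Cons by auto
qed (auto simp: syms_def)

text \<open>The bridge from words to the processes: the symbols of distinct cells are i.i.d. with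
  the weights of \<open>iid_exp\<close>.\<close>

lemma prob_syms:
  assumes h: "h > 0" and js: "distinct js"
  shows "{\<omega>\<in>space M. G (syms h js \<omega>)} \<in> events" (is ?E)
    "prob {\<omega>\<in>space M. G (syms h js \<omega>)} = iid_exp (pB h) (pR h) (length js) (\<lambda>xs. of_bool (G xs))" (is ?P)
proof -
  let ?L = "{xs. length xs = length js \<and> set xs \<subseteq> {-1, 0, 1::int}}"
  let ?w = "\<lambda>a. if a = (1::int) then pB h else if a = -1 then pR h else 1 - pB h - pR h"
  have fin: "finite ?L"
    using finite_lists_length_eq[of "{-1, 0, 1::int}" "length js"] by (simp add: conj_commute)
  then have fin': "finite {xs\<in>?L. G xs}" by (rule finite_subset[rotated]) auto
  have sL: "syms h js \<omega> \<in> ?L" for \<omega> by (auto simp: syms_def cell_sym_def)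
  have eq: "{\<omega>\<in>space M. G (syms h js \<omega>)} = (\<Union>xs\<in>{xs\<in>?L. G xs}. {\<omega>\<in>space M. syms h js \<omega> = xs})"
    using sL by blast
  have each: "prob {\<omega>\<in>space M. syms h js \<omega> = xs} = prod_list (map ?w xs)" if "xs \<in> ?L" for xs
  proof -
    have "{\<omega>\<in>space M. syms h js \<omega> = xs} = {\<omega>\<in>space M. \<forall>k<length js. cell_sym (cells h (js ! k) \<omega>) = xs ! k}"
      using that by (auto simp: syms_def list_eq_iff_nth_eq)
    also have "prob \<dots> = (\<Prod>k<length js. prob {\<omega>\<in>space M. cell_sym (cells h (js ! k) \<omega>) = xs ! k})"
      by (rule prob_cells_all[OF h js])
    also have "\<dots> = (\<Prod>k<length xs. ?w (xs ! k))"
    proof (rule prod.cong)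
      fix k assume "k \<in> {..<length xs}"
      then have "xs ! k \<in> {-1, 0, 1}" using that nth_mem by blast
      then show "prob {\<omega>\<in>space M. cell_sym (cells h (js ! k) \<omega>) = xs ! k} = ?w (xs ! k)"
        by (rule prob_cell_sym[OF h])
    qed (use that in simp)
    also have "\<dots> = prod_list (map ?w xs)"
      by (simp add: prod.list_conv_set_nth atLeast0LessThan)
    finally show ?thesis .
  qed
  show ?E unfolding eq using fin' sets_syms[OF h] by (intro sets.finite_UN) auto
  have "prob {\<omega>\<in>space M. G (syms h js \<omega>)} = (\<Sum>xs\<in>{xs\<in>?L. G xs}. prob {\<omega>\<in>space M. syms h js \<omega> = xs})"
    unfolding eq using fin' sets_syms[OF h]
    by (intro finite_measure_finite_Union) (auto simp: disjoint_family_on_def)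
  also have "\<dots> = (\<Sum>xs\<in>{xs\<in>?L. G xs}. prod_list (map ?w xs))" using each by (intro sum.cong) auto
  also have "\<dots> = (\<Sum>xs\<in>?L. prod_list (map ?w xs) * of_bool (G xs))"
    using fin by (simp add: of_bool_def if_distrib[where f = "\<lambda>x. _ * x"] sum.If_cases Int_def conj_commute cong: if_cong)
  finally show ?P by (simp only: iid_exp_eq_sum)
qed

text \<open>The point added at the origin makes the cell 0 blue.\<close>

definition palm_sym :: "real \<Rightarrow> 'a \<Rightarrow> int \<Rightarrow> int" where
  "palm_sym h \<omega> j = (if j = 0 then 1 else cell_sym (cells h j \<omega>))"

definition E_alive :: "real \<Rightarrow> nat \<Rightarrow> 'a set" where
  "E_alive h D = {\<omega>\<in>space M. alive (palm_sym h \<omega>) D 0}"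

end

section \<open>Rare cell configurations\<close>

text \<open>The positions within 1 of y or of its mirror image 2 x - y in x: those whose distance
  from x nearly ties with that of y.\<close>

definition near :: "int \<Rightarrow> int \<Rightarrow> int set" where
  "near x y = {y - 1, y, y + 1, 2 * x - y - 1, 2 * x - y, 2 * x - y + 1}"

lemma nearI: "\<bar>\<bar>x - y\<bar> - \<bar>x - z\<bar>\<bar> \<le> 1 \<Longrightarrow> z \<in> near x y"
  unfolding near_def by (cases "x \<le> y"; cases "x \<le> z") auto

lemma near_finite: "finite (near x y)" "card (near x y) \<le> 6"
  unfolding near_def by (auto simp: card_insert_if)

text \<open>Two free cells and six choices for the third give of order L^2 triples. Each is fully
  occupied with probability of order h^3, and L has order 1 / h, so the union is of order h.\<close>

definition tie3 :: "nat \<Rightarrow> (int \<times> int \<times> int) set" where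
  "tie3 L = {(x, y, z). \<bar>x\<bar> \<le> int L \<and> \<bar>y\<bar> \<le> int L \<and> x \<noteq> y \<and> x \<noteq> z \<and> y \<noteq> z \<and> z \<in> near x y}"

definition tie2 :: "nat \<Rightarrow> (int \<times> int) set" where
  "tie2 L = {(x, y). \<bar>x\<bar> \<le> int L \<and> x \<noteq> y \<and> y \<in> near x 0 \<union> near 0 x}"

lemma card_window: "card {- int L..int L} = 2 * L + 1"
  by simp

lemma tie3_finite: "finite (tie3 L)" "card (tie3 L) \<le> 6 * (2 * L + 1)\<^sup>2"
proof -
  let ?W = "{- int L..int L}"
  let ?S = "SIGMA x:?W. SIGMA y:?W. near x y"
  have sub: "tie3 L \<subseteq> ?S" by (auto simp: tie3_def abs_le_iff)
  have fin: "finite ?S" using near_finite by (intro finite_SigmaI) auto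
  then show "finite (tie3 L)" using sub finite_subset by blast
  have "card (tie3 L) \<le> card ?S" using sub fin by (rule card_mono[rotated])
  also have "\<dots> = (\<Sum>x\<in>?W. \<Sum>y\<in>?W. card (near x y))"
    using near_finite by (simp add: card_SigmaI finite_SigmaI)
  also have "\<dots> \<le> (\<Sum>x\<in>?W. \<Sum>y\<in>?W. 6)" using near_finite by (intro sum_mono) auto
  also have "\<dots> = 6 * (2 * L + 1)\<^sup>2"
    by (simp only: sum_constant card_window) (simp add: power2_eq_square algebra_simps)
  finally show "card (tie3 L) \<le> 6 * (2 * L + 1)\<^sup>2" .
qed

lemma tie2_finite: "finite (tie2 L)" "card (tie2 L) \<le> 12 * (2 * L + 1)"
proof -
  let ?W = "{- int L..int L}"
  let ?S = "SIGMA x:?W. near x 0 \<union> near 0 x"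
  have sub: "tie2 L \<subseteq> ?S" by (auto simp: tie2_def abs_le_iff)
  have fin: "finite ?S" using near_finite by (intro finite_SigmaI) auto
  then show "finite (tie2 L)" using sub finite_subset by blast
  have "card (tie2 L) \<le> card ?S" using sub fin by (rule card_mono[rotated])
  also have "\<dots> = (\<Sum>x\<in>?W. card (near x 0 \<union> near 0 x))"
    using near_finite by (simp add: card_SigmaI)
  also have "\<dots> \<le> (\<Sum>x\<in>?W. 12)"
  proof (rule sum_mono)
    fix x show "card (near x 0 \<union> near 0 x) \<le> 12"
      using card_Un_le[of "near x 0" "near 0 x"] near_finite(2)[of x 0] near_finite(2)[of 0 x] by linarith
  qed
  also have "\<dots> = 12 * (2 * L + 1)" by (simp only: sum_constant card_window) simp
  finally show "card (tie2 L) \<le> 12 * (2 * L + 1)" .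
qed

context poisson_pair
begin

lemma prob_E_alive:
  assumes h: "h > 0" and r: "radius D \<le> r" and w: "lazy_walk (pB h) (pR h)"
  shows "E_alive h D \<in> events" "prob (E_alive h D) = lazy_walk.palm_alive (pB h) (pR h) r D"
proof -
  interpret lazy_walk "pB h" "pR h" by (rule w)
  \<comment> \<open>The cells -r, ..., -1 and 1, ..., r. Cell 0 is left out, since the added point
    fixes its letter; the blue letter is inserted in the middle.\<close>
  define js where "js = map (\<lambda>k. int k - int r) [0..<r] @ map (\<lambda>k. int k + 1) [0..<r]"
  define G where "G xs = alive (conf (take r xs @ 1 # drop r xs)) D (int r + 1)" for xs
  have js: "distinct js" "length js = r + r"
    by (auto simp: js_def distinct_map inj_on_def)
  have eq: "E_alive h D = {\<omega>\<in>space M. G (syms h js \<omega>)}"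
  proof -
    have "alive (palm_sym h \<omega>) D 0 = G (syms h js \<omega>)" for \<omega>
    proof -
      let ?xs = "syms h js \<omega>"
      let ?ys = "take r ?xs @ 1 # drop r ?xs"
      have "G ?xs = alive (\<lambda>x. conf ?ys (x + (int r + 1))) D 0"
        unfolding G_def by (subst alive_shift) simp
      also have "\<dots> = alive (palm_sym h \<omega>) D 0"
      proof (rule alive_local)
        fix x assume "\<bar>x - 0\<bar> \<le> int (radius D)"
        then have x: "\<bar>x\<bar> \<le> int r" using r by simp
        define y where "y = nat (x + int r)"
        have y: "x = int y - int r" "y \<le> 2 * r" using x by (auto simp: y_def)
        have len: "length ?xs = r + r" by (simp add: syms_def js)
        have "conf ?ys (x + (int r + 1)) = ?ys ! y"
          using y len by (simp add: conf_def)
        also have "\<dots> = palm_sym h \<omega> x"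
        proof -
          consider "y < r" | "y = r" | k where "y = r + Suc k" "k < r"
            using y(2) by (metis add_Suc_right add_diff_inverse_nat less_Suc_eq_le mult_2 nat_add_left_cancel_le
                not_less_iff_gr_or_eq less_imp_Suc_add Suc_le_eq)
          then show ?thesis
          proof cases
            case 1
            then show ?thesis using y len by (simp add: nth_append syms_def js_def palm_sym_def)
          next
            case 2
            then show ?thesis using y len by (simp add: nth_append palm_sym_def)
          next
            case 3
            then show ?thesis using y len by (simp add: nth_append syms_def js_def palm_sym_def add.commute)
          qed
        qed
        finally show "conf ?ys (x + (int r + 1)) = palm_sym h \<omega> x" .
      qed
      finally show ?thesis by simp
    qed
    then show ?thesis by (simp add: E_alive_def)
  qed
  show "E_alive h D \<in> events" unfolding eq by (rule prob_syms(1)[OF h js(1)])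
  have "prob (E_alive h D) = E (r + r) (\<lambda>xs. of_bool (G xs))"
    unfolding eq using prob_syms(2)[OF h js(1), of G] js(2) by simp
  also have "\<dots> = palm_alive r D"
    unfolding E_append palm_alive_def G_def by (rule E_cong)+ simp
  finally show "prob (E_alive h D) = palm_alive r D" .
qed

definition all_occupied :: "real \<Rightarrow> int list \<Rightarrow> 'a set" where
  "all_occupied h js = {\<omega>\<in>space M. \<forall>k<length js. cells h (js ! k) \<omega> \<noteq> (0, 0)}"

lemma prob_occupied_eq:
  assumes h: "h > 0" and js: "distinct js"
  shows "prob (all_occupied h js) = (1 - exp (- (\<kappa> * h))) ^ length js"
  using prob_cells_all[OF h js, of "\<lambda>_ z. z \<noteq> (0, 0)"]
  by (simp add: all_occupied_def prob_cell_nonempty[OF h])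

lemma prob_occupied:
  assumes h: "h > 0" and js: "distinct js"
  shows "prob (all_occupied h js) \<le> (\<kappa> * h) ^ length js"
  unfolding prob_occupied_eq[OF assms]
  using h lam_pos mu_pos one_minus_exp_le by (intro power_mono) auto

text \<open>
  Distances of points and of their cells are ordered alike unless two of the latter differ by
  at most one; tie2 covers the triples that contain the added point at the origin.
\<close>

definition congested :: "real \<Rightarrow> nat \<Rightarrow> 'a set" where
  "congested h L = {\<omega>\<in>space M. cells h 0 \<omega> \<noteq> (0, 0)} \<union>
     (\<Union>j\<in>{- int L..int L}. {\<omega>\<in>space M. 2 \<le> fst (cells h j \<omega>) + snd (cells h j \<omega>)}) \<union>
     (\<Union>(x, y, z)\<in>tie3 L. all_occupied h [x, y, z]) \<union>
     (\<Union>(x, y)\<in>tie2 L. all_occupied h [x, y])"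

lemma sets_occupied: "h > 0 \<Longrightarrow> all_occupied h js \<in> events"
  unfolding all_occupied_def by (intro sets.sets_Collect_countable_All sets.sets_Collect_imp sets_cells) auto

lemma sets_congested: "h > 0 \<Longrightarrow> congested h L \<in> events"
  unfolding congested_def using tie2_finite(1) tie3_finite(1)
  by (intro sets.Un sets.finite_UN)
    (auto intro!: sets_cells[of h "\<lambda>z. z \<noteq> (0, 0)"] sets_cells[of h "\<lambda>z. 2 \<le> fst z + snd z"] sets_occupied)

text \<open>The quantity bounded by V is the mean number of points in the window. While V stays
  bounded, all four sources of congestion have probability of order h: one cell at the origin, about
  1 / h cells with two points, 1 / h pairs and 1 / h^2 triples.\<close>

lemma prob_congested:
  assumes h: "h > 0" and V: "real (2 * L + 1) * (\<kappa> * h) \<le> V"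
  shows "prob (congested h L) \<le> \<kappa> * h * (1 + 13 * V + 6 * V\<^sup>2)"
proof -
  have e: "0 \<le> \<kappa> * h" using h lam_pos mu_pos by simp
  let ?U1 = "\<Union>j\<in>{- int L..int L}. {\<omega>\<in>space M. 2 \<le> fst (cells h j \<omega>) + snd (cells h j \<omega>)}"
  let ?U2 = "\<Union>(x, y, z)\<in>tie3 L. all_occupied h [x, y, z]"
  let ?U3 = "\<Union>(x, y)\<in>tie2 L. all_occupied h [x, y]"
  let ?U0 = "{\<omega>\<in>space M. cells h 0 \<omega> \<noteq> (0, 0)}"
  have m: "?U0 \<in> events" "?U1 \<in> events" "?U2 \<in> events" "?U3 \<in> events"
    using h tie2_finite(1) tie3_finite(1)
    by (auto intro!: sets_cells[of h "\<lambda>z. z \<noteq> (0, 0)"] sets_cells[of h "\<lambda>z. 2 \<le> fst z + snd z"] sets_occupied)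
  have V1: "real (2 * L + 1) * (\<kappa> * h) * (\<kappa> * h) \<le> V * (\<kappa> * h)"
    using V e by (rule mult_right_mono)
  have p0: "prob ?U0 \<le> \<kappa> * h" using prob_cell_nonempty[OF h] one_minus_exp_le[of "\<kappa> * h"] by simp
  have p1: "prob ?U1 \<le> V * (\<kappa> * h)"
  proof -
    have "prob ?U1 \<le> (\<Sum>j\<in>{- int L..int L}. prob {\<omega>\<in>space M. 2 \<le> fst (cells h j \<omega>) + snd (cells h j \<omega>)})"
      using h by (intro finite_measure_subadditive_finite) (auto intro!: sets_cells[of h "\<lambda>z. 2 \<le> fst z + snd z"])
    also have "\<dots> \<le> (\<Sum>j\<in>{- int L..int L}. (\<kappa> * h)\<^sup>2)" by (intro sum_mono prob_cell_multi h)
    also have "\<dots> = real (2 * L + 1) * (\<kappa> * h) * (\<kappa> * h)"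
      by (simp only: sum_constant card_window) (simp add: power2_eq_square)
    finally show ?thesis using V1 by linarith
  qed
  have p2: "prob ?U2 \<le> 6 * V\<^sup>2 * (\<kappa> * h)"
  proof -
    have "prob ?U2 \<le> (\<Sum>(x, y, z)\<in>tie3 L. prob (all_occupied h [x, y, z]))"
      using h tie3_finite(1) unfolding case_prod_beta
      by (intro finite_measure_subadditive_finite) (auto intro!: sets_occupied)
    also have "\<dots> \<le> (\<Sum>(x, y, z)\<in>tie3 L. (\<kappa> * h) ^ 3)"
    proof (rule sum_mono, safe)
      fix x y z assume "(x, y, z) \<in> tie3 L"
      then have "distinct [x, y, z]" by (auto simp: tie3_def)
      from prob_occupied[OF h this]
      show "prob (all_occupied h [x, y, z]) \<le> (\<kappa> * h) ^ 3"
        by (simp add: eval_nat_numeral)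
    qed
    also have "\<dots> = real (card (tie3 L)) * (\<kappa> * h) ^ 3" by simp
    also have "\<dots> \<le> real (6 * (2 * L + 1)\<^sup>2) * (\<kappa> * h) ^ 3"
      using tie3_finite(2)[of L] e by (intro mult_right_mono) (auto simp only: of_nat_le_iff zero_le_power)
    also have "\<dots> = 6 * (real (2 * L + 1) * (\<kappa> * h))\<^sup>2 * (\<kappa> * h)"
      by (simp add: power2_eq_square power3_eq_cube algebra_simps)
    also have "\<dots> \<le> 6 * V\<^sup>2 * (\<kappa> * h)"
      using V e by (intro mult_right_mono mult_left_mono power_mono) auto
    finally show ?thesis .
  qed
  have p3: "prob ?U3 \<le> 12 * V * (\<kappa> * h)"
  proof -
    have "prob ?U3 \<le> (\<Sum>(x, y)\<in>tie2 L. prob (all_occupied h [x, y]))"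
      using h tie2_finite(1) unfolding case_prod_beta
      by (intro finite_measure_subadditive_finite) (auto intro!: sets_occupied)
    also have "\<dots> \<le> (\<Sum>(x, y)\<in>tie2 L. (\<kappa> * h) ^ 2)"
    proof (rule sum_mono, safe)
      fix x y assume "(x, y) \<in> tie2 L"
      then have "distinct [x, y]" by (auto simp: tie2_def)
      from prob_occupied[OF h this]
      show "prob (all_occupied h [x, y]) \<le> (\<kappa> * h) ^ 2"
        by (simp add: eval_nat_numeral)
    qed
    also have "\<dots> = real (card (tie2 L)) * (\<kappa> * h) ^ 2" by simp
    also have "\<dots> \<le> real (12 * (2 * L + 1)) * (\<kappa> * h) ^ 2"
      using tie2_finite(2)[of L] e by (intro mult_right_mono) (auto simp only: of_nat_le_iff zero_le_power)
    also have "\<dots> = 12 * (real (2 * L + 1) * (\<kappa> * h) * (\<kappa> * h))"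
      by (simp add: power2_eq_square algebra_simps)
    finally show ?thesis using V1 by linarith
  qed
  have "prob (congested h L) \<le> prob ?U0 + prob ?U1 + prob ?U2 + prob ?U3"
    unfolding congested_def using m
    by (intro order.trans[OF measure_Un_le] add_right_mono) auto
  also have "\<dots> \<le> \<kappa> * h + V * (\<kappa> * h) + 6 * V\<^sup>2 * (\<kappa> * h) + 12 * V * (\<kappa> * h)"
    by (intro add_mono p0 p1 p2 p3)
  also have "\<dots> = \<kappa> * h * (1 + 13 * V + 6 * V\<^sup>2)" by (simp add: algebra_simps)
  finally show ?thesis .
qed

section \<open>Reading the points off the cells outside the congested event\<close>

lemma cells_card:
  assumes "h > 0"
  shows "cells h j \<omega> = (card {x\<in>B \<omega>. cell h x = j}, card {x\<in>R \<omega>. cell h x = j})"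
proof -
  have "S \<inter> {(real_of_int j - 1 / 2) * h<..(real_of_int j + 1 / 2) * h} = {x\<in>S. cell h x = j}" for S
    using cell_eq_iff[OF assms] by auto
  then show ?thesis by (simp add: cells_def npts_def)
qed

lemma finite_cell:
  assumes "\<omega> \<in> space M" "h > 0"
  shows "finite {x\<in>B \<omega>. cell h x = j}" "finite {x\<in>R \<omega>. cell h x = j}"
proof -
  have "{x\<in>S. cell h x = j} \<subseteq> S \<inter> {(real_of_int j - 1 / 2) * h..(real_of_int j + 1 / 2) * h}" for S
    using cell_eq_iff[OF assms(2)] by auto
  then show "finite {x\<in>B \<omega>. cell h x = j}" "finite {x\<in>R \<omega>. cell h x = j}"
    using finB[OF assms(1)] finR[OF assms(1)] finite_subset by metis+
qed

lemma palm_symD: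
  assumes "\<omega> \<in> space M" "h > 0"
  shows "palm_sym h \<omega> j = 1 \<Longrightarrow> \<exists>x\<in>insert 0 (B \<omega>). cell h x = j"
    "palm_sym h \<omega> j = -1 \<Longrightarrow> \<exists>x\<in>R \<omega>. cell h x = j"
proof -
  show "\<exists>x\<in>insert 0 (B \<omega>). cell h x = j" if "palm_sym h \<omega> j = 1"
  proof (cases "j = 0")
    case False
    then have "card {x\<in>B \<omega>. cell h x = j} = 1"
      using that by (auto simp: palm_sym_def cell_sym_def cells_card[OF assms(2)] split: if_splits)
    then have "{x\<in>B \<omega>. cell h x = j} \<noteq> {}" by (metis card.empty zero_neq_one)
    then show ?thesis by blast
  qed auto
  show "\<exists>x\<in>R \<omega>. cell h x = j" if "palm_sym h \<omega> j = -1"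
  proof -
    have "card {x\<in>R \<omega>. cell h x = j} = 1"
      using that by (auto simp: palm_sym_def cell_sym_def cells_card[OF assms(2)] split: if_splits)
    then have "{x\<in>R \<omega>. cell h x = j} \<noteq> {}" by (metis card.empty zero_neq_one)
    then show ?thesis by blast
  qed
qed

context
  fixes h :: real and L :: nat and \<omega> :: 'a
  assumes \<omega>: "\<omega> \<in> space M" "\<omega> \<notin> congested h L" and h: "h > 0"
begin

lemma cell_0_empty: "x \<in> B \<omega> \<union> R \<omega> \<Longrightarrow> cell h x \<noteq> 0"
proof
  assume x: "x \<in> B \<omega> \<union> R \<omega>" "cell h x = 0"
  have "cells h 0 \<omega> = (0, 0)" using \<omega> by (auto simp: congested_def)
  then have "{x\<in>B \<omega>. cell h x = 0} = {}" "{x\<in>R \<omega>. cell h x = 0} = {}"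
    using finite_cell[OF \<omega>(1) h] by (auto simp: cells_card[OF h])
  then show False using x by blast
qed

lemma occupied: "x \<in> B \<omega> \<union> R \<omega> \<Longrightarrow> cells h (cell h x) \<omega> \<noteq> (0, 0)"
  using finite_cell[OF \<omega>(1) h] by (auto simp: cells_card[OF h])

lemma cell_le_1: "\<bar>j\<bar> \<le> int L \<Longrightarrow> fst (cells h j \<omega>) + snd (cells h j \<omega>) \<le> 1"
proof (rule ccontr)
  assume "\<bar>j\<bar> \<le> int L" "\<not> fst (cells h j \<omega>) + snd (cells h j \<omega>) \<le> 1"
  then have "j \<in> {- int L..int L}" "2 \<le> fst (cells h j \<omega>) + snd (cells h j \<omega>)" by auto
  then show False using \<omega> unfolding congested_def by blast
qed

lemma sym_blue:
  assumes "x \<in> B \<omega>" "\<bar>cell h x\<bar> \<le> int L"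
  shows "cells h (cell h x) \<omega> = (1, 0)" "\<And>y. y \<in> B \<omega> \<union> R \<omega> \<Longrightarrow> cell h y = cell h x \<Longrightarrow> y = x"
proof -
  let ?A = "{y\<in>B \<omega>. cell h y = cell h x}" and ?A' = "{y\<in>R \<omega>. cell h y = cell h x}"
  have fin: "finite ?A" "finite ?A'" using finite_cell[OF \<omega>(1) h] by auto
  have "?A \<noteq> {}" using assms by blast
  then have "card ?A \<noteq> 0" using fin by simp
  then have c: "card ?A = 1" "card ?A' = 0"
    using cell_le_1[OF assms(2)] by (auto simp: cells_card[OF h])
  then show "cells h (cell h x) \<omega> = (1, 0)" by (simp add: cells_card[OF h])
  obtain a where A: "?A = {a}" using c(1) by (auto simp: card_1_singleton_iff)
  have A': "?A' = {}" using c(2) fin by simp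
  have mem: "y = a" if "y \<in> B \<omega> \<union> R \<omega>" "cell h y = cell h x" for y
  proof -
    have "y \<in> ?A \<union> ?A'" using that by blast
    then show ?thesis unfolding A A' by simp
  qed
  show "y = x" if "y \<in> B \<omega> \<union> R \<omega>" "cell h y = cell h x" for y
    using mem[OF that] mem[of x] assms by simp
qed

lemma sym_red:
  assumes "x \<in> R \<omega>" "\<bar>cell h x\<bar> \<le> int L"
  shows "cells h (cell h x) \<omega> = (0, 1)" "\<And>y. y \<in> B \<omega> \<union> R \<omega> \<Longrightarrow> cell h y = cell h x \<Longrightarrow> y = x"
proof -
  let ?A = "{y\<in>R \<omega>. cell h y = cell h x}" and ?A' = "{y\<in>B \<omega>. cell h y = cell h x}"
  have fin: "finite ?A" "finite ?A'" using finite_cell[OF \<omega>(1) h] by auto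
  have "?A \<noteq> {}" using assms by blast
  then have "card ?A \<noteq> 0" using fin by simp
  then have c: "card ?A = 1" "card ?A' = 0"
    using cell_le_1[OF assms(2)] by (auto simp: cells_card[OF h])
  then show "cells h (cell h x) \<omega> = (0, 1)" by (simp add: cells_card[OF h])
  obtain a where A: "?A = {a}" using c(1) by (auto simp: card_1_singleton_iff)
  have A': "?A' = {}" using c(2) fin by simp
  have mem: "y = a" if "y \<in> B \<omega> \<union> R \<omega>" "cell h y = cell h x" for y
  proof -
    have "y \<in> ?A \<union> ?A'" using that by blast
    then show ?thesis unfolding A A' by simp
  qed
  show "y = x" if "y \<in> B \<omega> \<union> R \<omega>" "cell h y = cell h x" for y
    using mem[OF that] mem[of x] assms by simp
qed

abbreviation "points \<equiv> insert 0 (B \<omega>) \<union> R \<omega>"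

lemma palm_sym_blue: "x \<in> insert 0 (B \<omega>) \<Longrightarrow> \<bar>cell h x\<bar> \<le> int L \<Longrightarrow> palm_sym h \<omega> (cell h x) = 1"
  using sym_blue(1)[of x] cell_0_empty[of x] by (auto simp: palm_sym_def cell_sym_def)

lemma palm_sym_red: "x \<in> R \<omega> \<Longrightarrow> \<bar>cell h x\<bar> \<le> int L \<Longrightarrow> palm_sym h \<omega> (cell h x) = -1"
  using sym_red(1)[of x] cell_0_empty[of x] by (auto simp: palm_sym_def cell_sym_def)

lemma cell_inj:
  assumes "x \<in> points" "y \<in> points" "\<bar>cell h x\<bar> \<le> int L" "cell h x = cell h y"
  shows "x = y"
proof (cases "x = 0 \<or> y = 0")
  case True
  then show ?thesis using assms cell_0_empty[of x] cell_0_empty[of y] by auto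
next
  case False
  then have y: "y \<in> B \<omega> \<union> R \<omega>" and "x \<in> B \<omega> \<or> x \<in> R \<omega>" using assms by auto
  then show ?thesis
    using sym_blue(2)[OF _ assms(3) y assms(4)[symmetric]] sym_red(2)[OF _ assms(3) y assms(4)[symmetric]] by blast
qed

lemma no_near_ties:
  assumes "x \<in> points" "y \<in> points" "z \<in> points" "x \<noteq> y" "x \<noteq> z" "y \<noteq> z"
    and L: "\<bar>cell h x\<bar> \<le> int L" "\<bar>cell h y\<bar> \<le> int L" "\<bar>cell h z\<bar> \<le> int L"
  shows "\<bar>\<bar>cell h x - cell h y\<bar> - \<bar>cell h x - cell h z\<bar>\<bar> > 1"
proof (rule ccontr)
  assume "\<not> ?thesis"
  then have tie: "\<bar>\<bar>cell h x - cell h y\<bar> - \<bar>cell h x - cell h z\<bar>\<bar> \<le> 1" by simp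
  have ne: "cell h x \<noteq> cell h y" "cell h x \<noteq> cell h z" "cell h y \<noteq> cell h z"
    using cell_inj[of x y] cell_inj[of x z] cell_inj[of y z] assms by auto
  have no2: False if "(cell h u, cell h v) \<in> tie2 L" "u \<in> B \<omega> \<union> R \<omega>" "v \<in> B \<omega> \<union> R \<omega>" for u v
  proof -
    have "\<omega> \<in> all_occupied h [cell h u, cell h v]"
      unfolding all_occupied_def using \<omega>(1) occupied[OF that(2)] occupied[OF that(3)] by (auto simp: less_Suc_eq)
    then show False using \<omega> that(1) unfolding congested_def by blast
  qed
  show False
  proof (cases "x = 0 \<or> y = 0 \<or> z = 0")
    case False
    then have P: "x \<in> B \<omega> \<union> R \<omega>" "y \<in> B \<omega> \<union> R \<omega>" "z \<in> B \<omega> \<union> R \<omega>" using assms by auto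
    have "\<omega> \<in> all_occupied h [cell h x, cell h y, cell h z]"
      unfolding all_occupied_def using \<omega>(1) occupied[OF P(1)] occupied[OF P(2)] occupied[OF P(3)] by (auto simp: less_Suc_eq)
    moreover have "(cell h x, cell h y, cell h z) \<in> tie3 L"
      using nearI[OF tie] L ne by (auto simp: tie3_def)
    ultimately show False using \<omega> unfolding congested_def by blast
  next
    case True
    then consider "x = 0" "y \<noteq> 0" "z \<noteq> 0" | "y = 0" "x \<noteq> 0" "z \<noteq> 0" | "z = 0" "x \<noteq> 0" "y \<noteq> 0"
      using assms by blast
    then show False
    proof cases
      case 1
      then have "(cell h y, cell h z) \<in> tie2 L" using nearI[OF tie] L ne by (auto simp: tie2_def)
      then show False using no2[of y z] 1 assms by auto
    next
      case 2
      then have "(cell h x, cell h z) \<in> tie2 L" using nearI[OF tie] L ne by (auto simp: tie2_def)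
      then show False using no2[of x z] 2 assms by auto
    next
      case 3
      have "\<bar>\<bar>cell h x - cell h z\<bar> - \<bar>cell h x - cell h y\<bar>\<bar> \<le> 1" using tie by linarith
      from nearI[OF this] have "(cell h x, cell h y) \<in> tie2 L" using L ne 3 by (auto simp: tie2_def)
      then show False using no2[of x y] 3 assms by auto
    qed
  qed
qed

end

end

section \<open>Passage to the continuum\<close>

lemma cell_abs_le:
  assumes "h > 0" "\<bar>x\<bar> \<le> real a * h"
  shows "\<bar>cell h x\<bar> \<le> int a + 1"
proof -
  have "\<bar>x / h\<bar> \<le> real a" using assms by (simp add: abs_divide divide_le_eq)
  then show ?thesis unfolding cell_def by linarith
qed

lemma min_le_sum_steps:
  fixes f :: ennreal
  assumes "h \<ge> 0"
  shows "min f (ennreal (real K * h)) \<le> ennreal (\<Sum>D<K. h * of_bool (ennreal (real D * h) < f))"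
proof (induction K)
  case (Suc K)
  let ?S = "\<Sum>D<K. h * of_bool (ennreal (real D * h) < f)"
  have S: "0 \<le> ?S" using assms by (intro sum_nonneg) auto
  show ?case
  proof (cases "ennreal (real K * h) < f")
    case True
    then have "ennreal (real K * h) \<le> ennreal ?S" using Suc by (simp add: min_def split: if_splits)
    then have "real K * h \<le> ?S" using S by (simp add: ennreal_le_iff)
    then have "ennreal (real (Suc K) * h) \<le> ennreal (?S + h)"
      by (intro ennreal_leI) (simp add: algebra_simps)
    then show ?thesis using True by (simp add: min.coboundedI2)
  next
    case False
    then have "f \<le> ennreal ?S" using Suc by (simp add: not_less min_absorb1)
    moreover have "(\<Sum>D<Suc K. h * of_bool (ennreal (real D * h) < f)) = ?S" using False by simp
    ultimately show ?thesis by (metis min.coboundedI1)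
  qed
qed simp

text \<open>The function f need not be measurable: its integral is a supremum over simple minorants.\<close>

lemma nn_integral_le_of_truncations:
  assumes "\<And>T. T \<ge> (1::nat) \<Longrightarrow> (\<integral>\<^sup>+x. min (f x) (ennreal (real T)) \<partial>M) \<le> c"
  shows "(\<integral>\<^sup>+x. f x \<partial>M) \<le> c"
  unfolding nn_integral_def[of M f]
proof (rule SUP_least)
  fix g assume "g \<in> {g. simple_function M g \<and> g \<le> f}"
  then have g: "simple_function M g" "g \<le> f" by auto
  have gm: "g \<in> borel_measurable M" using g(1) by (rule borel_measurable_simple_function)
  have sup: "(SUP T. min (g x) (ennreal (real T))) = g x" for x
  proof -
    have "(SUP T::nat. inf (g x) (ennreal (real T))) = inf (g x) (SUP T::nat. ennreal (real T))"
      by (rule inf_SUP[symmetric])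
    then show ?thesis by (simp add: inf_min ennreal_of_nat_eq_real_of_nat[symmetric] ennreal_SUP_of_nat_eq_top)
  qed
  have "integral\<^sup>S M g = (\<integral>\<^sup>+x. g x \<partial>M)" using g by (simp add: nn_integral_eq_simple_integral)
  also have "\<dots> = (\<integral>\<^sup>+x. (SUP T. min (g x) (ennreal (real T))) \<partial>M)" by (simp only: sup)
  also have "\<dots> = (SUP T. (\<integral>\<^sup>+x. min (g x) (ennreal (real T)) \<partial>M))"
    using gm by (intro nn_integral_monotone_convergence_SUP incseq_SucI le_funI min.mono ennreal_leI) auto
  also have "\<dots> \<le> c"
  proof (rule SUP_least)
    fix T :: nat
    have "(\<integral>\<^sup>+x. min (g x) (ennreal (real T)) \<partial>M) \<le> (\<integral>\<^sup>+x. min (f x) (ennreal (real (Suc T))) \<partial>M)"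
      using g(2) by (intro nn_integral_mono min.mono ennreal_leI) (auto simp: le_fun_def)
    also have "\<dots> \<le> c" by (rule assms) simp
    finally show "(\<integral>\<^sup>+x. min (g x) (ennreal (real T)) \<partial>M) \<le> c" .
  qed
  finally show "integral\<^sup>S M g \<le> c" .
qed

section \<open>Almost sure regularity of the configuration\<close>

context poisson_pair
begin

lemma AE_empty_cell:
  assumes d: "d > 0" and f: "inj f"
  shows "AE \<omega> in M. \<exists>k::nat. cells d (f k) \<omega> = (0, 0)"
proof -
  let ?N = "{\<omega>\<in>space M. \<not> (\<exists>k. cells d (f k) \<omega> = (0, 0))}"
  let ?e = "1 - exp (- (\<kappa> * d))"
  have N: "?N \<in> events"
    by (intro sets.sets_Collect_neg sets.sets_Collect_countable_Ex sets_cells[OF d])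
  have le: "prob ?N \<le> ?e ^ J" for J
  proof -
    have "?N \<subseteq> all_occupied d (map f [0..<J])" by (auto simp: all_occupied_def)
    then have "prob ?N \<le> prob (all_occupied d (map f [0..<J]))"
      by (rule finite_measure_mono[OF _ sets_occupied[OF d]])
    also have "\<dots> = ?e ^ J"
      using f by (subst prob_occupied_eq[OF d]) (auto simp: distinct_map inj_on_def)
    finally show ?thesis .
  qed
  have "(\<lambda>J. ?e ^ J) \<longlonglongrightarrow> 0" using d lam_pos mu_pos by (intro LIMSEQ_realpow_zero) auto
  then have "prob ?N \<le> 0" using le by (intro LIMSEQ_le_const) auto
  then have "prob ?N = 0" using measure_nonneg[of M ?N] by linarith
  then show ?thesis using N by (subst AE_iff_measurable[OF _ refl]) (auto simp: emeasure_eq_measure)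
qed

text \<open>One good mesh per window suffices, so the probabilities only have to tend to 0 and need
  not be summable. The bound \<open>N * Suc K + 1\<close> on the cell index covers all points of
  absolute value at most N.\<close>

lemma AE_uncongested: "AE \<omega> in M. \<exists>K. \<omega> \<notin> congested (1 / real (Suc K)) (N * Suc K + 1)"
proof -
  let ?C = "\<lambda>K. congested (1 / real (Suc K)) (N * Suc K + 1)"
  have C: "?C K \<in> events" for K by (rule sets_congested) simp
  define V where "V = (2 * real N + 3) * \<kappa>"
  have le: "prob (\<Inter>K. ?C K) \<le> \<kappa> * (1 / real (Suc K)) * (1 + 13 * V + 6 * V\<^sup>2)" for K
  proof -
    have "prob (\<Inter>K. ?C K) \<le> prob (?C K)" using C by (intro finite_measure_mono) auto
    also have "\<dots> \<le> \<kappa> * (1 / real (Suc K)) * (1 + 13 * V + 6 * V\<^sup>2)"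
    proof (rule prob_congested)
      have "real (2 * (N * Suc K + 1) + 1) \<le> (2 * real N + 3) * real (Suc K)"
        by (simp add: algebra_simps)
      then have "real (2 * (N * Suc K + 1) + 1) / real (Suc K) \<le> 2 * real N + 3"
        by (simp only: divide_le_eq of_nat_0_less_iff zero_less_Suc if_True)
      then have "real (2 * (N * Suc K + 1) + 1) / real (Suc K) * \<kappa> \<le> V"
        unfolding V_def using lam_pos mu_pos by (intro mult_right_mono) auto
      then show "real (2 * (N * Suc K + 1) + 1) * (\<kappa> * (1 / real (Suc K))) \<le> V" by (simp add: mult.commute)
    qed simp
    finally show ?thesis .
  qed
  have "(\<lambda>K. \<kappa> * (1 / real (Suc K)) * (1 + 13 * V + 6 * V\<^sup>2)) \<longlonglongrightarrow> \<kappa> * 0 * (1 + 13 * V + 6 * V\<^sup>2)"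
    using LIMSEQ_inverse_real_of_nat by (intro tendsto_intros) (simp add: inverse_eq_divide)
  then have "prob (\<Inter>K. ?C K) \<le> \<kappa> * 0 * (1 + 13 * V + 6 * V\<^sup>2)"
    by (rule LIMSEQ_le_const) (use le in blast)
  then have "prob (\<Inter>K. ?C K) \<le> 0" by (simp only: mult_zero_right mult_zero_left)
  then have "prob (\<Inter>K. ?C K) = 0" by (simp only: measure_le_0_iff)
  moreover have "(\<Inter>K. ?C K) \<in> events" using C by (intro sets.countable_INT) auto
  ultimately show ?thesis by (intro AE_I[of _ _ "\<Inter>K. ?C K"]) (auto simp: emeasure_eq_measure)
qed

lemma empty_cell_gap:
  assumes "\<omega> \<in> space M" "h > 0" "cells h j \<omega> = (0, 0)" "x \<in> B \<omega> \<union> R \<omega>"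
  shows "cell h x \<noteq> j"
  using assms finite_cell[OF assms(1,2)] by (auto simp: cells_card)

text \<open>Integer meshes, starting cells and windows reduce every condition to countably many
  events. Gaps are empty cells of mesh at least d; a coincidence or a tie would show up in a fine
  uncongested mesh.\<close>

lemma AE_point_config: "AE \<omega> in M. point_config (insert 0 (B \<omega>)) (R \<omega>)"
proof -
  have right: "AE \<omega> in M. \<forall>d m. \<exists>k. cells (real (Suc d)) (int m + 1 + int k) \<omega> = (0, 0)"
    unfolding AE_all_countable by (intro allI AE_empty_cell) (auto simp: inj_on_def)
  have left: "AE \<omega> in M. \<forall>d m. \<exists>k. cells (real (Suc d)) (- int m - 1 - int k) \<omega> = (0, 0)"
    unfolding AE_all_countable by (intro allI AE_empty_cell) (auto simp: inj_on_def)
  have unc: "AE \<omega> in M. \<forall>N. \<exists>K. \<omega> \<notin> congested (1 / real (Suc K)) (N * Suc K + 1)"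
    unfolding AE_all_countable by (intro allI AE_uncongested)
  show ?thesis
    using right left unc AE_space
  proof eventually_elim
    case (elim \<omega>)
    let ?P = "insert 0 (B \<omega>) \<union> R \<omega>"
    have window: "\<exists>K. \<omega> \<notin> congested (1 / real (Suc K)) (N * Suc K + 1) \<and>
        (\<forall>x. \<bar>x\<bar> \<le> real N \<longrightarrow> \<bar>cell (1 / real (Suc K)) x\<bar> \<le> int (N * Suc K + 1))" for N
    proof -
      obtain K where K: "\<omega> \<notin> congested (1 / real (Suc K)) (N * Suc K + 1)" using elim by blast
      have "\<bar>cell (1 / real (Suc K)) x\<bar> \<le> int (N * Suc K) + 1" if "\<bar>x\<bar> \<le> real N" for x
      proof (rule cell_abs_le)
        have "real N * real (Suc K) * (1 / real (Suc K)) = real N" by (simp del: of_nat_Suc)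
        then have "real (N * Suc K) * (1 / real (Suc K)) = real N" by (simp only: of_nat_mult)
        then show "\<bar>x\<bar> \<le> real (N * Suc K) * (1 / real (Suc K))" using that by simp
      qed simp
      then have "\<forall>x. \<bar>x\<bar> \<le> real N \<longrightarrow> \<bar>cell (1 / real (Suc K)) x\<bar> \<le> int (N * Suc K + 1)"
        by (simp only: of_nat_add of_nat_1) blast
      then show ?thesis using K by blast
    qed
    show ?case
    proof
      fix a b
      have "(?P \<inter> {a..b}) \<subseteq> {0} \<union> (B \<omega> \<inter> {a..b}) \<union> (R \<omega> \<inter> {a..b})" by blast
      then show "finite (?P \<inter> {a..b})"
        by (rule finite_subset) (use finB finR elim in auto)
    next
      show "insert 0 (B \<omega>) \<inter> R \<omega> = {}"
      proof (rule ccontr)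
        assume "insert 0 (B \<omega>) \<inter> R \<omega> \<noteq> {}"
        then obtain x where x: "x \<in> insert 0 (B \<omega>)" "x \<in> R \<omega>" by blast
        obtain N :: nat where N: "\<bar>x\<bar> \<le> real N" using real_arch_simple by blast
        obtain K where K: "\<omega> \<notin> congested (1 / real (Suc K)) (N * Suc K + 1)"
          "\<bar>cell (1 / real (Suc K)) x\<bar> \<le> int (N * Suc K + 1)" using window N by blast
        show False
          using palm_sym_blue[OF elim(4) K(1) _ x(1) K(2)] palm_sym_red[OF elim(4) K(1) _ x(2) K(2)] by simp
      qed
    next
      fix x y z assume P: "x \<in> ?P" "y \<in> ?P" "z \<in> ?P" and ne: "x \<noteq> y" "x \<noteq> z" "y \<noteq> z"
      show "\<bar>x - y\<bar> \<noteq> \<bar>x - z\<bar>"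
      proof
        assume eq: "\<bar>x - y\<bar> = \<bar>x - z\<bar>"
        obtain N :: nat where "\<bar>x\<bar> + \<bar>y\<bar> + \<bar>z\<bar> \<le> real N" using real_arch_simple by blast
        then have N: "\<bar>x\<bar> \<le> real N" "\<bar>y\<bar> \<le> real N" "\<bar>z\<bar> \<le> real N" by linarith+
        obtain K where K: "\<omega> \<notin> congested (1 / real (Suc K)) (N * Suc K + 1)"
          "\<And>x. \<bar>x\<bar> \<le> real N \<Longrightarrow> \<bar>cell (1 / real (Suc K)) x\<bar> \<le> int (N * Suc K + 1)" using window by blast
        define h where "h = 1 / real (Suc K)"
        have h: "h > 0" by (simp add: h_def)
        define a where "a = \<bar>cell h x - cell h y\<bar>"
        define b where "b = \<bar>cell h x - cell h z\<bar>"
        have "\<bar>a - b\<bar> > 1"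
          unfolding a_def b_def
          by (rule no_near_ties[OF elim(4) K(1)[folded h_def] h P ne]) (use K(2) N in \<open>auto simp: h_def\<close>)
        \<comment> \<open>Both scaled cell distances lie within h of the same number, so the
          integers differ by less than 2, against \<open>no_near_ties\<close>.\<close>
        moreover have "\<bar>h * real_of_int a - h * real_of_int b\<bar> < h * 2"
        proof -
          have "\<bar>\<bar>x - y\<bar> - h * real_of_int a\<bar> < h" "\<bar>\<bar>x - y\<bar> - h * real_of_int b\<bar> < h"
            using cell_dist[OF h, of x y] cell_dist[OF h, of x z] by (simp_all add: a_def b_def eq)
          then show ?thesis by linarith
        qed
        then have "h * \<bar>real_of_int a - real_of_int b\<bar> < h * 2"
          using h by (simp add: abs_mult right_diff_distrib[symmetric])
        then have "\<bar>real_of_int a - real_of_int b\<bar> < 2" using h by simp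
        ultimately show False by linarith
      qed
    next
      fix x d :: real
      obtain m :: nat where m: "\<bar>x\<bar> \<le> real m" using real_arch_simple by blast
      obtain d' :: nat where d': "\<bar>d\<bar> \<le> real d'" using real_arch_simple by blast
      define h where "h = real (Suc d')"
      have h: "h \<ge> 1" "h \<ge> d" using d' by (auto simp: h_def)
      obtain k where k: "cells h (int m + 1 + int k) \<omega> = (0, 0)" using elim h_def by metis
      define j where "j = int m + 1 + int k"
      define g where "g = (real_of_int j - 1 / 2) * h"
      have "real m * 1 \<le> (real_of_int j - 1 / 2) * h" using h by (intro mult_mono) (auto simp: j_def)
      then have g: "x \<le> g" "0 < g" using m h by (auto simp: g_def j_def)
      have "?P \<inter> {g<..g + d} = {}"
      proof (rule ccontr)
        assume "?P \<inter> {g<..g + d} \<noteq> {}"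
        then obtain y where "y \<in> ?P \<inter> {g<..g + d}" by blast
        then have y: "y \<in> ?P" "g < y" "y \<le> g + d" by auto
        have "cell h y = j" using y h by (subst cell_eq_iff) (auto simp: g_def algebra_simps)
        then show False using empty_cell_gap[OF elim(4) _ k, of y] y g h by (auto simp: j_def)
      qed
      then show "\<exists>g\<ge>x. ?P \<inter> {g<..g + d} = {}" using g by blast
    next
      fix x d :: real
      obtain m :: nat where m: "\<bar>x\<bar> \<le> real m" using real_arch_simple by blast
      obtain d' :: nat where d': "\<bar>d\<bar> \<le> real d'" using real_arch_simple by blast
      define h where "h = real (Suc d')"
      have h: "h \<ge> 1" "h \<ge> d" using d' by (auto simp: h_def)
      obtain k where k: "cells h (- int m - 1 - int k) \<omega> = (0, 0)" using elim h_def by metis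
      define j where "j = - int m - 1 - int k"
      define g where "g = (real_of_int j + 1 / 2) * h"
      have "real m * 1 \<le> (- (real_of_int j + 1 / 2)) * h" using h by (intro mult_mono) (auto simp: j_def)
      moreover have "0 < (- (real_of_int j + 1 / 2)) * h" using h by (intro mult_pos_pos) (auto simp: j_def)
      ultimately have g: "g \<le> x" "g < 0" using m unfolding g_def minus_mult_left[symmetric] by linarith+
      have "?P \<inter> {g - d<..g} = {}"
      proof (rule ccontr)
        assume "?P \<inter> {g - d<..g} \<noteq> {}"
        then obtain y where "y \<in> ?P \<inter> {g - d<..g}" by blast
        then have y: "y \<in> ?P" "g - d < y" "y \<le> g" by auto
        have "cell h y = j" using y h by (subst cell_eq_iff) (auto simp: g_def algebra_simps)
        then show False using empty_cell_gap[OF elim(4) _ k, of y] y g h by (auto simp: j_def)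
      qed
      then show "\<exists>g\<le>x. ?P \<inter> {g - d<..g} = {}" using g by blast
    qed
  qed
qed

section \<open>Error estimates and the limits in mesh, window and truncation\<close>

text \<open>
  An empty cell of mesh T on each side of the origin cuts out a core that no pair at distance
  less than T leaves; congestion is only excluded within this core.
\<close>

definition bad :: "nat \<Rightarrow> nat \<Rightarrow> nat \<Rightarrow> 'a set" where
  "bad T K J = congested (real T / real K) ((J + 1) * K) \<union>
     all_occupied (real T) (map (\<lambda>k. int k + 1) [0..<J]) \<union>
     all_occupied (real T) (map (\<lambda>k. - int k - 1) [0..<J])"

text \<open>The two empty cells of mesh T bound the core, and a pair that leaves it is at distance
  at least T; greedy edges of D < K cells are shorter than that.\<close>

lemma dist_imp_E_alive:
  fixes T K J D :: nat
  defines "h \<equiv> real T / real K"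
  assumes \<omega>: "\<omega> \<in> space M" "\<omega> \<notin> bad T K J" and pc: "point_config (insert 0 (B \<omega>)) (R \<omega>)"
    and T: "T \<ge> 1" and D: "D < K"
    and dist: "ennreal ((real D + 1) * h) < typical_blue_dist (B \<omega>) (R \<omega>)"
  shows "\<omega> \<in> E_alive h D"
proof -
  let ?P = "insert 0 (B \<omega>) \<union> R \<omega>"
  \<comment> \<open>The core lies within J T = J K h of the origin; rounding may cost one further
    cell, and K \<ge> 1 cells are allowed for it.\<close>
  define L where "L = (J + 1) * K"
  have K: "K \<ge> 1" using D by simp
  have h: "h > 0" using T K by (simp add: h_def)
  have T0: "real T > 0" using T by simp
  have unc: "\<omega> \<notin> congested h L" using \<omega> by (simp add: bad_def h_def L_def)
  obtain i where i: "i < J" "cells (real T) (int i + 1) \<omega> = (0, 0)"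
    using \<omega> by (auto simp: bad_def all_occupied_def)
  obtain i' where i': "i' < J" "cells (real T) (- int i' - 1) \<omega> = (0, 0)"
    using \<omega> by (auto simp: bad_def all_occupied_def)
  define g where "g = (real i + 1 / 2) * real T"
  define g' where "g' = - ((real i' + 1 / 2) * real T)"
  have gJ: "0 < g" "g \<le> real J * real T" "g' < 0" "- g' \<le> real J * real T"
  proof -
    have "0 < (real k + 1 / 2) * real T \<and> (real k + 1 / 2) * real T \<le> real J * real T" if "k < J" for k
      using that T0 by (intro conjI mult_pos_pos mult_right_mono) auto
    then show "0 < g" "g \<le> real J * real T" "g' < 0" "- g' \<le> real J * real T"
      using i(1) i'(1) unfolding g_def g'_def by fastforce+
  qed
  define C where "C = {g'<..g}"
  have gap: "y \<in> C" if "x \<in> C" "y \<in> ?P" "\<bar>x - y\<bar> < real T" for x y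
  proof (rule ccontr)
    assume y: "y \<notin> C"
    then have "y \<noteq> 0" using gJ by (auto simp: C_def)
    then have yP: "y \<in> B \<omega> \<union> R \<omega>" using that by blast
    have "g < y \<and> y \<le> g + real T \<or> g' - real T < y \<and> y \<le> g'" using y that by (auto simp: C_def)
    then show False
    proof
      assume "g < y \<and> y \<le> g + real T"
      then have "cell (real T) y = int i + 1"
        using T0 by (subst cell_eq_iff) (auto simp: g_def algebra_simps)
      then show False using empty_cell_gap[OF \<omega>(1) T0 i(2) yP] by simp
    next
      assume "g' - real T < y \<and> y \<le> g'"
      then have "cell (real T) y = - int i' - 1"
        using T0 by (subst cell_eq_iff) (auto simp: g'_def algebra_simps)
      then show False using empty_cell_gap[OF \<omega>(1) T0 i'(2) yP] by simp
    qed
  qed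
  have win: "\<bar>cell h x\<bar> \<le> int L" if "x \<in> C" for x
  proof -
    have "\<bar>x\<bar> \<le> real J * real T" using that gJ by (auto simp: C_def)
    also have "\<dots> = real (J * K) * h" using K by (simp add: h_def)
    finally have "\<bar>cell h x\<bar> \<le> int (J * K) + 1" by (rule cell_abs_le[OF h])
    also have "\<dots> \<le> int L" using K by (simp add: L_def)
    finally show ?thesis .
  qed
  have "alive (palm_sym h \<omega>) D 0"
  proof (rule mdist_imp_alive[OF pc point_config.stable_matching_stable[OF pc] h, where \<tau> = "real T" and C = C])
    show "\<exists>x\<in>insert 0 (B \<omega>). cell h x = j" if "palm_sym h \<omega> j = 1" for j
      using palm_symD(1)[OF \<omega>(1) h that] .
    show "\<exists>x\<in>R \<omega>. cell h x = j" if "palm_sym h \<omega> j = -1" for j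
      using palm_symD(2)[OF \<omega>(1) h that] .
    show "y \<in> C" if "x \<in> C" "y \<in> ?P" "\<bar>x - y\<bar> < real T" for x y by (rule gap[OF that])
    show "palm_sym h \<omega> (cell h x) = 1" if "x \<in> insert 0 (B \<omega>) \<inter> C" for x
      using palm_sym_blue[OF \<omega>(1) unc h] that win by blast
    show "palm_sym h \<omega> (cell h x) = -1" if "x \<in> R \<omega> \<inter> C" for x
      using palm_sym_red[OF \<omega>(1) unc h] that win by blast
    show "\<bar>\<bar>cell h x - cell h y\<bar> - \<bar>cell h x - cell h z\<bar>\<bar> > 1"
      if "x \<in> ?P \<inter> C" "y \<in> ?P \<inter> C" "z \<in> ?P \<inter> C" "x \<noteq> y" "x \<noteq> z" "y \<noteq> z" for x y z
      using that win by (intro no_near_ties[OF \<omega>(1) unc h]) auto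
    have "(real D + 1) * h \<le> real K * h" using D h by (intro mult_right_mono) auto
    also have "\<dots> = real T" using K by (simp add: h_def)
    finally show "(real D + 1) * h \<le> real T" .
    show "0 \<in> C" using gJ by (simp add: C_def)
    show "ennreal ((real D + 1) * h) < Defs.mdist (stable_matching (insert 0 (B \<omega>)) (R \<omega>)) 0"
      using dist by (simp add: typical_blue_dist_def)
  qed simp
  then show ?thesis using \<omega> by (simp add: E_alive_def)
qed

lemma lazy_walk_cells:
  assumes "lam < mu" "h > 0"
  shows "lazy_walk (pB h) (pR h)"
proof
  show "0 < pB h" using lam_pos assms by simp
  show "pB h < pR h" using assms by simp
  have "pB h + pR h = \<kappa> * h * exp (- (\<kappa> * h))" by (simp add: algebra_simps)
  also have "\<dots> \<le> exp (\<kappa> * h) * exp (- (\<kappa> * h))"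
  proof (rule mult_right_mono)
    show "\<kappa> * h \<le> exp (\<kappa> * h)" using exp_ge_add_one_self[of "\<kappa> * h"] by linarith
  qed simp
  finally show "pB h + pR h \<le> 1" by (simp flip: exp_add)
qed

text \<open>The drift per cell is (mu - lam) h exp (- \<kappa> h), so the mesh cancels up to a
  factor that tends to 1, and the ratio inside the logarithm does not depend on h at all.\<close>

lemma sum_prob_E_alive:
  assumes lm: "lam < mu" and h: "h > 0"
  shows "(\<Sum>D<K. h * prob (E_alive h D)) \<le> (1 + ln (\<kappa> / (mu - lam))) * (1 / (mu - lam)) * exp (\<kappa> * h) + h / 2"
proof -
  interpret lazy_walk "pB h" "pR h" by (rule lazy_walk_cells[OF assms])
  have diff: "pR h - pB h = (mu - lam) * (h * exp (- (\<kappa> * h)))"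
    and sum: "pB h + pR h = \<kappa> * (h * exp (- (\<kappa> * h)))" by (simp_all add: algebra_simps)
  have pos: "h * exp (- (\<kappa> * h)) > 0" using h by simp
  have ratio: "(pB h + pR h) / (pR h - pB h) = \<kappa> / (mu - lam)"
    unfolding diff sum by (rule mult_divide_mult_cancel_right) (use pos in linarith)
  have "(\<Sum>D<K. h * prob (E_alive h D)) = h * (\<Sum>D<K. palm_alive (radius K) D)"
    unfolding sum_distrib_left
    using prob_E_alive(2)[OF h radius_mono lazy_walk_cells[OF assms]] by (intro sum.cong) auto
  also have "\<dots> \<le> h * ((1 + ln (\<kappa> / (mu - lam))) / (pR h - pB h) + 1 / 2)"
    using sum_palm_alive_le[OF order.refl, of K] h unfolding ratio by (intro mult_left_mono) auto
  also have "\<dots> = (1 + ln (\<kappa> / (mu - lam))) * (1 / (mu - lam)) * exp (\<kappa> * h) + h / 2"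
  proof -
    have "h * (a / (d * (h * w)) + 1 / 2) = a * (1 / d) * (1 / w) + h / 2" if "d > 0" "w > 0" for a d w :: real
      using h that by (simp add: field_simps)
    moreover have "exp (\<kappa> * h) = 1 / exp (- (\<kappa> * h))" by (simp add: exp_minus divide_inverse)
    ultimately show ?thesis unfolding diff using lm by simp
  qed
  finally show ?thesis .
qed

lemma sets_bad: "T \<ge> 1 \<Longrightarrow> K \<ge> 1 \<Longrightarrow> bad T K J \<in> events"
  unfolding bad_def by (intro sets.Un sets_congested sets_occupied) auto

lemma prob_bad:
  fixes T K J :: nat
  assumes T: "T \<ge> 1" and K: "K \<ge> 1"
  defines "V \<equiv> real (2 * J + 3) * (\<kappa> * real T)"
  shows "prob (bad T K J) \<le> \<kappa> * (real T / real K) * (1 + 13 * V + 6 * V\<^sup>2) + 2 * (1 - exp (- (\<kappa> * real T))) ^ J"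
proof -
  let ?h = "real T / real K"
  have h: "?h > 0" using T K by simp
  have e: "0 \<le> \<kappa> * ?h" using h lam_pos mu_pos by simp
  have "real (2 * ((J + 1) * K) + 1) * (\<kappa> * ?h) \<le> real ((2 * J + 3) * K) * (\<kappa> * ?h)"
    using K e by (intro mult_right_mono) (auto simp: algebra_simps)
  also have "\<dots> = V" using K by (simp add: V_def)
  finally have c: "prob (congested ?h ((J + 1) * K)) \<le> \<kappa> * ?h * (1 + 13 * V + 6 * V\<^sup>2)"
    by (rule prob_congested[OF h])
  have o: "prob (all_occupied (real T) (map f [0..<J])) = (1 - exp (- (\<kappa> * real T))) ^ J" if "inj f" for f
    using T that by (subst prob_occupied_eq) (auto simp: distinct_map inj_on_def)
  have "prob (bad T K J) \<le> prob (congested ?h ((J + 1) * K)) +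
      prob (all_occupied (real T) (map (\<lambda>k. int k + 1) [0..<J])) +
      prob (all_occupied (real T) (map (\<lambda>k. - int k - 1) [0..<J]))"
    unfolding bad_def using h T
    by (intro order.trans[OF measure_Un_le] add_right_mono) (auto intro!: sets_congested sets_occupied)
  also have "\<dots> \<le> \<kappa> * ?h * (1 + 13 * V + 6 * V\<^sup>2) + 2 * (1 - exp (- (\<kappa> * real T))) ^ J"
    using c by (subst (1 2) o) (auto simp: inj_on_def)
  finally show ?thesis .
qed

text \<open>Measurability of the matching distance is not at hand, so it is dominated almost
  everywhere by a combination of indicators of events. On the bad event the dominating value is at
  least T.\<close>

lemma truncated_integral_le:
  assumes lm: "lam < mu" and T: "T \<ge> 1" and K: "K \<ge> 1"
  defines "h \<equiv> real T / real K"
  shows "(\<integral>\<^sup>+ \<omega>. min (typical_blue_dist (B \<omega>) (R \<omega>)) (ennreal (real T)) \<partial>M)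
     \<le> ennreal (h + (\<Sum>D<K. h * prob (E_alive h D)) + real T * prob (bad T K J))"
proof -
  have h: "h > 0" using T K by (simp add: h_def)
  have E: "E_alive h D \<in> events" for D
    by (rule prob_E_alive(1)[OF h order.refl lazy_walk_cells[OF lm h]])
  let ?g = "\<lambda>\<omega>. h + (\<Sum>D<K. h * indicator (E_alive h D) \<omega>) + real T * indicator (bad T K J) \<omega> :: real"
  have "(\<integral>\<^sup>+ \<omega>. min (typical_blue_dist (B \<omega>) (R \<omega>)) (ennreal (real T)) \<partial>M) \<le> (\<integral>\<^sup>+ \<omega>. ennreal (?g \<omega>) \<partial>M)"
  proof (rule nn_integral_mono_AE)
    show "AE \<omega> in M. min (typical_blue_dist (B \<omega>) (R \<omega>)) (ennreal (real T)) \<le> ennreal (?g \<omega>)"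
      using AE_point_config AE_space
    proof eventually_elim
      case (elim \<omega>)
      let ?f = "typical_blue_dist (B \<omega>) (R \<omega>)"
      show ?case
      proof (cases "\<omega> \<in> bad T K J")
        case True
        have "real T \<le> ?g \<omega>" using True h by (auto intro!: add_increasing sum_nonneg)
        then have "ennreal (real T) \<le> ennreal (?g \<omega>)" by (rule ennreal_leI)
        then show ?thesis by (rule min.coboundedI2)
      next
        case False
        obtain K' where K': "K = Suc K'" using K by (cases K) auto
        have "min ?f (ennreal (real K * h)) \<le> ennreal (\<Sum>D<K. h * of_bool (ennreal (real D * h) < ?f))"
          using h by (intro min_le_sum_steps) simp
        also have "\<dots> \<le> ennreal (?g \<omega>)"
        proof (rule ennreal_leI)
          \<comment> \<open>The layer D = 0 is paid for by the summand h. The other layers shift by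
            one, because passing from cells to points may add one mesh width to a distance.\<close>
          have "(\<Sum>D<K. h * of_bool (ennreal (real D * h) < ?f)) =
            h * of_bool (0 < ?f) + (\<Sum>D<K'. h * of_bool (ennreal (real (Suc D) * h) < ?f))"
            unfolding K' by (subst sum.lessThan_Suc_shift) simp
          also have "\<dots> \<le> h + (\<Sum>D<K'. h * indicator (E_alive h D) \<omega>)"
          proof (intro add_mono sum_mono mult_left_mono)
            fix D assume "D \<in> {..<K'}"
            then have "D < K" by (simp add: K')
            then show "of_bool (ennreal (real (Suc D) * h) < ?f) \<le> (indicator (E_alive h D) \<omega> :: real)"
              using dist_imp_E_alive[OF elim(2) False elim(1) T, of D]
              by (auto simp: indicator_def h_def add.commute)
          qed (use h in auto)
          also have "\<dots> \<le> ?g \<omega>" unfolding K' using h by simp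
          finally show "(\<Sum>D<K. h * of_bool (ennreal (real D * h) < ?f)) \<le> ?g \<omega>" .
        qed
        also have "real K * h = real T" using K by (simp add: h_def)
        finally show ?thesis .
      qed
    qed
  qed
  also have "\<dots> = ennreal (h + (\<Sum>D<K. h * prob (E_alive h D)) + real T * prob (bad T K J))"
  proof -
    have ind: "integrable M (\<lambda>\<omega>. a * indicator A \<omega> :: real)" "(\<integral>\<omega>. a * indicator A \<omega> \<partial>M) = a * prob A"
      if "A \<in> events" for a A
      using that by (auto simp: less_top[symmetric] intro!: integrable_real_indicator)
    have int: "integrable M (\<lambda>\<omega>. h)" "integrable M (\<lambda>\<omega>. \<Sum>D<K. h * indicator (E_alive h D) \<omega>)"
      "integrable M (\<lambda>\<omega>. real T * indicator (bad T K J) \<omega>)"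
      using ind(1) E sets_bad[OF T K] by (auto intro!: Bochner_Integration.integrable_sum simp del: sum_mult_indicator)
    have "(\<integral>\<^sup>+ \<omega>. ennreal (?g \<omega>) \<partial>M) = ennreal (\<integral>\<omega>. ?g \<omega> \<partial>M)"
    proof (rule nn_integral_eq_integral)
      show "integrable M ?g" by (intro Bochner_Integration.integrable_add int)
      show "AE \<omega> in M. 0 \<le> ?g \<omega>"
        using h by (intro AE_I2 add_nonneg_nonneg sum_nonneg mult_nonneg_nonneg) auto
    qed
    also have "(\<integral>\<omega>. ?g \<omega> \<partial>M) = (\<integral>\<omega>. h \<partial>M) + (\<Sum>D<K. \<integral>\<omega>. h * indicator (E_alive h D) \<omega> \<partial>M) +
        (\<integral>\<omega>. real T * indicator (bad T K J) \<omega> \<partial>M)"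
      using E ind(1)
      by (simp only: Bochner_Integration.integral_add int Bochner_Integration.integrable_add Bochner_Integration.integral_sum)
    also have "\<dots> = h + (\<Sum>D<K. h * prob (E_alive h D)) + real T * prob (bad T K J)"
      by (simp only: ind(2) E sets_bad[OF T K]) (simp add: prob_space)
    finally show ?thesis .
  qed
  finally show ?thesis .
qed

text \<open>The order of the limits matters: the congestion bound grows with J and T, so the mesh h
  = T / (K + 1) goes to 0 first, then J to infinity removes the chance of finding no empty cell, and
  the truncation T is lifted last.\<close>

lemma expected_dist_le:
  assumes lm: "lam < mu"
  shows "(\<integral>\<^sup>+ \<omega>. typical_blue_dist (B \<omega>) (R \<omega>) \<partial>M) \<le> ennreal ((1 + ln (\<kappa> / (mu - lam))) * (1 / (mu - lam)))"
proof (rule nn_integral_le_of_truncations)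
  fix T :: nat assume T: "T \<ge> 1"
  let ?I = "\<integral>\<^sup>+ \<omega>. min (typical_blue_dist (B \<omega>) (R \<omega>)) (ennreal (real T)) \<partial>M"
  define c where "c = (1 + ln (\<kappa> / (mu - lam))) * (1 / (mu - lam))"
  define \<theta> where "\<theta> = 1 - exp (- (\<kappa> * real T))"
  define V where "V J = real (2 * J + 3) * (\<kappa> * real T)" for J
  have le1: "?I \<le> ennreal (c + real T * (2 * \<theta> ^ J))" for J
  proof -
    define h where "h K = real T / real (Suc K)" for K
    define u where "u K = h K + (c * exp (\<kappa> * h K) + h K / 2) +
       real T * (\<kappa> * h K * (1 + 13 * V J + 6 * (V J)\<^sup>2) + 2 * \<theta> ^ J)" for K
    have "?I \<le> ennreal (u K)" for K
    proof -
      have hK: "h K > 0" using T by (simp add: h_def)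
      have "?I \<le> ennreal (h K + (\<Sum>D<Suc K. h K * prob (E_alive (h K) D)) + real T * prob (bad T (Suc K) J))"
        unfolding h_def by (rule truncated_integral_le[OF lm T]) simp
      also have "\<dots> \<le> ennreal (u K)"
      proof -
        have "prob (bad T (Suc K) J) \<le> \<kappa> * h K * (1 + 13 * V J + 6 * (V J)\<^sup>2) + 2 * \<theta> ^ J"
          unfolding h_def V_def \<theta>_def by (rule prob_bad[OF T]) simp
        then show ?thesis
          unfolding u_def using sum_prob_E_alive[OF lm hK, of "Suc K"] unfolding c_def[symmetric]
          by (intro ennreal_leI add_mono mult_left_mono) auto
      qed
      finally show ?thesis .
    qed
    moreover have "(\<lambda>K. ennreal (u K)) \<longlonglongrightarrow> ennreal (c + real T * (2 * \<theta> ^ J))"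
    proof -
      have "h \<longlonglongrightarrow> real T * 0"
        unfolding h_def divide_inverse by (intro tendsto_intros LIMSEQ_inverse_real_of_nat)
      then have h0: "h \<longlonglongrightarrow> 0" by simp
      have "u \<longlonglongrightarrow> 0 + (c * exp (\<kappa> * 0) + 0 / 2) + real T * (\<kappa> * 0 * (1 + 13 * V J + 6 * (V J)\<^sup>2) + 2 * \<theta> ^ J)"
        unfolding u_def by (intro tendsto_intros h0) simp
      then show ?thesis by (intro tendsto_ennrealI) simp
    qed
    ultimately show ?thesis by (intro LIMSEQ_le_const) auto
  qed
  have th: "norm \<theta> < 1" unfolding \<theta>_def using T lam_pos mu_pos by auto
  have "(\<lambda>J. c + real T * (2 * \<theta> ^ J)) \<longlonglongrightarrow> c + real T * (2 * 0)"
    by (intro tendsto_intros LIMSEQ_power_zero th)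
  then have "(\<lambda>J. ennreal (c + real T * (2 * \<theta> ^ J))) \<longlonglongrightarrow> ennreal c" by (intro tendsto_ennrealI) simp
  then have "?I \<le> ennreal c" using le1 by (intro LIMSEQ_le_const) auto
  then show "?I \<le> ennreal ((1 + ln (\<kappa> / (mu - lam))) * (1 / (mu - lam)))" by (simp add: c_def)
qed

end

theorem theorem4p7:
  fixes M :: "'a measure" and B R :: "'a \<Rightarrow> real set" and lam mu :: real
  assumes "0 < lam" and "lam < mu"
    and "indep_poisson_processes M lam mu B R"
  shows "(\<integral>\<^sup>+ \<omega>. typical_blue_dist (B \<omega>) (R \<omega>) \<partial>M)
           \<le> ennreal ((1 + ln ((mu + lam) / (mu - lam))) * (1 / (mu - lam)))"
proof -
  interpret poisson_pair M B R lam mu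
    using assms by unfold_locales auto
  show ?thesis using expected_dist_le[OF assms(2)] by (simp add: add.commute)
qed

end
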